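(* Let $\mathcal{M}=(M,\in^{\mathcal{M}})$ be a model (of any cardinality) of $\mathsf{ZF}+\exists p\,(\mathrm{V}=\mathrm{HOD}(p))$. Then $\mathcal{M}$ has a conservative elementary extension $\mathcal{N}$ such that $\mathcal{N}$ is taller than $\mathcal{M}$.
   Context: $\mathcal{L}_{\mathrm{set}}=\{=,\in\}$. For a structure $\mathcal{K}$ and $c\in K$, $\mathrm{Ext}_{\mathcal{K}}(c)=\{m\in K: m\in^{\mathcal{K}}c\}$. "Definable" always means first-order definable with parameters. $\mathcal{N}$ is a conservative extension of $\mathcal{M}$ (with $\mathcal{M}\subseteq\mathcal{N}$) if for every $\mathcal{N}$-definable set $D$, the set $D\cap M$ is $\mathcal{M}$-definable. $\mathcal{N}$ is taller than $\mathcal{M}$ if there is $b\in N$ with $M\subseteq \mathrm{Ext}_{\mathcal{N}}(b)$ (for models of $\mathsf{ZF}$ with $\mathcal{M}\preceq\mathcal{N}$ this is equivalent to $\mathcal{N}$ having an ordinal above all ordinals of $\mathcal{M}$). The sentence $\exists p\,(\mathrm{V}=\mathrm{HOD}(p))$ expresses: there is $p$ such that every set is first-order definable in some structure $(\mathrm{V}_\alpha,\in,p,\beta)_{\beta<\alpha}$ with $p\in \mathrm{V}_\alpha$; over $\mathsf{ZF}$ it is equivalent to the existence of a parametrically definable global well-ordering. *)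

theory Defs
  imports Main
begin

record 'a set_struct =
  univ :: "'a set"
  rel :: "'a \<Rightarrow> 'a \<Rightarrow> bool"

definition Ext :: "'a set_struct \<Rightarrow> 'a \<Rightarrow> 'a set" where
  "Ext K c = {m \<in> univ K. rel K m c}"

section \<open>First-order logic over the language of set theory\<close>

text \<open>Variables are de Bruijn indices: \<open>FEx\<close> binds index 0.\<close>

datatype fm = FEq nat nat | FMem nat nat | FNeg fm | FAnd fm fm | FEx fm

primrec sat :: "'a set_struct \<Rightarrow> (nat \<Rightarrow> 'a) \<Rightarrow> fm \<Rightarrow> bool" where
  "sat K s (FEq i j) \<longleftrightarrow> s i = s j"
| "sat K s (FMem i j) \<longleftrightarrow> rel K (s i) (s j)"
| "sat K s (FNeg \<phi>) \<longleftrightarrow> \<not> sat K s \<phi>"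
| "sat K s (FAnd \<phi> \<psi>) \<longleftrightarrow> sat K s \<phi> \<and> sat K s \<psi>"
| "sat K s (FEx \<phi>) \<longleftrightarrow> (\<exists>a\<in>univ K. sat K (case_nat a s) \<phi>)"

definition definable :: "'a set_struct \<Rightarrow> 'a set \<Rightarrow> bool" where
  "definable K D \<longleftrightarrow>
     (\<exists>\<phi> s. range s \<subseteq> univ K \<and> D = {a \<in> univ K. sat K (case_nat a s) \<phi>})"

definition substructure :: "'a set_struct \<Rightarrow> 'a set_struct \<Rightarrow> bool" where
  "substructure M N \<longleftrightarrow>
     univ M \<subseteq> univ N \<and> (\<forall>x\<in>univ M. \<forall>y\<in>univ M. rel M x y \<longleftrightarrow> rel N x y)"

definition elementary_extension :: "'a set_struct \<Rightarrow> 'a set_struct \<Rightarrow> bool" where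
  "elementary_extension M N \<longleftrightarrow> substructure M N \<and>
     (\<forall>\<phi> s. range s \<subseteq> univ M \<longrightarrow> (sat M s \<phi> \<longleftrightarrow> sat N s \<phi>))"

definition conservative_extension :: "'a set_struct \<Rightarrow> 'a set_struct \<Rightarrow> bool" where
  "conservative_extension M N \<longleftrightarrow> substructure M N \<and>
     (\<forall>D. definable N D \<longrightarrow> definable M (D \<inter> univ M))"

definition taller :: "'a set_struct \<Rightarrow> 'a set_struct \<Rightarrow> bool" where
  "taller M N \<longleftrightarrow> (\<exists>b\<in>univ N. univ M \<subseteq> Ext N b)"

text \<open>
  The isomorphic copy of a structure along a function that is injective on its universe. A
  structure on \<open>'a\<close> may exhaust its type, so extensions are taken of its copy along \<open>Inl\<close> in
  \<open>'a + 'a\<close>. For infinite structures this type is large enough: an elementary substructure of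
  \<open>N\<close> that contains \<open>M\<close> and the element witnessing \<open>taller M N\<close> is again a taller conservative
  elementary extension of \<open>M\<close>, and by Loewenheim-Skolem it can be chosen of the cardinality
  of \<open>M\<close>.
\<close>

definition struct_image :: "('a \<Rightarrow> 'b) \<Rightarrow> 'a set_struct \<Rightarrow> 'b set_struct" where
  "struct_image f M =
     \<lparr> univ = f ` univ M,
       rel = (\<lambda>x y. \<exists>a\<in>univ M. \<exists>b\<in>univ M. x = f a \<and> y = f b \<and> rel M a b) \<rparr>"

lemma sat_struct_image:
  assumes "inj_on f (univ M)" and "range s \<subseteq> univ M"
  shows "sat (struct_image f M) (f \<circ> s) \<phi> \<longleftrightarrow> sat M s \<phi>"
  using assms(2)
proof (induction \<phi> arbitrary: s)
  case (FEq i j)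
  have "s i \<in> univ M" "s j \<in> univ M"
    using FEq by auto
  then show ?case
    using assms(1) by (auto dest: inj_onD)
next
  case (FMem i j)
  have "s i \<in> univ M" "s j \<in> univ M"
    using FMem by auto
  then show ?case
    using assms(1) by (auto simp: struct_image_def dest: inj_onD)
next
  case (FEx \<phi>)
  have *: "case_nat (f a) (f \<circ> s) = f \<circ> case_nat a s" for a
    by (rule ext) (simp split: nat.split)
  have univ_image: "univ (struct_image f M) = f ` univ M"
    by (simp add: struct_image_def)
  have "range (case_nat a s) \<subseteq> univ M" if "a \<in> univ M" for a
    using that FEx.prems by (simp add: image_subset_iff split: nat.split)
  then show ?case
    using FEx.IH by (simp add: univ_image * del: comp_apply cong: bex_cong)
qed simp_all

section \<open>Models of ZF\<close>

text \<open>
  The clauses are the Tarskian truth conditions of the axioms in \<open>M\<close>; the two schemes range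
  over all formulas \<open>\<phi>\<close> and all parameters \<open>s\<close> from \<open>M\<close>.
\<close>

definition ZF_model :: "'a set_struct \<Rightarrow> bool" where
  "ZF_model M \<longleftrightarrow>
    \<comment> \<open>extensionality\<close>
    (\<forall>x\<in>univ M. \<forall>y\<in>univ M. Ext M x = Ext M y \<longrightarrow> x = y) \<and>
    \<comment> \<open>foundation\<close>
    (\<forall>x\<in>univ M. Ext M x \<noteq> {} \<longrightarrow> (\<exists>y\<in>Ext M x. Ext M y \<inter> Ext M x = {})) \<and>
    \<comment> \<open>pairing\<close>
    (\<forall>x\<in>univ M. \<forall>y\<in>univ M. \<exists>z\<in>univ M. Ext M z = {x, y}) \<and>
    \<comment> \<open>union\<close>
    (\<forall>x\<in>univ M. \<exists>u\<in>univ M. Ext M u = (\<Union>y\<in>Ext M x. Ext M y)) \<and>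
    \<comment> \<open>power set\<close>
    (\<forall>x\<in>univ M. \<exists>y\<in>univ M. Ext M y = {z \<in> univ M. Ext M z \<subseteq> Ext M x}) \<and>
    \<comment> \<open>infinity\<close>
    (\<exists>w\<in>univ M. (\<exists>z\<in>Ext M w. Ext M z = {}) \<and>
       (\<forall>y\<in>Ext M w. \<exists>z\<in>Ext M w. Ext M z = insert y (Ext M y))) \<and>
    \<comment> \<open>separation\<close>
    (\<forall>\<phi> s. range s \<subseteq> univ M \<longrightarrow>
       (\<forall>a\<in>univ M. \<exists>b\<in>univ M. Ext M b = {x \<in> Ext M a. sat M (case_nat x s) \<phi>})) \<and>
    \<comment> \<open>replacement\<close>
    (\<forall>\<phi> s. range s \<subseteq> univ M \<longrightarrow>
       (\<forall>a\<in>univ M.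
          (\<forall>x\<in>Ext M a. \<forall>y\<in>univ M. \<forall>z\<in>univ M.
             sat M (case_nat x (case_nat y s)) \<phi> \<and> sat M (case_nat x (case_nat z s)) \<phi>
               \<longrightarrow> y = z) \<longrightarrow>
          (\<exists>b\<in>univ M. Ext M b =
             {y \<in> univ M. \<exists>x\<in>Ext M a. sat M (case_nat x (case_nat y s)) \<phi>})))"

section \<open>Basic set-theoretic notions, interpreted in a structure\<close>

text \<open>
  From here on every predicate states the truth in \<open>M\<close> of a formula of set theory: all
  quantifiers are bounded by \<open>univ M\<close>, and the arguments of type \<open>'a\<close> are meant to be elements
  of \<open>univ M\<close>.
\<close>

definition is_pair :: "'a set_struct \<Rightarrow> 'a \<Rightarrow> 'a \<Rightarrow> 'a \<Rightarrow> bool" where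
  "is_pair M z x y \<longleftrightarrow>
     (\<exists>u\<in>univ M. \<exists>v\<in>univ M. Ext M u = {x} \<and> Ext M v = {x, y} \<and> Ext M z = {u, v})"

definition is_ord :: "'a set_struct \<Rightarrow> 'a \<Rightarrow> bool" where
  "is_ord M \<alpha> \<longleftrightarrow>
     (\<forall>x\<in>Ext M \<alpha>. Ext M x \<subseteq> Ext M \<alpha>) \<and> (\<forall>x\<in>Ext M \<alpha>. \<forall>y\<in>Ext M x. Ext M y \<subseteq> Ext M x)"

definition is_nat :: "'a set_struct \<Rightarrow> 'a \<Rightarrow> bool" where
  "is_nat M n \<longleftrightarrow> is_ord M n \<and>
     (\<forall>m\<in>insert n (Ext M n). Ext M m = {} \<or> (\<exists>k\<in>univ M. Ext M m = insert k (Ext M k)))"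

primrec is_numeral :: "'a set_struct \<Rightarrow> nat \<Rightarrow> 'a \<Rightarrow> bool" where
  "is_numeral M 0 x \<longleftrightarrow> Ext M x = {}"
| "is_numeral M (Suc k) x \<longleftrightarrow> (\<exists>y\<in>univ M. is_numeral M k y \<and> Ext M x = insert y (Ext M y))"

text \<open>\<open>maps_to M f x y\<close>: the ordered pair of \<open>x\<close> and \<open>y\<close> belongs to \<open>f\<close>.\<close>

definition maps_to :: "'a set_struct \<Rightarrow> 'a \<Rightarrow> 'a \<Rightarrow> 'a \<Rightarrow> bool" where
  "maps_to M f x y \<longleftrightarrow> (\<exists>z\<in>Ext M f. is_pair M z x y)"

text \<open>\<open>is_fun_on M f d\<close>: \<open>f\<close> is a function with domain \<open>d\<close>.\<close>

definition is_fun_on :: "'a set_struct \<Rightarrow> 'a \<Rightarrow> 'a \<Rightarrow> bool" where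
  "is_fun_on M f d \<longleftrightarrow>
     (\<forall>z\<in>Ext M f. \<exists>x\<in>Ext M d. \<exists>y\<in>univ M. is_pair M z x y) \<and>
     (\<forall>x\<in>Ext M d. \<exists>!y. y \<in> univ M \<and> maps_to M f x y)"

text \<open>
  \<open>is_V M \<alpha> v\<close>: \<open>v\<close> is the level \<open>V\<^sub>\<alpha>\<close> of the cumulative hierarchy, given by the recursion
  \<open>V\<^sub>\<beta> = (\<Union>\<gamma><\<beta>. Pow V\<^sub>\<gamma>)\<close>.
\<close>

definition is_V :: "'a set_struct \<Rightarrow> 'a \<Rightarrow> 'a \<Rightarrow> bool" where
  "is_V M \<alpha> v \<longleftrightarrow> is_ord M \<alpha> \<and>
     (\<exists>d\<in>univ M. \<exists>f\<in>univ M. Ext M d = insert \<alpha> (Ext M \<alpha>) \<and> is_fun_on M f d \<and>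
        (\<forall>\<beta>\<in>Ext M d. \<forall>y\<in>univ M. maps_to M f \<beta> y \<longrightarrow>
           Ext M y = {x \<in> univ M. \<exists>\<gamma>\<in>Ext M \<beta>. \<exists>z\<in>univ M. maps_to M f \<gamma> z \<and> Ext M x \<subseteq> Ext M z}) \<and>
        maps_to M f \<alpha> v)"

section \<open>Definability inside a model, and V = HOD(p)\<close>

text \<open>
  Formulas of the language of \<open>(V\<^sub>\<alpha>, \<in>, p, \<beta>)\<close> with \<open>\<beta> < \<alpha>\<close> are coded by sets of \<open>M\<close>, so that
  an \<open>\<omega>\<close>-nonstandard \<open>M\<close> also has nonstandard formulas. Terms: \<open>(0, i)\<close> is the variable with
  index \<open>i \<in> \<omega>\<close>, \<open>(1, 0)\<close> is the constant denoting \<open>p\<close>, and \<open>(2, \<beta>)\<close> is the constant denoting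
  \<open>\<beta>\<close>. Formulas: \<open>(0, (t, u))\<close> is \<open>t = u\<close>, \<open>(1, (t, u))\<close> is \<open>t \<in> u\<close>, \<open>(2, F)\<close> is the negation
  of \<open>F\<close>, \<open>(3, (F, G))\<close> is the conjunction of \<open>F\<close> and \<open>G\<close>, and \<open>(4, (i, F))\<close> quantifies \<open>F\<close>
  existentially over the variable with index \<open>i\<close>.
\<close>

definition tagged :: "'a set_struct \<Rightarrow> nat \<Rightarrow> 'a \<Rightarrow> 'a \<Rightarrow> bool" where
  "tagged M k x c \<longleftrightarrow> (\<exists>t\<in>univ M. is_numeral M k t \<and> is_pair M c t x)"

definition tagged2 :: "'a set_struct \<Rightarrow> nat \<Rightarrow> 'a \<Rightarrow> 'a \<Rightarrow> 'a \<Rightarrow> bool" where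
  "tagged2 M k x y c \<longleftrightarrow> (\<exists>q\<in>univ M. is_pair M q x y \<and> tagged M k q c)"

definition is_term :: "'a set_struct \<Rightarrow> 'a \<Rightarrow> 'a \<Rightarrow> bool" where
  "is_term M \<alpha> t \<longleftrightarrow>
     (\<exists>i\<in>univ M. is_nat M i \<and> tagged M 0 i t) \<or>
     (\<exists>z\<in>univ M. is_numeral M 0 z \<and> tagged M 1 z t) \<or>
     (\<exists>\<beta>\<in>Ext M \<alpha>. tagged M 2 \<beta> t)"

text \<open>\<open>is_assignment M v a\<close>: \<open>a\<close> is a function from \<open>\<omega>\<close> to \<open>v\<close>.\<close>

definition is_assignment :: "'a set_struct \<Rightarrow> 'a \<Rightarrow> 'a \<Rightarrow> bool" where
  "is_assignment M v a \<longleftrightarrow>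
     (\<exists>w\<in>univ M. Ext M w = {n \<in> univ M. is_nat M n} \<and> is_fun_on M a w) \<and>
     (\<forall>i\<in>univ M. \<forall>y\<in>univ M. maps_to M a i y \<longrightarrow> y \<in> Ext M v)"

text \<open>\<open>term_value M \<alpha> p t a y\<close>: \<open>y\<close> is the value of the term \<open>t\<close> under the assignment \<open>a\<close>.\<close>

definition term_value :: "'a set_struct \<Rightarrow> 'a \<Rightarrow> 'a \<Rightarrow> 'a \<Rightarrow> 'a \<Rightarrow> 'a \<Rightarrow> bool" where
  "term_value M \<alpha> p t a y \<longleftrightarrow>
     (\<exists>i\<in>univ M. is_nat M i \<and> tagged M 0 i t \<and> maps_to M a i y) \<or>
     (\<exists>z\<in>univ M. is_numeral M 0 z \<and> tagged M 1 z t \<and> y = p) \<or>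
     (\<exists>\<beta>\<in>Ext M \<alpha>. tagged M 2 \<beta> t \<and> y = \<beta>)"

text \<open>
  \<open>sat_step M \<alpha> v p k S T F X\<close>: \<open>F\<close> is atomic, or built from formulas \<open>S(j)\<close> with \<open>j < k\<close>, and
  \<open>X\<close> is the set of assignments satisfying \<open>F\<close>, provided that \<open>T(j)\<close> is the set of assignments
  satisfying \<open>S(j)\<close> for each \<open>j < k\<close>.
\<close>

definition sat_step ::
  "'a set_struct \<Rightarrow> 'a \<Rightarrow> 'a \<Rightarrow> 'a \<Rightarrow> 'a \<Rightarrow> 'a \<Rightarrow> 'a \<Rightarrow> 'a \<Rightarrow> 'a \<Rightarrow> bool" where
  "sat_step M \<alpha> v p k S T F X \<longleftrightarrow>
     (\<exists>t\<in>univ M. \<exists>u\<in>univ M. is_term M \<alpha> t \<and> is_term M \<alpha> u \<and> tagged2 M 0 t u F \<and>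
        Ext M X = {a \<in> univ M. is_assignment M v a \<and>
          (\<exists>x\<in>univ M. \<exists>y\<in>univ M.
             term_value M \<alpha> p t a x \<and> term_value M \<alpha> p u a y \<and> x = y)}) \<or>
     (\<exists>t\<in>univ M. \<exists>u\<in>univ M. is_term M \<alpha> t \<and> is_term M \<alpha> u \<and> tagged2 M 1 t u F \<and>
        Ext M X = {a \<in> univ M. is_assignment M v a \<and>
          (\<exists>x\<in>univ M. \<exists>y\<in>univ M.
             term_value M \<alpha> p t a x \<and> term_value M \<alpha> p u a y \<and> x \<in> Ext M y)}) \<or>
     (\<exists>j\<in>Ext M k. \<exists>G\<in>univ M. \<exists>Y\<in>univ M. maps_to M S j G \<and> maps_to M T j Y \<and>
        tagged M 2 G F \<and>
        Ext M X = {a \<in> univ M. is_assignment M v a \<and> a \<notin> Ext M Y}) \<or>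
     (\<exists>i\<in>Ext M k. \<exists>G\<in>univ M. \<exists>Y\<in>univ M. maps_to M S i G \<and> maps_to M T i Y \<and>
        (\<exists>j\<in>Ext M k. \<exists>H\<in>univ M. \<exists>Z\<in>univ M. maps_to M S j H \<and> maps_to M T j Z \<and>
           tagged2 M 3 G H F \<and>
           Ext M X = Ext M Y \<inter> Ext M Z)) \<or>
     (\<exists>j\<in>Ext M k. \<exists>G\<in>univ M. \<exists>Y\<in>univ M. maps_to M S j G \<and> maps_to M T j Y \<and>
        (\<exists>i\<in>univ M. is_nat M i \<and> tagged2 M 4 i G F \<and>
           Ext M X = {a \<in> univ M. is_assignment M v a \<and>
             (\<exists>b\<in>Ext M Y. \<forall>m\<in>univ M. is_nat M m \<and> m \<noteq> i \<longrightarrow>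
                (\<forall>y\<in>univ M. maps_to M b m y \<longleftrightarrow> maps_to M a m y))}))"

text \<open>
  \<open>is_truth_set M \<alpha> v p F X\<close>: \<open>F\<close> is a formula, and \<open>X\<close> is the set of assignments that satisfy
  it in \<open>(v, \<in>, p, \<beta>)\<close> with \<open>\<beta> < \<alpha>\<close>. This is witnessed by a formation sequence \<open>S\<close> of \<open>F\<close>, of
  length \<open>n + 1\<close> for some \<open>n \<in> \<omega>\<close>, and the sequence \<open>T\<close> of the corresponding truth sets.
\<close>

definition is_truth_set :: "'a set_struct \<Rightarrow> 'a \<Rightarrow> 'a \<Rightarrow> 'a \<Rightarrow> 'a \<Rightarrow> 'a \<Rightarrow> bool" where
  "is_truth_set M \<alpha> v p F X \<longleftrightarrow>
     (\<exists>n\<in>univ M. \<exists>d\<in>univ M. \<exists>S\<in>univ M. \<exists>T\<in>univ M.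
        is_nat M n \<and> Ext M d = insert n (Ext M n) \<and> is_fun_on M S d \<and> is_fun_on M T d \<and>
        (\<forall>k\<in>Ext M d. \<forall>G\<in>univ M. \<forall>Y\<in>univ M.
           maps_to M S k G \<and> maps_to M T k Y \<longrightarrow> sat_step M \<alpha> v p k S T G Y) \<and>
        maps_to M S n F \<and> maps_to M T n X)"

text \<open>
  \<open>x\<close> is definable in \<open>(v, \<in>, p, \<beta>)\<close> with \<open>\<beta> < \<alpha>\<close>: some formula is satisfied by exactly those
  assignments that give the variable with index 0 the value \<open>x\<close>.
\<close>

definition is_definable_in :: "'a set_struct \<Rightarrow> 'a \<Rightarrow> 'a \<Rightarrow> 'a \<Rightarrow> 'a \<Rightarrow> bool" where
  "is_definable_in M \<alpha> v p x \<longleftrightarrow> x \<in> Ext M v \<and>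
     (\<exists>F\<in>univ M. \<exists>X\<in>univ M. is_truth_set M \<alpha> v p F X \<and>
        (\<forall>a\<in>univ M. is_assignment M v a \<longrightarrow>
           (a \<in> Ext M X \<longleftrightarrow> (\<exists>z\<in>univ M. is_numeral M 0 z \<and> maps_to M a z x))))"

definition satisfies_ex_V_eq_HOD :: "'a set_struct \<Rightarrow> bool" where
  "satisfies_ex_V_eq_HOD M \<longleftrightarrow>
     (\<exists>p\<in>univ M. \<forall>x\<in>univ M. \<exists>\<alpha>\<in>univ M. \<exists>v\<in>univ M.
        is_ord M \<alpha> \<and> is_V M \<alpha> v \<and> p \<in> Ext M v \<and> is_definable_in M \<alpha> v p x)"

end

theory Submission
  imports Defs "HOL-Library.Countable"
begin

text \<open>
  Let \<open>M\<close> satisfy ZF and \<open>V = HOD(p)\<close>. Ordinal definability from \<open>p\<close> yields a parametrically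
  definable, set-like well-order of \<open>M\<close>: a set is coded by \<open>\<alpha>\<close> and a finite sequence of truth sets
  over \<open>V\<^sub>\<alpha>\<close>, and such sequences are compared lexicographically by the least instruction (a tuple of
  ordinals) that produces the next truth set from the earlier ones.

  Start from the filter on \<open>M\<close> generated by the classes \<open>{x. z \<subseteq> x}\<close> and run through the countably
  many formulas \<open>\<phi>\<^sub>n(x, y)\<close>. At stage \<open>n\<close> decide the classes \<open>{x. \<phi>\<^sub>n(x, y)}\<close> for all parameters
  \<open>y\<close> by one recursion along the well-order, keeping the finite intersection property in the sense
  of \<open>M\<close>. Each stage is definable in \<open>M\<close>, because only finitely many formulas have been used, so
  the resulting ultrafilter \<open>UF\<close> on the definable classes is itself definable: for every
  \<open>\<phi>(x, y)\<close> the class \<open>{y. {x. \<phi>(x, y)} \<in> UF}\<close> is definable. Hence the ultrapower of \<open>M\<close> by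
  definable functions modulo \<open>UF\<close> is a conservative elementary extension; the class of the identity
  function has every element of \<open>M\<close> as a member.
\<close>

text \<open>The obstacle is that \<open>M\<close> has no definable truth predicate for itself, so no
  single recursion inside \<open>M\<close> can decide all definable classes. One formula at a time
  is possible, provided that the filter reached so far is again a single definable family over which
  \<open>M\<close> can quantify; the enumeration of formulas stays outside, where dependent choice
  strings the stages together. Compatibility has to be expressed in \<open>M\<close>, so finiteness
  is that of \<open>M\<close>, and inductions on it are restricted to definable predicates.
  Set-likeness of the well-order makes the decisions before a given parameter a set, to which a
  recursion can refer. The well-order is used a second time to choose least witnesses: these are the
  definable Skolem functions behind the existential step of the theorem of Los. Countability of
  formulas gives the enumeration and also lets one element of \<open>M\<close> name a definable
  function, which keeps the ultrapower inside \<open>'a + 'a\<close>.\<close>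

instance fm :: countable
  by countable_datatype

section \<open>Renaming of variables and interleaved environments\<close>

primrec ren :: "(nat \<Rightarrow> nat) \<Rightarrow> fm \<Rightarrow> fm" where
  "ren r (FEq i j) = FEq (r i) (r j)"
| "ren r (FMem i j) = FMem (r i) (r j)"
| "ren r (FNeg \<phi>) = FNeg (ren r \<phi>)"
| "ren r (FAnd \<phi> \<psi>) = FAnd (ren r \<phi>) (ren r \<psi>)"
| "ren r (FEx \<phi>) = FEx (ren (case_nat 0 (\<lambda>i. Suc (r i))) \<phi>)"

lemma sat_ren: "sat K s (ren r \<phi>) \<longleftrightarrow> sat K (\<lambda>i. s (r i)) \<phi>"
proof (induction \<phi> arbitrary: s r)
  case (FEx \<phi>)
  have "(\<lambda>i. case_nat a s (case_nat 0 (\<lambda>i. Suc (r i)) i)) = case_nat a (\<lambda>i. s (r i))" for a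
    by (rule ext) (simp split: nat.split)
  then show ?case
    by (simp add: FEx.IH)
qed simp_all

text \<open>Environments are infinite sequences; the bound makes it possible to pack the parameters
  of a formula into one element of the model.\<close>

lemma sat_finite_support:
  "\<exists>k. \<forall>s s'. (\<forall>i<k. s i = s' i) \<longrightarrow> sat K s \<phi> = sat K s' \<phi>"
proof (induction \<phi>)
  case (FEq i j)
  show ?case by (rule exI[of _ "Suc (max i j)"]) auto
next
  case (FMem i j)
  show ?case by (rule exI[of _ "Suc (max i j)"]) auto
next
  case (FNeg \<phi>)
  then show ?case by simp
next
  case (FAnd \<phi> \<psi>)
  then obtain k l where
    "\<forall>s s'. (\<forall>i<k. s i = s' i) \<longrightarrow> sat K s \<phi> = sat K s' \<phi>"
    "\<forall>s s'. (\<forall>i<l. s i = s' i) \<longrightarrow> sat K s \<psi> = sat K s' \<psi>"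
    by blast
  then have "sat K s \<phi> = sat K s' \<phi>" "sat K s \<psi> = sat K s' \<psi>" if "\<forall>i<max k l. s i = s' i" for s s'
    using that by (simp_all add: less_max_iff_disj)
  then show ?case
    by (intro exI[of _ "max k l"] allI impI) (simp only: sat.simps)
next
  case (FEx \<phi>)
  then obtain k where k: "\<And>s s'. (\<forall>i<k. s i = s' i) \<Longrightarrow> sat K s \<phi> = sat K s' \<phi>"
    by blast
  have "sat K (case_nat a s) \<phi> = sat K (case_nat a s') \<phi>" if "\<forall>i<k. s i = s' i" for a s s'
    using that by (intro k) (auto split: nat.split)
  then show ?case
    by (intro exI[of _ k] allI impI) (simp only: sat.simps)
qed

definition merge :: "(nat \<Rightarrow> 'a) \<Rightarrow> (nat \<Rightarrow> 'a) \<Rightarrow> nat \<Rightarrow> 'a" where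
  "merge s t i = (if even i then s (i div 2) else t (i div 2))"

lemma merge_double [simp]: "merge s t (2 * i) = s i"
  by (simp add: merge_def)

lemma merge_Suc_double [simp]: "merge s t (Suc (2 * i)) = t i"
  by (simp add: merge_def)

lemma ext_parity:
  assumes "\<And>i. f (2 * i) = g (2 * i)" "\<And>i. f (Suc (2 * i)) = g (Suc (2 * i))"
  shows "f = g"
proof (rule ext)
  fix i :: nat
  show "f i = g i"
    using assms(1)[of "i div 2"] assms(2)[of "i div 2"] by (cases "even i") simp_all
qed

text \<open>Closure rules of definability for a shallow embedding: formulas are rarely written out;
  \<open>intro dfns\<close> follows the HOL syntax of a predicate and shows that some formula with
  parameters expresses it.\<close>

named_theorems dfns

section \<open>Definable predicates and definable terms\<close>

locale fo_structure =
  fixes M :: "'a set_struct"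
  assumes nonempty: "univ M \<noteq> {}"
begin

abbreviation U :: "'a set" where "U \<equiv> univ M"
abbreviation E :: "'a \<Rightarrow> 'a set" where "E \<equiv> Ext M"

definition env :: "(nat \<Rightarrow> 'a) \<Rightarrow> bool" where
  "env s \<longleftrightarrow> (\<forall>i. s i \<in> U)"

text \<open>
  Predicates and terms take an environment. In \<open>merge s t\<close> the even variables carry the
  arguments \<open>s\<close> and the odd ones the parameters \<open>t\<close> of the definition.
\<close>

definition dfn :: "((nat \<Rightarrow> 'a) \<Rightarrow> bool) \<Rightarrow> bool" where
  "dfn P \<longleftrightarrow> (\<exists>\<phi> t. env t \<and> (\<forall>s. env s \<longrightarrow> (P s \<longleftrightarrow> sat M (merge s t) \<phi>)))"

definition tmd :: "((nat \<Rightarrow> 'a) \<Rightarrow> 'a) \<Rightarrow> bool" where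
  "tmd f \<longleftrightarrow> (\<forall>s. env s \<longrightarrow> f s \<in> U) \<and> dfn (\<lambda>s. s 0 = f (\<lambda>n. s (Suc n)))"

lemma env_app: "env s \<Longrightarrow> s i \<in> U"
  by (simp add: env_def)

lemma env_case: "a \<in> U \<Longrightarrow> env s \<Longrightarrow> env (case_nat a s)"
  by (simp add: env_def split: nat.split)

lemma env_Suc: "env s \<Longrightarrow> env (\<lambda>n. s (Suc n))"
  by (simp add: env_def)

lemma env_merge: "env s \<Longrightarrow> env t \<Longrightarrow> env (merge s t)"
  by (simp add: env_def merge_def)

lemma dfn_cong: "(\<And>s. env s \<Longrightarrow> P s \<longleftrightarrow> Q s) \<Longrightarrow> dfn Q \<Longrightarrow> dfn P"
  unfolding dfn_def by metis

lemma dfn_not[dfns]: "dfn P \<Longrightarrow> dfn (\<lambda>s. \<not> P s)"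
  unfolding dfn_def by (metis sat.simps(3))

lemma dfn_and[dfns]:
  assumes "dfn P" "dfn Q"
  shows "dfn (\<lambda>s. P s \<and> Q s)"
proof -
  obtain \<phi> t \<psi> u where \<phi>: "env t" "\<And>s. env s \<Longrightarrow> P s \<longleftrightarrow> sat M (merge s t) \<phi>"
    and \<psi>: "env u" "\<And>s. env s \<Longrightarrow> Q s \<longleftrightarrow> sat M (merge s u) \<psi>"
    using assms unfolding dfn_def by blast
  \<comment> \<open>Both parameter lists must share one: in \<open>merge s (merge t u)\<close> the
    entries \<open>t j\<close> and \<open>u j\<close> have positions \<open>4 * j + 1\<close> and
    \<open>4 * j + 3\<close>, which arise from the odd index \<open>i = 2 * j + 1\<close> as
    \<open>Suc (2 * (i - 1))\<close> and \<open>Suc (2 * i)\<close>.\<close>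
  have 1: "(\<lambda>i. merge s (merge t u) (if even i then i else Suc (2 * (i - 1)))) = merge s t" for s
    by (rule ext_parity) (simp_all add: merge_def)
  have 2: "(\<lambda>i. merge s (merge t u) (if even i then i else Suc (2 * i))) = merge s u" for s
    by (rule ext_parity) (simp_all add: merge_def)
  show ?thesis
    unfolding dfn_def
    by (rule exI[of _ "FAnd (ren (\<lambda>i. if even i then i else Suc (2 * (i - 1))) \<phi>)
                       (ren (\<lambda>i. if even i then i else Suc (2 * i)) \<psi>)"],
        rule exI[of _ "merge t u"])
      (simp add: sat_ren 1 2 \<phi> \<psi> env_merge)
qed

text \<open>A quantifier prepends its value to the whole merged environment, whereas
  \<open>dfn\<close> wants it prepended to the arguments only; even positions above 0 are therefore
  looked up one place lower, odd ones one place higher.\<close>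

lemma merge_case_nat:
  "(\<lambda>i. case_nat a (merge s t) (if i = 0 then 0 else if even i then i - 1 else Suc i))
     = merge (case_nat a s) t"
proof (rule ext_parity)
  show "case_nat a (merge s t) (if 2 * i = 0 then 0 else if even (2 * i) then 2 * i - 1 else Suc (2 * i))
      = merge (case_nat a s) t (2 * i)" for i
    by (cases i) (simp_all add: merge_def)
qed simp

text \<open>The premise has the shape that higher-order unification produces: the bound variable is
  \<open>s 0\<close> and the outer environment is shifted by one. Hence \<open>tmd_rename\<close>
  accompanies \<open>dfns\<close> under quantifiers.\<close>

lemma dfn_ex[dfns]:
  assumes "dfn (\<lambda>s. Q (s 0) (\<lambda>n. s (Suc n)))"
  shows "dfn (\<lambda>s. \<exists>u\<in>U. Q u s)"
proof -
  obtain \<phi> t where \<phi>: "env t"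
      "\<And>s. env s \<Longrightarrow> Q (s 0) (\<lambda>n. s (Suc n)) \<longleftrightarrow> sat M (merge s t) \<phi>"
    using assms unfolding dfn_def by blast
  have "Q u s \<longleftrightarrow> sat M (merge (case_nat u s) t) \<phi>" if "u \<in> U" "env s" for u s
    using \<phi>(2)[OF env_case[OF that]] by simp
  then show ?thesis
    unfolding dfn_def
    by (intro exI[of _ "FEx (ren (\<lambda>i. if i = 0 then 0 else if even i then i - 1 else Suc i) \<phi>)"]
        exI[of _ t]) (simp add: sat_ren merge_case_nat \<phi>(1) cong: bex_cong)
qed

lemma dfn_or[dfns]: "dfn P \<Longrightarrow> dfn Q \<Longrightarrow> dfn (\<lambda>s. P s \<or> Q s)"
  using dfn_not[OF dfn_and[OF dfn_not dfn_not]] by simp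

lemma dfn_imp[dfns]: "dfn P \<Longrightarrow> dfn Q \<Longrightarrow> dfn (\<lambda>s. P s \<longrightarrow> Q s)"
  using dfn_or[OF dfn_not] by simp

lemma dfn_iff[dfns]: "dfn P \<Longrightarrow> dfn Q \<Longrightarrow> dfn (\<lambda>s. P s \<longleftrightarrow> Q s)"
  using dfn_and[OF dfn_imp dfn_imp] by (simp only: iff_conv_conj_imp)

lemma dfn_all[dfns]:
  assumes "dfn (\<lambda>s. Q (s 0) (\<lambda>n. s (Suc n)))"
  shows "dfn (\<lambda>s. \<forall>u\<in>U. Q u s)"
  using dfn_not[OF dfn_ex[of "\<lambda>u s. \<not> Q u s", OF dfn_not[OF assms]]] by simp

lemma dfn_rename:
  assumes "dfn P"
  shows "dfn (\<lambda>s. P (\<lambda>n. s (r n)))"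
proof -
  obtain \<phi> t where \<phi>: "env t" "\<And>s. env s \<Longrightarrow> P s \<longleftrightarrow> sat M (merge s t) \<phi>"
    using assms unfolding dfn_def by blast
  have "(\<lambda>i. merge s t (if even i then 2 * r (i div 2) else i)) = merge (\<lambda>n. s (r n)) t" for s
    by (rule ext_parity) simp_all
  moreover have "env (\<lambda>n. s (r n))" if "env s" for s
    using that by (simp add: env_def)
  ultimately show ?thesis
    unfolding dfn_def
    by (intro exI[of _ "ren (\<lambda>i. if even i then 2 * r (i div 2) else i) \<phi>"] exI[of _ t])
      (simp add: sat_ren \<phi>)
qed

lemma dfn_eq_var: "dfn (\<lambda>s. s i = s j)"
  unfolding dfn_def
proof (intro exI conjI allI impI)
  \<comment> \<open>No parameter occurs, but \<open>dfn\<close> asks for an environment of them;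
    nonemptiness supplies one.\<close>
  show "env (\<lambda>_. SOME x. x \<in> U)"
    using nonempty by (simp add: env_def some_in_eq)
  show "(s i = s j) = sat M (merge s (\<lambda>_. SOME x. x \<in> U)) (FEq (2 * i) (2 * j))" for s
    by (simp add: merge_def)
qed

lemma dfn_rel_var: "dfn (\<lambda>s. rel M (s i) (s j))"
  unfolding dfn_def
proof (intro exI conjI allI impI)
  show "env (\<lambda>_. SOME x. x \<in> U)"
    using nonempty by (simp add: env_def some_in_eq)
  show "rel M (s i) (s j) = sat M (merge s (\<lambda>_. SOME x. x \<in> U)) (FMem (2 * i) (2 * j))" for s
    by (simp add: merge_def)
qed

lemma dfn_eq_const: "c \<in> U \<Longrightarrow> dfn (\<lambda>s. s i = c)"
  unfolding dfn_def
  by (rule exI[of _ "FEq (2 * i) 1"], rule exI[of _ "\<lambda>_. c"]) (simp add: env_def merge_def)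

lemma tmd_var[dfns]: "tmd (\<lambda>s. s i)"
  by (simp add: tmd_def env_def dfn_eq_var)

lemma tmd_const[dfns]: "c \<in> U \<Longrightarrow> tmd (\<lambda>s. c)"
  by (simp add: tmd_def dfn_eq_const)

lemma tmd_in: "tmd f \<Longrightarrow> env s \<Longrightarrow> f s \<in> U"
  by (simp add: tmd_def)

lemma tmd_graph: "tmd f \<Longrightarrow> dfn (\<lambda>s. s i = f (\<lambda>n. s (r n)))"
  using dfn_rename[of "\<lambda>s. s 0 = f (\<lambda>n. s (Suc n))" "case_nat i r"] by (simp add: tmd_def)

lemma tmd_rename:
  assumes "tmd f"
  shows "tmd (\<lambda>s. f (\<lambda>n. s (r n)))"
  using assms tmd_graph[OF assms, of 0 "\<lambda>n. Suc (r n)"] by (simp add: tmd_def env_def)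

lemma dfn_eq[dfns]:
  assumes "tmd f" "tmd g"
  shows "dfn (\<lambda>s. f s = g s)"
proof (rule dfn_cong)
  show "f s = g s \<longleftrightarrow> (\<exists>u\<in>U. u = f s \<and> u = g s)" if "env s" for s
    using assms that by (auto simp: tmd_in)
  show "dfn (\<lambda>s. \<exists>u\<in>U. u = f s \<and> u = g s)"
    using assms by (intro dfn_ex dfn_and tmd_graph)
qed

lemma dfn_rel[dfns]:
  assumes "tmd f" "tmd g"
  shows "dfn (\<lambda>s. rel M (f s) (g s))"
proof (rule dfn_cong)
  show "rel M (f s) (g s) \<longleftrightarrow> (\<exists>u\<in>U. \<exists>v\<in>U. u = f s \<and> v = g s \<and> rel M u v)" if "env s" for s
    using assms that by (auto simp: tmd_in)
  show "dfn (\<lambda>s. \<exists>u\<in>U. \<exists>v\<in>U. u = f s \<and> v = g s \<and> rel M u v)"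
    using assms by (intro dfn_ex dfn_and tmd_graph dfn_rel_var)
qed

text \<open>The formula is fixed outside the model and only the terms vary, so this is no truth
  definition. It serves for the stage predicates and for the classes in the theorem of Los.\<close>

lemma dfn_sat:
  assumes "\<And>i. tmd (fs i)"
  shows "dfn (\<lambda>s. sat M (\<lambda>i. fs i s) \<phi>)"
  using assms
proof (induction \<phi> arbitrary: fs)
  case (FEx \<phi>)
  have "tmd (case_nat (\<lambda>s. s 0) (\<lambda>i s. fs i (\<lambda>n. s (Suc n))) i)" for i
    using FEx.prems by (cases i) (auto intro: tmd_var tmd_rename)
  then have "dfn (\<lambda>s. sat M (\<lambda>i. case_nat (\<lambda>s. s 0) (\<lambda>i s. fs i (\<lambda>n. s (Suc n))) i s) \<phi>)"
    by (rule FEx.IH)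
  moreover have "(\<lambda>i. case_nat (\<lambda>s. s 0) (\<lambda>i s. fs i (\<lambda>n. s (Suc n))) i s)
      = case_nat (s 0) (\<lambda>i. fs i (\<lambda>n. s (Suc n)))" for s :: "nat \<Rightarrow> 'a"
    by (rule ext) (simp split: nat.split)
  ultimately show ?case
    by (simp only: sat.simps) (rule dfn_ex, simp only:)
qed (simp_all only: sat.simps dfn_eq dfn_rel dfn_not dfn_and)

lemma dfn_subst:
  assumes "dfn P" "\<And>i. tmd (fs i)"
  shows "dfn (\<lambda>s. P (\<lambda>i. fs i s))"
proof -
  obtain \<phi> t where \<phi>: "env t" "\<And>s. env s \<Longrightarrow> P s \<longleftrightarrow> sat M (merge s t) \<phi>"
    using assms(1) unfolding dfn_def by blast
  let ?g = "\<lambda>i. if even i then fs (i div 2) else (\<lambda>_. t (i div 2))"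
  have "dfn (\<lambda>s. sat M (\<lambda>i. ?g i s) \<phi>)"
    using assms(2) \<phi>(1) by (intro dfn_sat) (auto simp: env_app tmd_const)
  moreover have "(\<lambda>i. ?g i s) = merge (\<lambda>i. fs i s) t" for s
    by (rule ext) (simp add: merge_def)
  ultimately show ?thesis
    using \<phi>(2) assms(2) by (elim dfn_cong[rotated]) (simp add: env_def tmd_in)
qed

lemma tmd_subst:
  assumes "tmd h" "\<And>i. tmd (fs i)"
  shows "tmd (\<lambda>s. h (\<lambda>i. fs i s))"
proof -
  have "tmd (case_nat (\<lambda>s. s 0) (\<lambda>i s. fs i (\<lambda>n. s (Suc n))) i)" for i
    using assms(2) by (cases i) (auto intro: tmd_var tmd_rename)
  from dfn_subst[of "\<lambda>s. s 0 = h (\<lambda>n. s (Suc n))"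
      "case_nat (\<lambda>s. s 0) (\<lambda>i s. fs i (\<lambda>n. s (Suc n)))", OF _ this] assms
  have "dfn (\<lambda>s. s 0 = h (\<lambda>i. fs i (\<lambda>n. s (Suc n))))"
    by (simp add: tmd_def)
  then show ?thesis
    using assms by (simp add: tmd_def env_def)
qed

lemma dfn_sub1: "dfn (\<lambda>s. P (s 0)) \<Longrightarrow> tmd f \<Longrightarrow> dfn (\<lambda>s. P (f s))"
  using dfn_subst[of "\<lambda>s. P (s 0)" "\<lambda>_. f"] by simp

lemma dfn_sub2: "dfn (\<lambda>s. P (s 0) (s 1)) \<Longrightarrow> tmd f \<Longrightarrow> tmd g \<Longrightarrow> dfn (\<lambda>s. P (f s) (g s))"
  using dfn_subst[of "\<lambda>s. P (s 0) (s 1)" "\<lambda>i. if i = 0 then f else g"] by simp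

lemma dfn_sub3:
  "dfn (\<lambda>s. P (s 0) (s 1) (s 2)) \<Longrightarrow> tmd f \<Longrightarrow> tmd g \<Longrightarrow> tmd h
    \<Longrightarrow> dfn (\<lambda>s. P (f s) (g s) (h s))"
  using dfn_subst[of "\<lambda>s. P (s 0) (s 1) (s 2)" "\<lambda>i. if i = 0 then f else if i = 1 then g else h"]
  by simp

lemma tmd_sub1: "tmd (\<lambda>s. h (s 0)) \<Longrightarrow> tmd f \<Longrightarrow> tmd (\<lambda>s. h (f s))"
  using tmd_subst[of "\<lambda>s. h (s 0)" "\<lambda>_. f"] by simp

lemma dfn_const[dfns]: "dfn (\<lambda>s. b)"
  using dfn_not[OF dfn_eq_var[of 0 0]] dfn_eq_var[of 0 0] by (cases b) simp_all

lemma dfn_mem[dfns]: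
  assumes "tmd f" "tmd g"
  shows "dfn (\<lambda>s. f s \<in> E (g s))"
  by (rule dfn_cong[OF _ dfn_rel[OF assms]]) (simp add: Ext_def tmd_in assms)

lemma dfn_bex[dfns]:
  assumes "tmd f" "dfn (\<lambda>s. Q (s 0) (\<lambda>n. s (Suc n)))"
  shows "dfn (\<lambda>s. \<exists>u\<in>E (f s). Q u s)"
proof (rule dfn_cong)
  show "(\<exists>u\<in>E (f s). Q u s) \<longleftrightarrow> (\<exists>u\<in>U. u \<in> E (f s) \<and> Q u s)" for s
    by (auto simp: Ext_def)
  show "dfn (\<lambda>s. \<exists>u\<in>U. u \<in> E (f s) \<and> Q u s)"
    using assms by (intro dfn_ex dfn_and dfn_mem tmd_rename[OF assms(1)] tmd_var)
qed

lemma dfn_ball[dfns]: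
  assumes "tmd f" "dfn (\<lambda>s. Q (s 0) (\<lambda>n. s (Suc n)))"
  shows "dfn (\<lambda>s. \<forall>u\<in>E (f s). Q u s)"
  using dfn_not[OF dfn_bex[of f "\<lambda>u s. \<not> Q u s", OF assms(1) dfn_not[OF assms(2)]]] by simp

lemma dfn_set_eq:
  assumes "tmd f" "dfn (\<lambda>s. s 0 \<in> A (\<lambda>n. s (Suc n)))" "\<And>s. env s \<Longrightarrow> A s \<subseteq> U"
  shows "dfn (\<lambda>s. E (f s) = A s)"
proof (rule dfn_cong)
  show "E (f s) = A s \<longleftrightarrow> (\<forall>u\<in>U. u \<in> E (f s) \<longleftrightarrow> u \<in> A s)" if "env s" for s
    using assms(3)[OF that] by (auto simp: Ext_def)
  show "dfn (\<lambda>s. \<forall>u\<in>U. u \<in> E (f s) \<longleftrightarrow> u \<in> A s)"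
    using assms by (intro dfn_all dfn_iff dfn_mem tmd_rename[OF assms(1)] tmd_var)
qed

lemma tmdI:
  assumes "\<And>s. env s \<Longrightarrow> f s \<in> U"
    and "\<And>u s. u \<in> U \<Longrightarrow> env s \<Longrightarrow> u = f s \<longleftrightarrow> P u s"
    and "dfn (\<lambda>s. P (s 0) (\<lambda>n. s (Suc n)))"
  shows "tmd f"
  unfolding tmd_def
proof
  show "dfn (\<lambda>s. s 0 = f (\<lambda>n. s (Suc n)))"
    by (rule dfn_cong[OF _ assms(3)]) (simp add: assms(2) env_app env_Suc)
qed (use assms(1) in blast)

text \<open>Passes from the even-odd format to the one in which separation and
  \<open>definable\<close> are stated. All even positions collapse to 0, as only the first argument
  matters.\<close>

lemma dfn_unary:
  assumes "dfn (\<lambda>s. P (s 0))"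
  obtains \<phi> t where "env t" "\<And>x. x \<in> U \<Longrightarrow> P x \<longleftrightarrow> sat M (case_nat x t) \<phi>"
proof -
  obtain \<phi> t where \<phi>: "env t" "\<And>s. env s \<Longrightarrow> P (s 0) \<longleftrightarrow> sat M (merge s t) \<phi>"
    using assms unfolding dfn_def by blast
  let ?r = "\<lambda>i. if even i then 0 else Suc (i div 2)"
  have "(\<lambda>i. case_nat x t (?r i)) = merge (\<lambda>_. x) t" for x
    by (rule ext_parity) simp_all
  then have "P x \<longleftrightarrow> sat M (case_nat x t) (ren ?r \<phi>)" if "x \<in> U" for x
    using \<phi>(2)[of "\<lambda>_. x"] that by (simp add: sat_ren env_def)
  then show thesis
    using that \<phi>(1) by blast
qed

end

section \<open>Elementary set theory in a model of ZF\<close>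

locale zf = fo_structure +
  assumes ZF: "ZF_model M"
begin

lemma extensionality: "x \<in> U \<Longrightarrow> y \<in> U \<Longrightarrow> E x = E y \<Longrightarrow> x = y"
  using ZF[unfolded ZF_model_def, THEN conjunct1] by blast

lemma foundation: "x \<in> U \<Longrightarrow> E x \<noteq> {} \<Longrightarrow> \<exists>y\<in>E x. E y \<inter> E x = {}"
  using ZF[unfolded ZF_model_def, THEN conjunct2, THEN conjunct1] by blast

lemma Ext_U: "x \<in> E y \<Longrightarrow> x \<in> U"
  by (simp add: Ext_def)

definition isset :: "'a set \<Rightarrow> bool" where
  "isset A \<longleftrightarrow> (\<exists>b\<in>U. E b = A)"

definition st :: "'a set \<Rightarrow> 'a" where
  "st A = (THE b. b \<in> U \<and> E b = A)"

lemma st_props: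
  assumes "isset A"
  shows st_in: "st A \<in> U" and E_st: "E (st A) = A"
proof -
  have "\<exists>!b. b \<in> U \<and> E b = A"
    using assms extensionality unfolding isset_def by blast
  from theI'[OF this] show "st A \<in> U" "E (st A) = A"
    by (simp_all add: st_def)
qed

lemma isset_E: "b \<in> U \<Longrightarrow> isset (E b)"
  unfolding isset_def by blast

lemma st_E: "b \<in> U \<Longrightarrow> st (E b) = b"
  using extensionality E_st isset_E st_in by blast

lemma isset_doubleton: "x \<in> U \<Longrightarrow> y \<in> U \<Longrightarrow> isset {x, y}"
  unfolding isset_def using ZF[unfolded ZF_model_def, THEN conjunct2, THEN conjunct2, THEN conjunct1] by blast

lemma isset_single: "x \<in> U \<Longrightarrow> isset {x}"
  using isset_doubleton[of x x] by simp

lemma isset_Union: "x \<in> U \<Longrightarrow> isset (\<Union>y\<in>E x. E y)"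
  unfolding isset_def using ZF[unfolded ZF_model_def, THEN conjunct2, THEN conjunct2, THEN conjunct2, THEN conjunct1] by blast

lemma isset_Pow: "x \<in> U \<Longrightarrow> isset {z \<in> U. E z \<subseteq> E x}"
  unfolding isset_def using ZF[unfolded ZF_model_def, THEN conjunct2, THEN conjunct2, THEN conjunct2, THEN conjunct2, THEN conjunct1] by blast

lemma infinity:
  "\<exists>w\<in>U. (\<exists>z\<in>E w. E z = {}) \<and> (\<forall>y\<in>E w. \<exists>z\<in>E w. E z = insert y (E y))"
  using ZF[unfolded ZF_model_def, THEN conjunct2, THEN conjunct2, THEN conjunct2, THEN conjunct2, THEN conjunct2, THEN conjunct1] by blast

lemma separation:
  "range s \<subseteq> U \<Longrightarrow> a \<in> U \<Longrightarrow> isset {x \<in> E a. sat M (case_nat x s) \<phi>}"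
  unfolding isset_def using ZF[unfolded ZF_model_def, THEN conjunct2, THEN conjunct2, THEN conjunct2, THEN conjunct2, THEN conjunct2, THEN conjunct2, THEN conjunct1] by blast

lemma replacement:
  assumes "range s \<subseteq> U" "a \<in> U"
    "\<forall>x\<in>E a. \<forall>y\<in>U. \<forall>z\<in>U. sat M (case_nat x (case_nat y s)) \<phi> \<and> sat M (case_nat x (case_nat z s)) \<phi>
       \<longrightarrow> y = z"
  shows "isset {y \<in> U. \<exists>x\<in>E a. sat M (case_nat x (case_nat y s)) \<phi>}"
  unfolding isset_def using ZF[unfolded ZF_model_def, THEN conjunct2, THEN conjunct2, THEN conjunct2, THEN conjunct2, THEN conjunct2, THEN conjunct2, THEN conjunct2] assms by blast

lemma isset_sep:
  assumes "a \<in> U" "dfn (\<lambda>s. P (s 0))"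
  shows "isset {x \<in> E a. P x}"
proof -
  obtain \<phi> t where \<phi>: "env t" "\<And>x. x \<in> U \<Longrightarrow> P x \<longleftrightarrow> sat M (case_nat x t) \<phi>"
    using assms(2) by (rule dfn_unary) blast
  then have "{x \<in> E a. P x} = {x \<in> E a. sat M (case_nat x t) \<phi>}"
    using Ext_U by blast
  then show ?thesis
    using separation[of t a] assms(1) \<phi>(1) by (auto simp: env_def)
qed

lemma isset_subset: "a \<in> U \<Longrightarrow> A \<subseteq> E a \<Longrightarrow> dfn (\<lambda>s. s 0 \<in> A) \<Longrightarrow> isset A"
  using isset_sep[of a "\<lambda>x. x \<in> A"] by (simp add: Int_absorb1 Collect_conj_eq)

lemma isset_repl:
  assumes "a \<in> U" "dfn (\<lambda>s. R (s 0) (s 1))"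
    and "\<And>x y z. x \<in> E a \<Longrightarrow> y \<in> U \<Longrightarrow> z \<in> U \<Longrightarrow> R x y \<Longrightarrow> R x z \<Longrightarrow> y = z"
  shows "isset {y \<in> U. \<exists>x\<in>E a. R x y}"
proof -
  obtain \<phi> t where \<phi>: "env t" "\<And>s. env s \<Longrightarrow> R (s 0) (s 1) \<longleftrightarrow> sat M (merge s t) \<phi>"
    using assms(2) unfolding dfn_def by blast
  \<comment> \<open>Only arguments 0 and 1 matter; filling the other even positions with
    \<open>y\<close> lets the parameters begin at index 2.\<close>
  let ?r = "\<lambda>i. if i = 0 then 0 else if even i then 1 else Suc (Suc (i div 2))"
  have "(\<lambda>i. case_nat x (case_nat y t) (?r i)) = merge (case_nat x (\<lambda>_. y)) t" for x y
  proof (rule ext_parity)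
    show "case_nat x (case_nat y t) (?r (2 * i)) = merge (case_nat x (\<lambda>_. y)) t (2 * i)" for i
      by (cases i) (simp_all add: merge_def)
  qed simp
  then have *: "R x y \<longleftrightarrow> sat M (case_nat x (case_nat y t)) (ren ?r \<phi>)" if "x \<in> U" "y \<in> U" for x y
    using \<phi>(2)[of "case_nat x (\<lambda>_. y)"] that by (simp add: sat_ren env_def split: nat.split)
  then have "{y \<in> U. \<exists>x\<in>E a. R x y} =
      {y \<in> U. \<exists>x\<in>E a. sat M (case_nat x (case_nat y t)) (ren ?r \<phi>)}"
    using Ext_U by blast
  moreover have "isset \<dots>"
  proof (rule replacement)
    show "range t \<subseteq> U"
      using \<phi>(1) by (auto simp: env_def)
    show "\<forall>x\<in>E a. \<forall>y\<in>U. \<forall>z\<in>U. sat M (case_nat x (case_nat y t)) (ren ?r \<phi>)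
        \<and> sat M (case_nat x (case_nat z t)) (ren ?r \<phi>) \<longrightarrow> y = z"
      by (intro ballI impI) (rule assms(3), auto simp: * Ext_U)
  qed (fact assms(1))
  ultimately show ?thesis
    by simp
qed

lemma isset_Un: "x \<in> U \<Longrightarrow> y \<in> U \<Longrightarrow> isset (E x \<union> E y)"
  using isset_Union[of "st {x, y}"] by (simp add: isset_doubleton st_in E_st)

lemma isset_insert: "x \<in> U \<Longrightarrow> y \<in> U \<Longrightarrow> isset (insert x (E y))"
  using isset_Un[of "st {x}" y] by (simp add: isset_single st_in E_st)

lemma isset_empty: "isset {}"
  using infinity Ext_U unfolding isset_def by blast

lemma tmd_st:
  assumes "\<And>s. env s \<Longrightarrow> isset (A s)" "dfn (\<lambda>s. s 0 \<in> A (\<lambda>n. s (Suc n)))"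
  shows "tmd (\<lambda>s. st (A s))"
proof (rule tmdI)
  show "st (A s) \<in> U" if "env s" for s
    using assms(1)[OF that] st_in by blast
  show "u = st (A s) \<longleftrightarrow> (\<forall>v\<in>U. v \<in> E u \<longleftrightarrow> v \<in> A s)" if u: "u \<in> U" and s: "env s" for u s
  proof -
    have "A s \<subseteq> U"
      using E_st[OF assms(1)[OF s]] Ext_U by blast
    moreover have "u = st (A s) \<longleftrightarrow> E u = A s"
      using u s assms(1) st_E E_st by metis
    ultimately show ?thesis
      by (auto simp: Ext_def)
  qed
  show "dfn (\<lambda>s. \<forall>v\<in>U. v \<in> E (s 0) \<longleftrightarrow> v \<in> A (\<lambda>n. s (Suc n)))"
    using dfn_rename[OF assms(2), of "case_nat 0 (\<lambda>n. Suc (Suc n))"]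
    by (intro dfns) simp
qed

lemma dfn_insert[dfns]:
  "tmd f \<Longrightarrow> tmd g \<Longrightarrow> dfn (\<lambda>s. f s \<in> A s) \<Longrightarrow> dfn (\<lambda>s. f s \<in> insert (g s) (A s))"
  by (simp add: dfn_or dfn_eq)

lemma dfn_Un[dfns]:
  "dfn (\<lambda>s. f s \<in> A s) \<Longrightarrow> dfn (\<lambda>s. f s \<in> B s) \<Longrightarrow> dfn (\<lambda>s. f s \<in> A s \<union> B s)"
  by (simp add: dfn_or)

lemma dfn_Int[dfns]:
  "dfn (\<lambda>s. f s \<in> A s) \<Longrightarrow> dfn (\<lambda>s. f s \<in> B s) \<Longrightarrow> dfn (\<lambda>s. f s \<in> A s \<inter> B s)"
  by (simp add: dfn_and)

lemma dfn_in_empty[dfns]: "dfn (\<lambda>s. f s \<in> {})"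
  by (simp add: dfn_const)

lemma dfn_Collect[dfns]: "dfn (\<lambda>s. P (f s) s) \<Longrightarrow> dfn (\<lambda>s. f s \<in> {x. P x s})"
  by simp

lemma dfn_in_U[dfns]: "tmd f \<Longrightarrow> dfn (\<lambda>s. f s \<in> U)"
  by (rule dfn_cong[OF _ dfn_const[of True]]) (simp add: tmd_in)

lemma dfn_subset[dfns]:
  assumes "tmd f" "tmd g"
  shows "dfn (\<lambda>s. E (f s) \<subseteq> E (g s))"
  unfolding subset_iff Ball_def[symmetric]
  by (intro dfns assms tmd_rename[OF assms(2)])

lemma dfn_ball_insert[dfns]:
  "dfn (\<lambda>s. Q (f s) s) \<Longrightarrow> dfn (\<lambda>s. \<forall>u\<in>A s. Q u s) \<Longrightarrow> dfn (\<lambda>s. \<forall>u\<in>insert (f s) (A s). Q u s)"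
  by (simp add: dfn_and)

declare dfn_set_eq[dfns]

definition emp :: 'a where "emp = st {}"
definition ins :: "'a \<Rightarrow> 'a \<Rightarrow> 'a" where "ins x y = st (insert x (E y))"
definition un :: "'a \<Rightarrow> 'a \<Rightarrow> 'a" where "un x y = st (E x \<union> E y)"
definition pr :: "'a \<Rightarrow> 'a \<Rightarrow> 'a" where "pr x y = st {st {x}, st {x, y}}"

lemma emp_in[simp]: "emp \<in> U" and E_emp[simp]: "E emp = {}"
  by (simp_all add: emp_def isset_empty st_in E_st)

lemma ins_in[simp]: "x \<in> U \<Longrightarrow> y \<in> U \<Longrightarrow> ins x y \<in> U"
  and E_ins[simp]: "x \<in> U \<Longrightarrow> y \<in> U \<Longrightarrow> E (ins x y) = insert x (E y)"
  by (simp_all add: ins_def isset_insert st_in E_st)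

lemma un_in[simp]: "x \<in> U \<Longrightarrow> y \<in> U \<Longrightarrow> un x y \<in> U"
  and E_un[simp]: "x \<in> U \<Longrightarrow> y \<in> U \<Longrightarrow> E (un x y) = E x \<union> E y"
  by (simp_all add: un_def isset_Un st_in E_st)

lemma pr_in[simp]: "x \<in> U \<Longrightarrow> y \<in> U \<Longrightarrow> pr x y \<in> U"
  by (simp add: pr_def isset_single isset_doubleton st_in)

lemma eq_ins_iff: "d \<in> U \<Longrightarrow> x \<in> U \<Longrightarrow> y \<in> U \<Longrightarrow> E d = insert x (E y) \<longleftrightarrow> d = ins x y"
  using extensionality E_ins ins_in by metis

lemma eq_emp_iff: "d \<in> U \<Longrightarrow> E d = {} \<longleftrightarrow> d = emp"
  using extensionality E_emp emp_in by metis

lemma E_eq_iff: "isset A \<Longrightarrow> u \<in> U \<Longrightarrow> E u = A \<longleftrightarrow> u = st A"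
  using E_st st_E by metis

lemma is_pair_iff:
  assumes "z \<in> U" "x \<in> U" "y \<in> U"
  shows "is_pair M z x y \<longleftrightarrow> z = pr x y"
proof -
  have "is_pair M z x y \<longleftrightarrow> (\<exists>u\<in>U. \<exists>v\<in>U. u = st {x} \<and> v = st {x, y} \<and> E z = {u, v})"
    unfolding is_pair_def
    by (intro bex_cong refl) (simp add: E_eq_iff isset_single isset_doubleton assms)
  then show ?thesis
    by (simp add: assms pr_def isset_single isset_doubleton st_in E_eq_iff)
qed

lemma pr_inject[simp]:
  assumes "x \<in> U" "y \<in> U" "x' \<in> U" "y' \<in> U"
  shows "pr x y = pr x' y' \<longleftrightarrow> x = x' \<and> y = y'"
proof
  assume "pr x y = pr x' y'"
  then have "{st {x}, st {x, y}} = {st {x'}, st {x', y'}}"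
    unfolding pr_def using assms E_st isset_single isset_doubleton st_in by metis
  then have "E ` {st {x}, st {x, y}} = E ` {st {x'}, st {x', y'}}"
    by simp
  then have "{{x}, {x, y}} = {{x'}, {x', y'}}"
    using assms by (simp add: isset_single isset_doubleton E_st)
  then show "x = x' \<and> y = y'"
    by (auto simp: doubleton_eq_iff)
qed simp

lemma tmd_ins[dfns]: "tmd f \<Longrightarrow> tmd g \<Longrightarrow> tmd (\<lambda>s. ins (f s) (g s))"
  unfolding ins_def by (rule tmd_st) (auto intro!: dfns intro: tmd_rename simp: isset_insert tmd_in simp del: insert_iff)

lemma tmd_un[dfns]: "tmd f \<Longrightarrow> tmd g \<Longrightarrow> tmd (\<lambda>s. un (f s) (g s))"
  unfolding un_def by (rule tmd_st) (auto intro!: dfns intro: tmd_rename simp: isset_Un tmd_in simp del: Un_iff)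

lemma pr_eq: "x \<in> U \<Longrightarrow> y \<in> U \<Longrightarrow> pr x y = ins (ins x emp) (ins (ins x (ins y emp)) emp)"
  by (simp add: pr_def ins_def E_st isset_single isset_doubleton st_in isset_empty)

lemma tmd_pr[dfns]:
  assumes "tmd f" "tmd g"
  shows "tmd (\<lambda>s. pr (f s) (g s))"
proof (rule tmdI)
  show "dfn (\<lambda>s. s 0 = ins (ins (f (\<lambda>n. s (Suc n))) emp)
      (ins (ins (f (\<lambda>n. s (Suc n))) (ins (g (\<lambda>n. s (Suc n))) emp)) emp))"
    using assms by (intro dfns tmd_rename[OF assms(1)] tmd_rename[OF assms(2)]) simp_all
qed (simp_all add: pr_eq[symmetric] assms tmd_in)

lemma dfn_is_pair[dfns]:
  assumes "tmd f" "tmd g" "tmd h"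
  shows "dfn (\<lambda>s. is_pair M (f s) (g s) (h s))"
  by (rule dfn_cong[of _ "\<lambda>s. f s = pr (g s) (h s)"]) (simp_all add: is_pair_iff tmd_in assms dfns)

text \<open>The default \<open>emp\<close> off pairs makes both projections total terms with values
  in \<open>U\<close>, so every element can be decoded as a pair.\<close>

definition pfst :: "'a \<Rightarrow> 'a" where
  "pfst w = (if \<exists>x\<in>U. \<exists>y\<in>U. w = pr x y then THE x. x \<in> U \<and> (\<exists>y\<in>U. w = pr x y) else emp)"
definition psnd :: "'a \<Rightarrow> 'a" where
  "psnd w = (if \<exists>x\<in>U. \<exists>y\<in>U. w = pr x y then THE y. y \<in> U \<and> (\<exists>x\<in>U. w = pr x y) else emp)"

lemma pfst_pr[simp]: "x \<in> U \<Longrightarrow> y \<in> U \<Longrightarrow> pfst (pr x y) = x"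
  unfolding pfst_def by (auto intro!: the_equality)

lemma psnd_pr[simp]: "x \<in> U \<Longrightarrow> y \<in> U \<Longrightarrow> psnd (pr x y) = y"
  unfolding psnd_def by (auto intro!: the_equality)

lemma pfst_graph:
  assumes "u \<in> U"
  shows "u = pfst w \<longleftrightarrow>
    (\<exists>y\<in>U. w = pr u y) \<or> \<not> (\<exists>x\<in>U. \<exists>y\<in>U. w = pr x y) \<and> u = emp"
proof (cases "\<exists>x\<in>U. \<exists>y\<in>U. w = pr x y")
  case True
  then obtain x y where "x \<in> U" "y \<in> U" "w = pr x y" by blast
  then show ?thesis using assms by auto
next
  case False
  then show ?thesis using assms unfolding pfst_def by auto
qed

lemma psnd_graph:
  assumes "u \<in> U"
  shows "u = psnd w \<longleftrightarrow>
    (\<exists>y\<in>U. w = pr y u) \<or> \<not> (\<exists>x\<in>U. \<exists>y\<in>U. w = pr x y) \<and> u = emp"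
proof (cases "\<exists>x\<in>U. \<exists>y\<in>U. w = pr x y")
  case True
  then obtain x y where "x \<in> U" "y \<in> U" "w = pr x y" by blast
  then show ?thesis using assms by auto
next
  case False
  then show ?thesis using assms unfolding psnd_def by auto
qed

lemma pfst_in[simp]: "pfst w \<in> U"
proof (cases "\<exists>x\<in>U. \<exists>y\<in>U. w = pr x y")
  case False
  then show ?thesis unfolding pfst_def by auto
qed auto

lemma psnd_in[simp]: "psnd w \<in> U"
proof (cases "\<exists>x\<in>U. \<exists>y\<in>U. w = pr x y")
  case False
  then show ?thesis unfolding psnd_def by auto
qed auto

lemma tmd_pfst[dfns]: "tmd f \<Longrightarrow> tmd (\<lambda>s. pfst (f s))"
  by (rule tmd_sub1, rule tmdI[where f = "\<lambda>s. pfst (s 0)"], rule pfst_in, rule pfst_graph)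
    (assumption, (intro dfns; simp)+)

lemma tmd_psnd[dfns]: "tmd f \<Longrightarrow> tmd (\<lambda>s. psnd (f s))"
  by (rule tmd_sub1, rule tmdI[where f = "\<lambda>s. psnd (s 0)"], rule psnd_in, rule psnd_graph)
    (assumption, (intro dfns; simp)+)

subsection \<open>Ordinals and natural numbers\<close>

lemma dfn_is_ord[dfns]: "tmd f \<Longrightarrow> dfn (\<lambda>s. is_ord M (f s))"
  unfolding is_ord_def by (rule dfn_sub1) (intro dfns)

lemma dfn_is_nat[dfns]: "tmd f \<Longrightarrow> dfn (\<lambda>s. is_nat M (f s))"
  unfolding is_nat_def
  by (rule dfn_sub1) (intro dfns; auto simp: env_app Ext_U)

definition ord :: "'a \<Rightarrow> bool" where "ord \<alpha> \<longleftrightarrow> \<alpha> \<in> U \<and> is_ord M \<alpha>"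

lemma dfn_ord[dfns]: "tmd f \<Longrightarrow> dfn (\<lambda>s. ord (f s))"
  unfolding ord_def by (intro dfns)

lemma ord_in: "ord \<alpha> \<Longrightarrow> \<alpha> \<in> U"
  by (simp add: ord_def)

lemma ord_trans: "ord \<alpha> \<Longrightarrow> \<beta> \<in> E \<alpha> \<Longrightarrow> \<gamma> \<in> E \<beta> \<Longrightarrow> \<gamma> \<in> E \<alpha>"
  unfolding ord_def is_ord_def by blast

lemma ord_elem: "ord \<alpha> \<Longrightarrow> \<beta> \<in> E \<alpha> \<Longrightarrow> ord \<beta>"
  unfolding ord_def is_ord_def using Ext_U by blast

lemma mem_irrefl: "x \<notin> E x"
proof
  assume "x \<in> E x"
  then have "x \<in> U" by (rule Ext_U)
  then show False
    using foundation[of "st {x}"] \<open>x \<in> E x\<close> by (simp add: isset_single st_in E_st)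
qed

lemma mem_asym: "x \<in> E y \<Longrightarrow> y \<notin> E x"
proof
  assume "x \<in> E y" "y \<in> E x"
  then have "x \<in> U" "y \<in> U" by (auto intro: Ext_U)
  then show False
    using foundation[of "st {x, y}"] \<open>x \<in> E y\<close> \<open>y \<in> E x\<close>
    by (auto simp: isset_doubleton st_in E_st)
qed

lemma ord_least:
  assumes "dfn (\<lambda>s. P (s 0))" "ord \<alpha>" "P \<alpha>"
  shows "\<exists>\<beta>. ord \<beta> \<and> P \<beta> \<and> (\<forall>\<gamma>\<in>E \<beta>. \<not> P \<gamma>)"
proof (cases "\<exists>\<gamma>\<in>E \<alpha>. P \<gamma>")
  case True
  have "isset {\<gamma> \<in> E \<alpha>. P \<gamma>}"
    using assms by (intro isset_sep) (auto simp: ord_def)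
  from foundation[OF st_in[OF this]] True obtain \<beta> where
    "\<beta> \<in> E \<alpha>" "P \<beta>" "E \<beta> \<inter> {\<gamma> \<in> E \<alpha>. P \<gamma>} = {}"
    by (auto simp: E_st[OF \<open>isset _\<close>])
  then show ?thesis
    using ord_elem ord_trans assms(2) by (intro exI[of _ \<beta>]) blast
qed (use assms in blast)

lemma ord_linear:
  assumes "ord \<alpha>" "ord \<beta>"
  shows "\<alpha> \<in> E \<beta> \<or> \<alpha> = \<beta> \<or> \<beta> \<in> E \<alpha>"
proof (rule ccontr)
  let ?C = "\<lambda>\<alpha> \<beta>. \<alpha> \<in> E \<beta> \<or> \<alpha> = \<beta> \<or> \<beta> \<in> E \<alpha>"
  assume "\<not> ?C \<alpha> \<beta>"
  have "dfn (\<lambda>s. \<exists>\<beta>\<in>U. ord \<beta> \<and> \<not> ?C (s 0) \<beta>)"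
    by (intro dfns)
  from ord_least[of "\<lambda>\<alpha>. \<exists>\<beta>\<in>U. ord \<beta> \<and> \<not> ?C \<alpha> \<beta>", OF this \<open>ord \<alpha>\<close>] obtain a where
    a: "ord a" "\<exists>\<beta>\<in>U. ord \<beta> \<and> \<not> ?C a \<beta>" "\<And>\<gamma> \<beta>. \<gamma> \<in> E a \<Longrightarrow> ord \<beta> \<Longrightarrow> ?C \<gamma> \<beta>"
    using \<open>\<not> ?C \<alpha> \<beta>\<close> \<open>ord \<beta>\<close> ord_in by metis
  have "dfn (\<lambda>s. \<not> ?C a (s 0))"
    using a(1) by (intro dfns ord_in)
  with a(2) ord_least[of "\<lambda>\<beta>. \<not> ?C a \<beta>"] obtain b where
    b: "ord b" "\<not> ?C a b" "\<And>\<gamma>. \<gamma> \<in> E b \<Longrightarrow> ?C a \<gamma>"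
    by blast
  \<comment> \<open>An element of \<open>a\<close> is comparable with \<open>b\<close>; were it
    equal to \<open>b\<close> or above it, \<open>b\<close> would lie in \<open>a\<close>. The other
    inclusion uses the minimality of \<open>b\<close>.\<close>
  have "E a = E b"
    using a b ord_trans ord_elem by blast
  then show False
    using a(1) b extensionality ord_in by blast
qed

lemma ord_emp: "ord emp"
  by (simp add: ord_def is_ord_def)

lemma ord_succ:
  assumes "ord \<alpha>"
  shows "ord (ins \<alpha> \<alpha>)"
proof -
  have "\<alpha> \<in> U" "\<forall>x\<in>E \<alpha>. E x \<subseteq> E \<alpha>" "\<forall>x\<in>E \<alpha>. \<forall>y\<in>E x. E y \<subseteq> E x"
    using assms by (simp_all add: ord_def is_ord_def)
  then show ?thesis
    by (simp add: ord_def is_ord_def) blast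
qed

definition num :: "nat \<Rightarrow> 'a" where
  "num k = rec_nat emp (\<lambda>_ x. ins x x) k"

lemma num_0[simp]: "num 0 = emp" and num_Suc[simp]: "num (Suc k) = ins (num k) (num k)"
  by (simp_all add: num_def)

lemma num_ord: "ord (num k)"
  by (induction k) (simp_all add: ord_emp ord_succ)

lemma num_in[simp]: "num k \<in> U"
  using num_ord ord_in by blast

lemma is_numeral_iff: "x \<in> U \<Longrightarrow> is_numeral M k x \<longleftrightarrow> x = num k"
proof (induction k arbitrary: x)
  case (Suc k)
  have "is_numeral M (Suc k) x \<longleftrightarrow> (\<exists>y\<in>U. y = num k \<and> x = ins y y)"
    unfolding is_numeral.simps by (intro bex_cong refl) (simp add: Suc eq_ins_iff)
  then show ?case
    by simp
qed (simp add: eq_emp_iff)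

lemma num_less: "i < j \<Longrightarrow> num i \<in> E (num j)"
  by (induction j) (auto simp: less_Suc_eq simp del: num_0)

lemma num_inject[simp]: "num i = num j \<longleftrightarrow> i = j"
  using num_less mem_irrefl by (metis linorder_neqE_nat)

definition natural :: "'a \<Rightarrow> bool" where "natural n \<longleftrightarrow> n \<in> U \<and> is_nat M n"

lemma natural_in: "natural n \<Longrightarrow> n \<in> U" and natural_ord: "natural n \<Longrightarrow> ord n"
  by (simp_all add: natural_def ord_def is_nat_def)

lemma dfn_natural[dfns]: "tmd f \<Longrightarrow> dfn (\<lambda>s. natural (f s))"
  unfolding natural_def by (intro dfns)

lemma natural_cases:
  assumes "natural n"
  obtains "n = emp" | k where "k \<in> U" "n = ins k k" "natural k"
proof -
  have n: "n \<in> U" "is_ord M n" "E n = {} \<or> (\<exists>k\<in>U. E n = insert k (E k))"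
    using assms by (auto simp: natural_def is_nat_def)
  show ?thesis
  proof (cases "E n = {}")
    case False
    with n obtain k where k: "k \<in> U" "E n = insert k (E k)"
      by blast
    then have "n = ins k k"
      using n eq_ins_iff by blast
    moreover have "ord k"
      using k n ord_elem[of n k] by (simp add: ord_def)
    then have "natural k"
      using assms k by (auto simp: natural_def is_nat_def ord_def)
    ultimately show ?thesis
      using that k by blast
  qed (use n that eq_emp_iff in blast)
qed

lemma natural_emp: "natural emp"
  using ord_emp by (simp add: natural_def is_nat_def ord_def)

lemma natural_succ: "natural n \<Longrightarrow> natural (ins n n)"
  using ord_succ[of n] by (auto simp: natural_def is_nat_def ord_def)

text \<open>The natural numbers of \<open>M\<close> may be nonstandard: the proof takes a least
  counterexample, which is guaranteed only for definable \<open>P\<close>.\<close>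

lemma natural_induct:
  assumes "dfn (\<lambda>s. P (s 0))" "P emp" "\<And>k. natural k \<Longrightarrow> P k \<Longrightarrow> P (ins k k)" "natural n"
  shows "P n"
proof (rule ccontr)
  assume "\<not> P n"
  have "dfn (\<lambda>s. natural (s 0) \<and> \<not> P (s 0))"
    by (intro dfns assms)
  from ord_least[of "\<lambda>n. natural n \<and> \<not> P n", OF this natural_ord[OF assms(4)]] \<open>\<not> P n\<close> assms(4)
  obtain b where b: "natural b" "\<not> P b" "\<And>c. c \<in> E b \<Longrightarrow> natural c \<Longrightarrow> P c"
    by blast
  show False
    using \<open>natural b\<close>
  proof (cases rule: natural_cases)
    case (2 k)
    then show False
      using b assms(3) by simp
  qed (use b assms(2) in simp)
qed

lemma isset_omega: "isset {n \<in> U. is_nat M n}"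
proof -
  obtain w where w: "w \<in> U" "\<exists>z\<in>E w. E z = {}" "\<forall>y\<in>E w. \<exists>z\<in>E w. E z = insert y (E y)"
    using infinity by blast
  have "n \<in> E w" if "natural n" for n
  proof (rule natural_induct[where P = "\<lambda>n. n \<in> E w", OF _ _ _ that])
    show "dfn (\<lambda>s. s 0 \<in> E w)"
      using w(1) by (intro dfns)
    show "emp \<in> E w"
      using w(2) eq_emp_iff Ext_U by metis
    show "ins k k \<in> E w" if "natural k" "k \<in> E w" for k
      using w(3) that eq_ins_iff Ext_U by metis
  qed
  then show ?thesis
    by (intro isset_subset[OF w(1)] dfns) (auto simp: natural_def)
qed

subsection \<open>Sets that are finite in the sense of the model\<close>

text \<open>
  Finiteness is defined inductively, as membership in every family that contains the empty set
  and is closed under adjoining elements; in a nonstandard \<open>M\<close> such a set may be infinite.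
\<close>

definition fin :: "'a \<Rightarrow> bool" where
  "fin s \<longleftrightarrow> (\<forall>K\<in>U. emp \<in> E K \<and> (\<forall>t\<in>E K. \<forall>m\<in>E s. ins m t \<in> E K) \<longrightarrow> s \<in> E K)"

lemma dfn_fin[dfns]: "tmd f \<Longrightarrow> dfn (\<lambda>s. fin (f s))"
  unfolding fin_def by (rule dfn_sub1) (intro dfns emp_in)

lemma fin_emp: "fin emp"
  by (simp add: fin_def)

lemma fin_ins: "fin s \<Longrightarrow> s \<in> U \<Longrightarrow> m \<in> U \<Longrightarrow> fin (ins m s)"
  unfolding fin_def by simp

text \<open>The subsets of \<open>s\<close> with property \<open>P\<close> form a set by power set
  and separation; this is the family \<open>K\<close> to which the definition of \<open>fin\<close>
  is applied.\<close>

lemma fin_induct: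
  assumes "fin s" "s \<in> U" "dfn (\<lambda>s. P (s 0))" "P emp"
    and "\<And>t m. t \<in> U \<Longrightarrow> m \<in> E s \<Longrightarrow> P t \<Longrightarrow> P (ins m t)"
  shows "P s"
proof -
  let ?K = "{t \<in> E (st {z \<in> U. E z \<subseteq> E s}). P t}"
  have K: "isset ?K"
    using assms(2,3) by (intro isset_sep st_in isset_Pow)
  have *: "?K = {t \<in> U. E t \<subseteq> E s \<and> P t}"
    using assms(2) by (auto simp: E_st isset_Pow)
  have "s \<in> E (st ?K)"
    using assms(1)[unfolded fin_def, rule_format, OF st_in[OF K]] assms(4,5) Ext_U
    by (simp add: E_st[OF K, unfolded *] *)
  then show ?thesis
    by (simp add: E_st[OF K])
qed

lemma fin_un:
  assumes "fin s" "s \<in> U" "fin t" "t \<in> U"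
  shows "fin (un s t)"
proof (rule fin_induct[where P = "\<lambda>t. fin (un s t)", OF assms(3,4)])
  show "dfn (\<lambda>r. fin (un s (r 0)))"
    using assms by (intro dfns)
  have "un s emp = s"
    using assms by (intro extensionality) simp_all
  then show "fin (un s emp)"
    using assms by simp
  show "fin (un s (ins m t'))" if "t' \<in> U" "m \<in> E t" "fin (un s t')" for t' m
  proof -
    have "un s (ins m t') = ins m (un s t')"
      using that assms Ext_U by (intro extensionality) auto
    then show ?thesis
      using fin_ins[OF that(3)] that assms Ext_U by auto
  qed
qed

lemma fin_subset:
  assumes "fin s" "s \<in> U" "u \<in> U" "E u \<subseteq> E s"
  shows "fin u"
proof -
  have "\<forall>u\<in>U. E u \<subseteq> E s \<longrightarrow> fin u"
  proof (rule fin_induct[where P = "\<lambda>s. \<forall>u\<in>U. E u \<subseteq> E s \<longrightarrow> fin u", OF assms(1,2)])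
    show "dfn (\<lambda>s. \<forall>u\<in>U. E u \<subseteq> E (s 0) \<longrightarrow> fin u)"
      by (intro dfns)
    show "\<forall>u\<in>U. E u \<subseteq> E emp \<longrightarrow> fin u"
      using eq_emp_iff fin_emp by auto
    show "\<forall>u\<in>U. E u \<subseteq> E (ins m t) \<longrightarrow> fin u"
      if t: "t \<in> U" "m \<in> E s" "\<forall>u\<in>U. E u \<subseteq> E t \<longrightarrow> fin u" for t m
    proof (intro ballI impI)
      fix u assume u: "u \<in> U" "E u \<subseteq> E (ins m t)"
      have m: "m \<in> U" using t Ext_U by blast
      have "isset {x \<in> E u. x \<noteq> m}"
        using u m by (intro isset_sep dfns)
      then obtain v where v: "v \<in> U" "E v = {x \<in> E u. x \<noteq> m}"
        unfolding isset_def by blast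
      have "fin v"
        using t v u m by auto
      show "fin u"
      proof (cases "m \<in> E u")
        case True
        then have "u = ins m v"
          using u v m by (intro extensionality) auto
        then show ?thesis
          using fin_ins[OF \<open>fin v\<close>] v m by simp
      next
        case False
        then have "u = v"
          using u v by (intro extensionality) auto
        then show ?thesis
          using \<open>fin v\<close> by simp
      qed
    qed
  qed
  then show ?thesis
    using assms by blast
qed

end

section \<open>Definable well-orders\<close>

context zf
begin

text \<open>Well-ordered as far as \<open>M\<close> can tell: least elements are for definable
  subclasses, and from outside there may be infinite descents. Minima of two- and three-element
  classes yield linearity and transitivity.\<close>

definition dwo :: "('a \<Rightarrow> bool) \<Rightarrow> ('a \<Rightarrow> 'a \<Rightarrow> bool) \<Rightarrow> bool" where
  "dwo C L \<longleftrightarrow> (\<forall>x\<in>U. \<forall>y\<in>U. C x \<and> C y \<and> L x y \<longrightarrow> \<not> L y x) \<and>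
     (\<forall>P. dfn (\<lambda>s. P (s 0)) \<longrightarrow> (\<exists>x\<in>U. C x \<and> P x) \<longrightarrow>
        (\<exists>x\<in>U. C x \<and> P x \<and> (\<forall>y\<in>U. C y \<and> P y \<and> y \<noteq> x \<longrightarrow> L x y)))"

lemma dwo_asym: "dwo C L \<Longrightarrow> x \<in> U \<Longrightarrow> y \<in> U \<Longrightarrow> C x \<Longrightarrow> C y \<Longrightarrow> L x y \<Longrightarrow> \<not> L y x"
  unfolding dwo_def by blast

lemma dwo_least:
  assumes "dwo C L" "dfn (\<lambda>s. P (s 0))" "x \<in> U" "C x" "P x"
  obtains m where "m \<in> U" "C m" "P m" "\<And>y. y \<in> U \<Longrightarrow> C y \<Longrightarrow> P y \<Longrightarrow> y \<noteq> m \<Longrightarrow> L m y"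
proof -
  from assms(1) have "dfn (\<lambda>s. P (s 0)) \<longrightarrow> (\<exists>x\<in>U. C x \<and> P x) \<longrightarrow>
      (\<exists>x\<in>U. C x \<and> P x \<and> (\<forall>y\<in>U. C y \<and> P y \<and> y \<noteq> x \<longrightarrow> L x y))"
    unfolding dwo_def by (elim conjE) (erule allE)
  then show ?thesis
    using assms that by metis
qed

lemma dwo_ord:
  assumes "\<And>x. C x \<Longrightarrow> ord x" "dfn (\<lambda>s. C (s 0))"
  shows "dwo C (\<lambda>x y. x \<in> E y)"
  unfolding dwo_def
proof (intro conjI allI impI)
  show "\<forall>x\<in>U. \<forall>y\<in>U. C x \<and> C y \<and> x \<in> E y \<longrightarrow> y \<notin> E x"
    using mem_asym by blast
  fix P assume P: "dfn (\<lambda>s. P (s 0))" "\<exists>x\<in>U. C x \<and> P x"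
  then obtain x where x: "C x \<and> P x" by blast
  have "dfn (\<lambda>s. C (s 0) \<and> P (s 0))"
    using P assms by (intro dfns)
  from ord_least[of "\<lambda>x. C x \<and> P x", OF this _ x] x assms(1) obtain m where
    "C m" "P m" "\<forall>y\<in>E m. \<not> (C y \<and> P y)"
    by blast
  then show "\<exists>x\<in>U. C x \<and> P x \<and> (\<forall>y\<in>U. C y \<and> P y \<and> y \<noteq> x \<longrightarrow> x \<in> E y)"
    using assms(1) ord_linear ord_in by blast
qed

text \<open>The second component may range over a class that depends on the first; codes need this,
  since their sequences belong to the chosen ordinal.\<close>

definition lex_class :: "('a \<Rightarrow> bool) \<Rightarrow> ('a \<Rightarrow> 'a \<Rightarrow> bool) \<Rightarrow> 'a \<Rightarrow> bool" where
  "lex_class C D w \<longleftrightarrow> (\<exists>x\<in>U. \<exists>y\<in>U. w = pr x y \<and> C x \<and> D x y)"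

definition lex_less :: "('a \<Rightarrow> 'a \<Rightarrow> bool) \<Rightarrow> ('a \<Rightarrow> 'a \<Rightarrow> 'a \<Rightarrow> bool) \<Rightarrow> 'a \<Rightarrow> 'a \<Rightarrow> bool" where
  "lex_less L K w w' \<longleftrightarrow> L (pfst w) (pfst w') \<or> pfst w = pfst w' \<and> K (pfst w) (psnd w) (psnd w')"

lemma lex_class_pr[simp]: "x \<in> U \<Longrightarrow> y \<in> U \<Longrightarrow> lex_class C D (pr x y) \<longleftrightarrow> C x \<and> D x y"
  by (auto simp: lex_class_def)

lemma lex_less_pr[simp]: "x \<in> U \<Longrightarrow> y \<in> U \<Longrightarrow> x' \<in> U \<Longrightarrow> y' \<in> U \<Longrightarrow>
    lex_less L K (pr x y) (pr x' y') \<longleftrightarrow> L x x' \<or> x = x' \<and> K x y y'"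
  by (simp add: lex_less_def)

lemma lex_classE: "lex_class C D w \<Longrightarrow> (\<And>x y. x \<in> U \<Longrightarrow> y \<in> U \<Longrightarrow> w = pr x y \<Longrightarrow> C x \<Longrightarrow> D x y \<Longrightarrow> R) \<Longrightarrow> R"
  by (auto simp: lex_class_def)

lemma dfn_lex_class:
  assumes "dfn (\<lambda>s. C (s 0))" "dfn (\<lambda>s. D (s 0) (s 1))" "tmd f"
  shows "dfn (\<lambda>s. lex_class C D (f s))"
  unfolding lex_class_def
  by (intro dfns assms(3)[THEN tmd_rename] dfn_sub1[OF assms(1)] dfn_sub2[OF assms(2)])

lemma dfn_lex_less:
  assumes "dfn (\<lambda>s. L (s 0) (s 1))" "dfn (\<lambda>s. K (s 0) (s 1) (s 2))" "tmd f" "tmd g"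
  shows "dfn (\<lambda>s. lex_less L K (f s) (g s))"
  unfolding lex_less_def
  by (intro dfns assms(3,4) dfn_sub2[OF assms(1)] dfn_sub3[OF assms(2)])

text \<open>Take the least first component that admits some second one, then the least second one
  for it; definability of \<open>D\<close> makes the first search definable.\<close>

lemma dwo_pair:
  assumes "dwo C L" "\<And>x. x \<in> U \<Longrightarrow> C x \<Longrightarrow> dwo (D x) (K x)" "dfn (\<lambda>s. D (s 0) (s 1))"
  shows "dwo (lex_class C D) (lex_less L K)"
  unfolding dwo_def
proof (intro conjI allI impI ballI)
  fix w w' assume "w \<in> U" "w' \<in> U" "lex_class C D w \<and> lex_class C D w' \<and> lex_less L K w w'"
  then obtain x y x' y' where w: "x \<in> U" "y \<in> U" "C x" "D x y" "w = pr x y"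
    "x' \<in> U" "y' \<in> U" "C x'" "D x' y'" "w' = pr x' y'" "L x x' \<or> x = x' \<and> K x y y'"
    by (auto elim!: lex_classE)
  have "\<not> L x' x \<or> \<not> L x x'" "\<not> K x y y' \<or> \<not> K x y' y" if "x = x'"
    using dwo_asym[OF assms(1), of x x'] dwo_asym[OF assms(2), of x y y'] w that by blast+
  moreover have "L x x' \<Longrightarrow> \<not> L x' x"
    using dwo_asym[OF assms(1), of x x'] w by blast
  ultimately show "\<not> lex_less L K w' w"
    using w by auto
next
  fix P assume P: "dfn (\<lambda>s. P (s 0))" "\<exists>w\<in>U. lex_class C D w \<and> P w"
  have 1: "dfn (\<lambda>s. \<exists>y\<in>U. D (s 0) y \<and> P (pr (s 0) y))"
    by (intro dfns dfn_sub2[OF assms(3)] dfn_sub1[OF P(1)])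
  obtain x y where "x \<in> U" "y \<in> U" "C x" "D x y" "P (pr x y)"
    using P(2) by (auto simp: lex_class_def)
  then obtain x0 where x0: "x0 \<in> U" "C x0" "\<exists>y\<in>U. D x0 y \<and> P (pr x0 y)"
    "\<And>x. x \<in> U \<Longrightarrow> C x \<Longrightarrow> \<exists>y\<in>U. D x y \<and> P (pr x y) \<Longrightarrow> x \<noteq> x0 \<Longrightarrow> L x0 x"
    using dwo_least[OF assms(1) 1] by blast
  have "dfn (\<lambda>s. P (pr x0 (s 0)))"
    by (intro dfns dfn_sub1[OF P(1)] x0)
  then obtain y0 where y0: "y0 \<in> U" "D x0 y0" "P (pr x0 y0)"
    "\<And>y. y \<in> U \<Longrightarrow> D x0 y \<Longrightarrow> P (pr x0 y) \<Longrightarrow> y \<noteq> y0 \<Longrightarrow> K x0 y0 y"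
    using dwo_least[OF assms(2)[OF x0(1,2)], of "\<lambda>y. P (pr x0 y)"] x0(3) by blast
  show "\<exists>w\<in>U. lex_class C D w \<and> P w \<and> (\<forall>w'\<in>U. lex_class C D w' \<and> P w' \<and> w' \<noteq> w \<longrightarrow> lex_less L K w w')"
  proof (rule bexI[of _ "pr x0 y0"], intro conjI ballI impI)
    fix w' assume "w' \<in> U" "lex_class C D w' \<and> P w' \<and> w' \<noteq> pr x0 y0"
    then obtain x y where w': "x \<in> U" "y \<in> U" "w' = pr x y" "C x" "D x y" "P (pr x y)"
      "x \<noteq> x0 \<or> y \<noteq> y0"
      by (auto simp: lex_class_def)
    then show "lex_less L K (pr x0 y0) w'"
      using x0 y0 by (cases "x = x0") auto
  qed (use x0 y0 in simp_all)
qed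

section \<open>A definable well-order from ordinal definability\<close>

lemma dfn_ex1[dfns]:
  assumes "dfn (\<lambda>s. Q (s 0) (\<lambda>n. s (Suc n)))"
  shows "dfn (\<lambda>s. \<exists>!y. y \<in> U \<and> Q y s)"
proof (rule dfn_cong)
  show "(\<exists>!y. y \<in> U \<and> Q y s) \<longleftrightarrow> (\<exists>y\<in>U. Q y s \<and> (\<forall>z\<in>U. Q z s \<longrightarrow> z = y))" for s
    by blast
  have "dfn (\<lambda>s. Q (s 0) (\<lambda>n. s (Suc (Suc n))))"
    using dfn_rename[OF assms, of "case_nat 0 (\<lambda>n. Suc (Suc n))"] by simp
  then show "dfn (\<lambda>s. \<exists>y\<in>U. Q y s \<and> (\<forall>z\<in>U. Q z s \<longrightarrow> z = y))"
    using assms by (intro dfns)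
qed

lemma maps_to_iff: "x \<in> U \<Longrightarrow> y \<in> U \<Longrightarrow> maps_to M f x y \<longleftrightarrow> pr x y \<in> E f"
  unfolding maps_to_def by (auto simp: is_pair_iff Ext_U)

lemma dfn_maps_to[dfns]: "tmd f \<Longrightarrow> tmd g \<Longrightarrow> tmd h \<Longrightarrow> dfn (\<lambda>s. maps_to M (f s) (g s) (h s))"
  by (rule dfn_cong[of _ "\<lambda>s. pr (g s) (h s) \<in> E (f s)"]) (simp_all add: maps_to_iff tmd_in dfns)

lemma dfn_is_numeral[dfns]: "tmd f \<Longrightarrow> dfn (\<lambda>s. is_numeral M k (f s))"
  by (rule dfn_cong[of _ "\<lambda>s. f s = num k"]) (simp_all add: is_numeral_iff tmd_in dfns)

lemma tagged_iff: "x \<in> U \<Longrightarrow> c \<in> U \<Longrightarrow> tagged M k x c \<longleftrightarrow> c = pr (num k) x"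
  unfolding tagged_def by (auto simp: is_pair_iff is_numeral_iff)

lemma dfn_tagged[dfns]: "tmd f \<Longrightarrow> tmd g \<Longrightarrow> dfn (\<lambda>s. tagged M k (f s) (g s))"
  by (rule dfn_cong[of _ "\<lambda>s. g s = pr (num k) (f s)"]) (simp_all add: tagged_iff tmd_in dfns)

lemma dfn_is_fun_on[dfns]:
  assumes "tmd f" "tmd g"
  shows "dfn (\<lambda>s. is_fun_on M (f s) (g s))"
  unfolding is_fun_on_def by (intro dfns assms[THEN tmd_rename])

lemma dfn_is_V[dfns]:
  assumes "tmd f" "tmd g"
  shows "dfn (\<lambda>s. is_V M (f s) (g s))"
  unfolding is_V_def
  by (intro dfns assms[THEN tmd_rename]) (auto simp: Ext_U tmd_in[OF assms(1)] env_def)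

lemma dfn_is_term[dfns]:
  assumes "tmd f" "tmd g"
  shows "dfn (\<lambda>s. is_term M (f s) (g s))"
  unfolding is_term_def by (intro dfns assms[THEN tmd_rename])

lemma dfn_is_assignment[dfns]:
  assumes "tmd f" "tmd g"
  shows "dfn (\<lambda>s. is_assignment M (f s) (g s))"
  unfolding is_assignment_def by (intro dfns assms[THEN tmd_rename]) auto

lemma dfn_term_value[dfns]:
  assumes "tmd f" "tmd g" "tmd h" "tmd i" "tmd j"
  shows "dfn (\<lambda>s. term_value M (f s) (g s) (h s) (i s) (j s))"
  unfolding term_value_def by (intro dfns assms[THEN tmd_rename])

lemma is_fun_on_ex: "is_fun_on M f d \<Longrightarrow> x \<in> E d \<Longrightarrow> \<exists>y\<in>U. maps_to M f x y"
  unfolding is_fun_on_def by blast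

lemma is_fun_on_unique:
  "is_fun_on M f d \<Longrightarrow> x \<in> E d \<Longrightarrow> y \<in> U \<Longrightarrow> z \<in> U \<Longrightarrow> maps_to M f x y \<Longrightarrow> maps_to M f x z \<Longrightarrow> y = z"
  unfolding is_fun_on_def by blast

definition agree_below :: "'a \<Rightarrow> 'a \<Rightarrow> 'a \<Rightarrow> bool" where
  "agree_below f g k \<longleftrightarrow> (\<forall>j\<in>E k. \<forall>y\<in>U. maps_to M f j y \<longleftrightarrow> maps_to M g j y)"

lemma agree_below_sym: "agree_below f g k \<Longrightarrow> agree_below g f k"
  unfolding agree_below_def by blast

lemma agree_below_trans: "agree_below f g k \<Longrightarrow> agree_below g h k \<Longrightarrow> agree_below f h k"
  unfolding agree_below_def by blast

lemma agree_below_mono: "agree_below f g k \<Longrightarrow> E j \<subseteq> E k \<Longrightarrow> agree_below f g j"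
  unfolding agree_below_def by blast

lemma dfn_agree_below[dfns]:
  assumes "tmd f" "tmd g" "tmd h"
  shows "dfn (\<lambda>s. agree_below (f s) (g s) (h s))"
  unfolding agree_below_def by (intro dfns assms[THEN tmd_rename])

lemma is_fun_on_eqI:
  assumes "is_fun_on M f d" "is_fun_on M g d" "f \<in> U" "g \<in> U" "agree_below f g d"
  shows "f = g"
proof (rule extensionality)
  have *: "E f \<subseteq> E g" if f: "is_fun_on M f d" and "agree_below f g d" for f g
  proof
    fix z assume z: "z \<in> E f"
    then obtain x y where "x \<in> E d" "y \<in> U" "is_pair M z x y"
      using f unfolding is_fun_on_def by blast
    moreover from this have "z = pr x y"
      using z Ext_U is_pair_iff by blast
    ultimately show "z \<in> E g"
      using that(2) z by (simp add: agree_below_def maps_to_iff Ext_U)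
  qed
  show "E f = E g"
    using *[OF assms(1,5)] *[OF assms(2) agree_below_sym[OF assms(5)]] by blast
qed (use assms in auto)

text \<open>Two witnessing recursions cannot first differ at some \<beta>, since the level at
  \<beta> is computed from the values below it. Uniqueness lets codes mention only \<alpha> and lets
  replacement collect levels.\<close>

lemma is_V_unique:
  assumes "is_V M \<alpha> v" "is_V M \<alpha> w" "\<alpha> \<in> U" "v \<in> U" "w \<in> U"
  shows "v = w"
proof -
  let ?R = "\<lambda>f. \<forall>\<beta>\<in>E (ins \<alpha> \<alpha>). \<forall>y\<in>U. maps_to M f \<beta> y \<longrightarrow>
           E y = {x \<in> U. \<exists>\<gamma>\<in>E \<beta>. \<exists>z\<in>U. maps_to M f \<gamma> z \<and> E x \<subseteq> E z}"
  have ex: "\<exists>f\<in>U. is_fun_on M f (ins \<alpha> \<alpha>) \<and> ?R f \<and> maps_to M f \<alpha> v" if "is_V M \<alpha> v" for v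
    using that assms(3) unfolding is_V_def by (auto simp: eq_ins_iff)
  obtain f g where f: "f \<in> U" "is_fun_on M f (ins \<alpha> \<alpha>)" "?R f" "maps_to M f \<alpha> v"
    and g: "g \<in> U" "is_fun_on M g (ins \<alpha> \<alpha>)" "?R g" "maps_to M g \<alpha> w"
    using ex[OF assms(1)] ex[OF assms(2)] by blast
  have \<alpha>: "ord \<alpha>" "ord (ins \<alpha> \<alpha>)"
    using assms(1,3) ord_succ by (simp_all add: is_V_def ord_def)
  let ?Q = "\<lambda>\<beta>. \<beta> \<in> E (ins \<alpha> \<alpha>) \<and> (\<exists>y\<in>U. \<exists>z\<in>U. maps_to M f \<beta> y \<and> maps_to M g \<beta> z \<and> y \<noteq> z)"
  have "dfn (\<lambda>s. ?Q (s 0))"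
    using f(1) g(1) assms(3) by (intro dfns ins_in)
  note least = ord_least[of ?Q, OF this]
  have "\<not> ?Q \<beta>" for \<beta>
  proof
    assume "?Q \<beta>"
    then obtain \<beta> where \<beta>: "ord \<beta>" "?Q \<beta>" "\<forall>\<gamma>\<in>E \<beta>. \<not> ?Q \<gamma>"
      using least[of \<beta>] ord_elem[OF \<alpha>(2)] by blast
    then obtain y z where yz: "y \<in> U" "z \<in> U" "maps_to M f \<beta> y" "maps_to M g \<beta> z" "y \<noteq> z"
      by blast
    have "maps_to M f \<gamma> u \<longleftrightarrow> maps_to M g \<gamma> u" if "\<gamma> \<in> E \<beta>" "u \<in> U" for \<gamma> u
    proof -
      have "\<gamma> \<in> E (ins \<alpha> \<alpha>)"
        using \<beta>(2) that ord_trans[OF \<alpha>(2)] by blast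
      then show ?thesis
        using is_fun_on_ex[OF f(2)] is_fun_on_ex[OF g(2)] \<beta>(3) that by metis
    qed
    then have "{x \<in> U. \<exists>\<gamma>\<in>E \<beta>. \<exists>u\<in>U. maps_to M f \<gamma> u \<and> E x \<subseteq> E u}
        = {x \<in> U. \<exists>\<gamma>\<in>E \<beta>. \<exists>u\<in>U. maps_to M g \<gamma> u \<and> E x \<subseteq> E u}"
      by blast
    moreover have "E y = {x \<in> U. \<exists>\<gamma>\<in>E \<beta>. \<exists>u\<in>U. maps_to M f \<gamma> u \<and> E x \<subseteq> E u}"
      using f(3) yz(1,3) \<beta>(2) by (elim conjE) (drule (1) bspec, drule (1) bspec, drule (1) mp)
    moreover have "E z = {x \<in> U. \<exists>\<gamma>\<in>E \<beta>. \<exists>u\<in>U. maps_to M g \<gamma> u \<and> E x \<subseteq> E u}"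
      using g(3) yz(2,4) \<beta>(2) by (elim conjE) (drule (1) bspec, drule (1) bspec, drule (1) mp)
    ultimately have "E y = E z"
      by simp
    then show False
      using yz extensionality by blast
  qed
  moreover have "\<alpha> \<in> E (ins \<alpha> \<alpha>)"
    using assms(3) by simp
  ultimately show ?thesis
    using f g assms by blast
qed

end

section \<open>Instructions, and the lexicographic order of sequences of truth sets\<close>

context zf
begin

definition ord2 :: "'a \<Rightarrow> bool" where
  "ord2 = lex_class ord (\<lambda>_. ord)"

definition ord2_less :: "'a \<Rightarrow> 'a \<Rightarrow> bool" where
  "ord2_less = lex_less (\<lambda>x y. x \<in> E y) (\<lambda>_ x y. x \<in> E y)"

definition instr_class :: "'a \<Rightarrow> bool" where
  "instr_class = lex_class ord (\<lambda>_. lex_class ord2 (\<lambda>_. ord2))"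

definition instr_less :: "'a \<Rightarrow> 'a \<Rightarrow> bool" where
  "instr_less = lex_less (\<lambda>x y. x \<in> E y) (\<lambda>_. lex_less ord2_less (\<lambda>_. ord2_less))"

lemma dfn_ord2[dfns]: "tmd f \<Longrightarrow> dfn (\<lambda>s. ord2 (f s))"
  unfolding ord2_def by (intro dfn_lex_class dfns)

lemma dfn_ord2_less[dfns]: "tmd f \<Longrightarrow> tmd g \<Longrightarrow> dfn (\<lambda>s. ord2_less (f s) (g s))"
  unfolding ord2_less_def by (intro dfn_lex_less dfns)

lemma dfn_instr_class[dfns]: "tmd f \<Longrightarrow> dfn (\<lambda>s. instr_class (f s))"
  unfolding instr_class_def by (intro dfn_lex_class dfns)

lemma dfn_instr_less[dfns]: "tmd f \<Longrightarrow> tmd g \<Longrightarrow> dfn (\<lambda>s. instr_less (f s) (g s))"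
  unfolding instr_less_def by (intro dfn_lex_less dfns)

lemma dwo_ord2: "dwo ord2 ord2_less"
  unfolding ord2_def ord2_less_def by (intro dwo_pair dwo_ord dfns)

lemma dwo_instr: "dwo instr_class instr_less"
  unfolding instr_class_def instr_less_def by (intro dwo_pair dwo_ord dwo_ord2 dfn_lex_class dfns)

text \<open>
  \<open>instr \<alpha> v p k T X b\<close>: the instruction \<open>b\<close> builds the truth set \<open>X\<close> from the values of \<open>T\<close>
  below \<open>k\<close>. The clauses are those of \<open>sat_step\<close> with the formula replaced by \<open>b\<close>, which
  mentions no set but ordinals. Indices occur as \<open>pr j j\<close> because the last two components of an
  instruction are pairs of ordinals (as terms are).
\<close>

definition instr :: "'a \<Rightarrow> 'a \<Rightarrow> 'a \<Rightarrow> 'a \<Rightarrow> 'a \<Rightarrow> 'a \<Rightarrow> 'a \<Rightarrow> bool" where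
  "instr \<alpha> v p k T X b \<longleftrightarrow>
     (\<exists>t\<in>U. \<exists>u\<in>U. is_term M \<alpha> t \<and> is_term M \<alpha> u \<and> b = pr (num 0) (pr t u) \<and>
        E X = {a \<in> U. is_assignment M v a \<and>
          (\<exists>x\<in>U. \<exists>y\<in>U. term_value M \<alpha> p t a x \<and> term_value M \<alpha> p u a y \<and> x = y)}) \<or>
     (\<exists>t\<in>U. \<exists>u\<in>U. is_term M \<alpha> t \<and> is_term M \<alpha> u \<and> b = pr (num 1) (pr t u) \<and>
        E X = {a \<in> U. is_assignment M v a \<and>
          (\<exists>x\<in>U. \<exists>y\<in>U. term_value M \<alpha> p t a x \<and> term_value M \<alpha> p u a y \<and> x \<in> E y)}) \<or>
     (\<exists>j\<in>E k. \<exists>Y\<in>U. maps_to M T j Y \<and> b = pr (num 2) (pr (pr j j) (pr j j)) \<and>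
        E X = {a \<in> U. is_assignment M v a \<and> a \<notin> E Y}) \<or>
     (\<exists>i\<in>E k. \<exists>Y\<in>U. maps_to M T i Y \<and> (\<exists>j\<in>E k. \<exists>Z\<in>U. maps_to M T j Z \<and>
        b = pr (num 3) (pr (pr i i) (pr j j)) \<and> E X = E Y \<inter> E Z)) \<or>
     (\<exists>j\<in>E k. \<exists>Y\<in>U. maps_to M T j Y \<and> (\<exists>i\<in>U. is_nat M i \<and>
        b = pr (num 4) (pr (pr i i) (pr j j)) \<and>
        E X = {a \<in> U. is_assignment M v a \<and>
          (\<exists>c\<in>E Y. \<forall>m\<in>U. is_nat M m \<and> m \<noteq> i \<longrightarrow>
             (\<forall>y\<in>U. maps_to M c m y \<longleftrightarrow> maps_to M a m y))}))"

lemma dfn_instr[dfns]: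
  assumes "tmd f1" "tmd f2" "tmd f3" "tmd f4" "tmd f5" "tmd f6" "tmd f7"
  shows "dfn (\<lambda>s. instr (f1 s) (f2 s) (f3 s) (f4 s) (f5 s) (f6 s) (f7 s))"
  unfolding instr_def
  by (intro dfns assms[THEN tmd_rename] num_in) (auto simp: Ext_U)

lemma instr_agree_below:
  assumes "instr \<alpha> v p k T X b" "agree_below T T' k"
  shows "instr \<alpha> v p k T' X b"
proof -
  have "maps_to M T j Y \<longleftrightarrow> maps_to M T' j Y" if "j \<in> E k" "Y \<in> U" for j Y
    using assms(2) that unfolding agree_below_def by blast
  then show ?thesis
    using assms(1) unfolding instr_def by (simp only: cong: bex_cong conj_cong)
qed

text \<open>The tag of \<open>b\<close> selects the clause and its two pairs determine the terms or
  indices; what remains are the values of \<open>T\<close> at the indices, and \<open>fu\<close>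
  makes them unique.\<close>

lemma instr_unique:
  assumes X: "instr \<alpha> v p k T X b" and X': "instr \<alpha> v p k T X' b" and U: "X \<in> U" "X' \<in> U"
    and fu: "\<And>j Y Z. j \<in> E k \<Longrightarrow> Y \<in> U \<Longrightarrow> Z \<in> U \<Longrightarrow> maps_to M T j Y \<Longrightarrow> maps_to M T j Z \<Longrightarrow> Y = Z"
  shows "X = X'"
proof -
  have "E X = E X'"
    using X[unfolded instr_def]
  proof (elim disjE bexE conjE, goal_cases)
    case (1 t u)
    then show ?case
      \<comment> \<open>Keeping \<open>num\<close> folded lets \<open>num_inject\<close> refute the
        clauses with a different tag.\<close>
      using X' unfolding instr_def by (auto simp: Ext_U simp del: num_0 num_Suc)
  next
    case (2 t u)
    then show ?case
      using X' unfolding instr_def by (auto simp: Ext_U simp del: num_0 num_Suc)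
  next
    case (3 j Y)
    then show ?case
      using X' unfolding instr_def by (auto simp: Ext_U simp del: num_0 num_Suc dest: fu)
  next
    case (4 i Y j Z)
    then show ?case
      using X' unfolding instr_def by (auto simp: Ext_U simp del: num_0 num_Suc dest: fu)
  next
    case (5 j Y i)
    then show ?case
      using X' unfolding instr_def by (auto simp: Ext_U simp del: num_0 num_Suc dest: fu)
  qed
  then show ?thesis
    using U extensionality by blast
qed

text \<open>The constant for \<open>p\<close> is coded by (1, 0), so terms are pairs of ordinals
  whatever set \<open>p\<close> is. This is what makes instructions comparable.\<close>

lemma is_term_ord2:
  assumes "is_term M \<alpha> t" "t \<in> U" "ord \<alpha>"
  shows "ord2 t"
proof -
  have "ord2 (pr (num k) x)" if "ord x" for k x
    using that by (simp add: ord2_def num_ord ord_in)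
  moreover have "ord i" if "is_nat M i" "i \<in> U" for i
    using that by (simp add: is_nat_def ord_def)
  ultimately show ?thesis
    using assms(1,2) num_ord[of 0] ord_elem[OF assms(3)] Ext_U unfolding is_term_def
    by (elim disjE bexE conjE) (metis tagged_iff is_numeral_iff)+
qed

text \<open>Subformulas are forgotten and only their positions in the sequence are kept: positions
  are ordinals, formulas are not.\<close>

lemma sat_step_instr:
  assumes "sat_step M \<alpha> v p k S T F X" "ord \<alpha>" "natural k"
  shows "\<exists>b\<in>U. instr_class b \<and> instr \<alpha> v p k T X b"
proof -
  have kE: "ord j" "j \<in> U" if "j \<in> E k" for j
    using that assms(3) natural_ord ord_elem ord_in by blast+
  have nE: "ord i" if "is_nat M i" "i \<in> U" for i
    using that by (simp add: is_nat_def ord_def)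
  have "\<exists>b\<in>U. instr_class b \<and> instr \<alpha> v p k T X b" if "t \<in> U" "u \<in> U" "ord2 t" "ord2 u"
    "instr \<alpha> v p k T X (pr (num m) (pr t u))" for m t u
    using that by (intro bexI[of _ "pr (num m) (pr t u)"]) (simp_all add: instr_class_def num_ord)
  note I = this
  have d: "ord2 (pr j j)" if "ord j" for j
    using that by (simp add: ord2_def ord_in)
  show ?thesis
    using assms(1)[unfolded sat_step_def]
  proof (elim disjE bexE conjE, goal_cases)
    case (1 t u)
    then show ?case
      using is_term_ord2[OF _ _ assms(2)] by (intro I[of t u 0]) (auto simp: instr_def)
  next
    case (2 t u)
    then show ?case
      using is_term_ord2[OF _ _ assms(2)] by (intro I[of t u 1]) (auto simp: instr_def)
  next
    case (3 j G Y)
    have "instr \<alpha> v p k T X (pr (num 2) (pr (pr j j) (pr j j)))"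
      unfolding instr_def using 3 by blast
    then show ?case
      using 3 kE d by (intro I[of "pr j j" "pr j j" 2]) simp_all
  next
    case (4 i G Y j H Z)
    have "instr \<alpha> v p k T X (pr (num 3) (pr (pr i i) (pr j j)))"
      unfolding instr_def using 4 by blast
    then show ?case
      using 4 kE d by (intro I[of "pr i i" "pr j j" 3]) simp_all
  next
    case (5 j G Y i)
    have "instr \<alpha> v p k T X (pr (num 4) (pr (pr i i) (pr j j)))"
      unfolding instr_def using 5 by blast
    then show ?case
      using 5 kE nE d by (intro I[of "pr i i" "pr j j" 4]) simp_all
  qed
qed

definition instr_at :: "'a \<Rightarrow> 'a \<Rightarrow> 'a \<Rightarrow> 'a \<Rightarrow> 'a \<Rightarrow> 'a \<Rightarrow> bool" where
  "instr_at p \<alpha> v k T b \<longleftrightarrow> instr_class b \<and> (\<exists>Y\<in>U. maps_to M T k Y \<and> instr \<alpha> v p k T Y b)"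

definition valid :: "'a \<Rightarrow> 'a \<Rightarrow> 'a \<Rightarrow> 'a \<Rightarrow> 'a \<Rightarrow> bool" where
  "valid p \<alpha> v n T \<longleftrightarrow> is_fun_on M T (ins n n) \<and> (\<forall>k\<in>E (ins n n). \<exists>b\<in>U. instr_at p \<alpha> v k T b)"

text \<open>An instruction of \<open>T\<close> at \<open>k\<close> below all those of
  \<open>T'\<close>: this compares the least instructions without naming them. Before
  \<open>k\<close> the values themselves agree, not merely their least instructions.\<close>

definition seq_less :: "'a \<Rightarrow> 'a \<Rightarrow> 'a \<Rightarrow> 'a \<Rightarrow> 'a \<Rightarrow> 'a \<Rightarrow> bool" where
  "seq_less p \<alpha> v d T T' \<longleftrightarrow> (\<exists>k\<in>E d. agree_below T T' k \<and>
     (\<exists>b\<in>U. instr_at p \<alpha> v k T b \<and> (\<forall>b'\<in>U. instr_at p \<alpha> v k T' b' \<longrightarrow> instr_less b b')))"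

lemma dfn_instr_at[dfns]:
  assumes "tmd f1" "tmd f2" "tmd f3" "tmd f4" "tmd f5" "tmd f6"
  shows "dfn (\<lambda>s. instr_at (f1 s) (f2 s) (f3 s) (f4 s) (f5 s) (f6 s))"
  unfolding instr_at_def by (intro dfns assms[THEN tmd_rename])

lemma dfn_valid[dfns]:
  assumes "tmd f1" "tmd f2" "tmd f3" "tmd f4" "tmd f5"
  shows "dfn (\<lambda>s. valid (f1 s) (f2 s) (f3 s) (f4 s) (f5 s))"
  unfolding valid_def by (intro dfns assms[THEN tmd_rename])

lemma dfn_seq_less[dfns]:
  assumes "tmd f1" "tmd f2" "tmd f3" "tmd f4" "tmd f5" "tmd f6"
  shows "dfn (\<lambda>s. seq_less (f1 s) (f2 s) (f3 s) (f4 s) (f5 s) (f6 s))"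
  unfolding seq_less_def by (intro dfns assms[THEN tmd_rename])

lemma instr_at_agree:
  assumes "instr_at p \<alpha> v k T b" "agree_below T T' m" "ord m" "k \<in> E m"
  shows "instr_at p \<alpha> v k T' b"
proof -
  have "agree_below T T' k"
    using assms ord_trans by (auto intro: agree_below_mono)
  then show ?thesis
    using assms instr_agree_below unfolding instr_at_def agree_below_def[of T T' m] by blast
qed

text \<open>Equal earlier values and a common instruction force equal values at \<open>k\<close>, by
  \<open>instr_unique\<close>. So two valid sequences first differ at a place where they share no
  instruction.\<close>

lemma agree_below_succ:
  assumes "valid p \<alpha> v n T" "valid p \<alpha> v n T'" "n \<in> U" "ord (ins n n)" "k \<in> E (ins n n)"
    and "agree_below T T' k" "instr_at p \<alpha> v k T b" "instr_at p \<alpha> v k T' b"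
  shows "agree_below T T' (ins k k)"
proof -
  have k: "k \<in> U" using assms Ext_U by blast
  have fT: "is_fun_on M T (ins n n)" and fT': "is_fun_on M T' (ins n n)"
    using assms by (simp_all add: valid_def)
  obtain Y Y' where Y: "Y \<in> U" "maps_to M T k Y" "instr \<alpha> v p k T Y b"
    and Y': "Y' \<in> U" "maps_to M T' k Y'" "instr \<alpha> v p k T' Y' b"
    using assms(7,8) unfolding instr_at_def by blast
  have "Y = Y'"
  proof (rule instr_unique[OF Y(3) instr_agree_below[OF Y'(3) agree_below_sym[OF assms(6)]] Y(1) Y'(1)])
    show "X = Z" if "j \<in> E k" "X \<in> U" "Z \<in> U" "maps_to M T j X" "maps_to M T j Z" for j X Z
      using is_fun_on_unique[OF fT ord_trans[OF assms(4,5) that(1)] that(2-)] .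
  qed
  moreover have "maps_to M T k Z \<longleftrightarrow> Z = Y" "maps_to M T' k Z \<longleftrightarrow> Z = Y'" if "Z \<in> U" for Z
    using is_fun_on_unique[OF fT assms(5)] is_fun_on_unique[OF fT' assms(5)] Y Y' that by blast+
  ultimately show ?thesis
    using assms(6) k unfolding agree_below_def by auto
qed

text \<open>Lexicographic orders on infinite sequences need not be well-founded; here the length is
  a natural number of \<open>M\<close>, and induction on \<open>k\<close> yields a sequence that is
  least as far as positions below \<open>k\<close> are concerned. In the step, the least instruction
  at \<open>k\<close> is chosen among the sequences that agree below \<open>k\<close>.\<close>

lemma dwo_valid:
  assumes "ord \<alpha>" "v \<in> U" "p \<in> U" "natural n"
  shows "dwo (valid p \<alpha> v n) (seq_less p \<alpha> v (ins n n))"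
  unfolding dwo_def
proof (intro conjI ballI impI allI)
  let ?d = "ins n n"
  have n: "n \<in> U" "natural ?d" "ord ?d" "?d \<in> U" "\<alpha> \<in> U"
    using assms natural_in natural_succ natural_ord ord_in by blast+
  have irr: "\<not> (instr_less b b' \<and> instr_less b' b)" if "instr_at p \<alpha> v k T b" "instr_at p \<alpha> v l T' b'" "b \<in> U" "b' \<in> U"
    for k l T T' b b'
    using that dwo_asym[OF dwo_instr] unfolding instr_at_def by blast
  {
    fix T T' assume T: "T \<in> U" "T' \<in> U"
      and "valid p \<alpha> v n T \<and> valid p \<alpha> v n T' \<and> seq_less p \<alpha> v ?d T T'"
    then obtain k b where k: "k \<in> E ?d" "agree_below T T' k" "b \<in> U" "instr_at p \<alpha> v k T b"
      "\<And>b'. b' \<in> U \<Longrightarrow> instr_at p \<alpha> v k T' b' \<Longrightarrow> instr_less b b'"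
      unfolding seq_less_def by blast
    show "\<not> seq_less p \<alpha> v ?d T' T"
    proof
      assume "seq_less p \<alpha> v ?d T' T"
      then obtain l c where l: "l \<in> E ?d" "agree_below T' T l" "c \<in> U" "instr_at p \<alpha> v l T' c"
        "\<And>b'. b' \<in> U \<Longrightarrow> instr_at p \<alpha> v l T b' \<Longrightarrow> instr_less c b'"
        unfolding seq_less_def by blast
      have o: "ord k" "ord l"
        using k l n ord_elem by blast+
      show False
        using ord_linear[OF o]
      proof (elim disjE)
        assume "k \<in> E l"
        \<comment> \<open>\<open>T'\<close> agrees with \<open>T\<close> below \<open>l\<close>, so
          \<open>b\<close> is also an instruction of \<open>T'\<close> at \<open>k\<close> and would
          have to lie below itself.\<close>
        then have "instr_less b b"
          using k instr_at_agree[OF k(4) agree_below_sym[OF l(2)] o(2)] by blast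
        then show False
          using irr[OF k(4,4,3,3)] by blast
      next
        assume "l \<in> E k"
        then have "instr_less c c"
          using l instr_at_agree[OF l(4) agree_below_sym[OF k(2)] o(1)] by blast
        then show False
          using irr[OF l(4,4,3,3)] by blast
      next
        assume "k = l"
        then show False
          using k l irr by blast
      qed
    qed
  }
  fix P assume P: "dfn (\<lambda>s. P (s 0))" "\<exists>T\<in>U. valid p \<alpha> v n T \<and> P T"
  let ?V = "\<lambda>T. valid p \<alpha> v n T \<and> P T"
  \<comment> \<open>\<open>T\<close> is least when only the positions below \<open>k\<close> are
    compared.\<close>
  let ?G = "\<lambda>k T. \<forall>T'\<in>U. ?V T' \<longrightarrow> agree_below T T' k \<or> seq_less p \<alpha> v k T T'"
  have V: "dfn (\<lambda>s. ?V (f s))" if "tmd f" for f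
    using that assms n by (intro dfns dfn_sub1[OF P(1)])
  \<comment> \<open>Membership in \<open>ins ?d ?d\<close> stops the induction at \<open>?d\<close>,
    the length of the sequences.\<close>
  have "?d \<in> E (ins ?d ?d) \<longrightarrow> (\<exists>T\<in>U. ?V T \<and> ?G ?d T)"
  proof (rule natural_induct[where P = "\<lambda>k. k \<in> E (ins ?d ?d) \<longrightarrow> (\<exists>T\<in>U. ?V T \<and> ?G k T)", OF _ _ _ n(2)])
    show "dfn (\<lambda>s. s 0 \<in> E (ins ?d ?d) \<longrightarrow> (\<exists>T\<in>U. ?V T \<and> ?G (s 0) T))"
      using assms n by (intro dfns V ins_in)
    show "emp \<in> E (ins ?d ?d) \<longrightarrow> (\<exists>T\<in>U. ?V T \<and> ?G emp T)"
      using P(2) by (auto simp: agree_below_def)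
  next
    fix k assume k: "natural k" and IH: "k \<in> E (ins ?d ?d) \<longrightarrow> (\<exists>T\<in>U. ?V T \<and> ?G k T)"
    show "ins k k \<in> E (ins ?d ?d) \<longrightarrow> (\<exists>T\<in>U. ?V T \<and> ?G (ins k k) T)"
    proof
      assume "ins k k \<in> E (ins ?d ?d)"
      then have "k \<in> E ?d"
        using E_ins[OF n(4,4)] E_ins[OF natural_in natural_in, OF k k] ord_trans[OF n(3), of "ins k k" k]
        by (metis insertE insertI1)
      then obtain T where T: "T \<in> U" "?V T" "?G k T"
        using IH n by auto
      have kU: "k \<in> U" "ord k" "ord (ins k k)"
        using k natural_in natural_ord natural_succ by blast+
      have fb: "dfn (\<lambda>s. \<exists>T'\<in>U. ?V T' \<and> agree_below T T' k \<and> instr_at p \<alpha> v k T' (s 0))"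
        using T(1) assms n kU by (intro dfns V)
      have "agree_below T T k"
        by (simp add: agree_below_def)
      moreover obtain b where "b \<in> U" "instr_at p \<alpha> v k T b"
        using T(2) \<open>k \<in> E ?d\<close> unfolding valid_def by blast
      ultimately obtain b0 where b0: "b0 \<in> U" "\<exists>T'\<in>U. ?V T' \<and> agree_below T T' k \<and> instr_at p \<alpha> v k T' b0"
        and min: "\<And>b. b \<in> U \<Longrightarrow> instr_class b \<Longrightarrow> \<exists>T'\<in>U. ?V T' \<and> agree_below T T' k \<and> instr_at p \<alpha> v k T' b
          \<Longrightarrow> b \<noteq> b0 \<Longrightarrow> instr_less b0 b"
        using dwo_least[OF dwo_instr fb, of b] T unfolding instr_at_def[of _ _ _ _ _ b] by metis
      then obtain T0 where T0: "T0 \<in> U" "?V T0" "agree_below T T0 k" "instr_at p \<alpha> v k T0 b0"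
        by blast
      have "agree_below T0 T' (ins k k) \<or> seq_less p \<alpha> v (ins k k) T0 T'" if T': "T' \<in> U" "?V T'" for T'
      proof (cases "agree_below T T' k")
        case True
        then have a: "agree_below T0 T' k"
          using T0 agree_below_sym agree_below_trans by blast
        show ?thesis
        proof (cases "instr_at p \<alpha> v k T' b0")
          case True
          then have "agree_below T0 T' (ins k k)"
            using agree_below_succ[OF _ _ n(1,3) \<open>k \<in> E ?d\<close> a T0(4)] T0 T' by blast
          then show ?thesis ..
        next
          case False
          have "instr_less b0 b'" if "b' \<in> U" "instr_at p \<alpha> v k T' b'" for b'
            using min[of b'] that False T' True unfolding instr_at_def by blast
          then have "seq_less p \<alpha> v (ins k k) T0 T'"
            unfolding seq_less_def using a T0(4) b0(1) kU by (intro bexI[of _ k]) auto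
          then show ?thesis ..
        qed
      next
        case False
        \<comment> \<open>\<open>T\<close> is already smaller than \<open>T'\<close> at some
          \<open>j\<close> before \<open>k\<close>, and \<open>T0\<close> inherits this because it
          agrees with \<open>T\<close> below \<open>k\<close>.\<close>
        then have "seq_less p \<alpha> v k T T'"
          using T(3) T' by blast
        then obtain j b where j: "j \<in> E k" "agree_below T T' j" "b \<in> U" "instr_at p \<alpha> v j T b"
          "\<forall>b'\<in>U. instr_at p \<alpha> v j T' b' \<longrightarrow> instr_less b b'"
          unfolding seq_less_def by blast
        have "agree_below T T0 j"
          using T0(3) j(1) ord_trans kU by (auto intro: agree_below_mono)
        then have "agree_below T0 T' j"
          using j(2) agree_below_sym agree_below_trans by blast
        moreover have "instr_at p \<alpha> v j T0 b"
          using instr_at_agree[OF j(4) T0(3) kU(2) j(1)] .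
        ultimately have "seq_less p \<alpha> v (ins k k) T0 T'"
          unfolding seq_less_def using j kU by (intro bexI[of _ j]) auto
        then show ?thesis ..
      qed
      then show "\<exists>T\<in>U. ?V T \<and> ?G (ins k k) T"
        using T0 by blast
    qed
  qed
  then obtain T where T: "T \<in> U" "?V T" "?G ?d T"
    using n by auto
  show "\<exists>T\<in>U. valid p \<alpha> v n T \<and> P T \<and>
      (\<forall>T'\<in>U. valid p \<alpha> v n T' \<and> P T' \<and> T' \<noteq> T \<longrightarrow> seq_less p \<alpha> v ?d T T')"
  proof (rule bexI[OF _ T(1)], intro conjI ballI impI)
    fix T' assume T': "T' \<in> U" "valid p \<alpha> v n T' \<and> P T' \<and> T' \<noteq> T"
    then have "\<not> agree_below T T' ?d"
      using is_fun_on_eqI[of T ?d T'] T unfolding valid_def by blast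
    then show "seq_less p \<alpha> v ?d T T'"
      using T T' by blast
  qed (use T in auto)
qed

end

section \<open>Codes for sets that are ordinal definable from p\<close>

context zf
begin

text \<open>The level \<open>v\<close> is quantified away so that the class depends on \<alpha> and
  \<open>n\<close> alone; \<open>is_V_unique\<close> recovers it.\<close>

definition seq_class :: "'a \<Rightarrow> 'a \<Rightarrow> 'a \<Rightarrow> 'a \<Rightarrow> bool" where
  "seq_class p \<alpha> n T \<longleftrightarrow> (\<exists>v\<in>U. is_V M \<alpha> v \<and> valid p \<alpha> v n T)"

definition seq_class_less :: "'a \<Rightarrow> 'a \<Rightarrow> 'a \<Rightarrow> 'a \<Rightarrow> 'a \<Rightarrow> bool" where
  "seq_class_less p \<alpha> n T T' \<longleftrightarrow> (\<exists>v\<in>U. is_V M \<alpha> v \<and> seq_less p \<alpha> v (ins n n) T T')"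

definition code_class :: "'a \<Rightarrow> 'a \<Rightarrow> bool" where
  "code_class p = lex_class ord (\<lambda>\<alpha>. lex_class natural (seq_class p \<alpha>))"

definition code_less :: "'a \<Rightarrow> 'a \<Rightarrow> 'a \<Rightarrow> bool" where
  "code_less p = lex_less (\<lambda>x y. x \<in> E y) (\<lambda>\<alpha>. lex_less (\<lambda>x y. x \<in> E y) (seq_class_less p \<alpha>))"

lemma dfn_seq_class[dfns]:
  assumes "tmd f" "tmd g" "tmd h" "tmd i"
  shows "dfn (\<lambda>s. seq_class (f s) (g s) (h s) (i s))"
  unfolding seq_class_def by (intro dfns assms[THEN tmd_rename])

lemma dfn_seq_class_less[dfns]:
  assumes "tmd f" "tmd g" "tmd h" "tmd i" "tmd j"
  shows "dfn (\<lambda>s. seq_class_less (f s) (g s) (h s) (i s) (j s))"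
  unfolding seq_class_less_def by (intro dfns assms[THEN tmd_rename])

lemma dfn_lex_seq_class:
  assumes "tmd f" "tmd g" "p \<in> U"
  shows "dfn (\<lambda>s. lex_class natural (seq_class p (f s)) (g s))"
  unfolding lex_class_def by (intro dfns assms(1,2)[THEN tmd_rename] assms(3))

lemma dfn_lex_seq_less:
  assumes "tmd f" "tmd g" "tmd h" "p \<in> U"
  shows "dfn (\<lambda>s. lex_less (\<lambda>x y. x \<in> E y) (seq_class_less p (f s)) (g s) (h s))"
  unfolding lex_less_def by (intro dfns assms)

lemma dfn_code_class:
  assumes "tmd f" "p \<in> U"
  shows "dfn (\<lambda>s. code_class p (f s))"
  unfolding code_class_def by (intro dfn_lex_class dfn_lex_seq_class dfns assms)

lemma dfn_code_less:
  assumes "tmd f" "tmd g" "p \<in> U"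
  shows "dfn (\<lambda>s. code_less p (f s) (g s))"
  unfolding code_less_def by (intro dfn_lex_less dfn_lex_seq_less dfns assms)

lemma dwo_seq_class:
  assumes "ord \<alpha>" "p \<in> U" "natural n"
  shows "dwo (seq_class p \<alpha> n) (seq_class_less p \<alpha> n)"
proof (cases "\<exists>v\<in>U. is_V M \<alpha> v")
  case True
  then obtain v where v: "v \<in> U" "is_V M \<alpha> v" by blast
  have "w = v" if "w \<in> U" "is_V M \<alpha> w" for w
    using that v is_V_unique assms(1) ord_in by blast
  then have "seq_class p \<alpha> n = valid p \<alpha> v n" "seq_class_less p \<alpha> n = seq_less p \<alpha> v (ins n n)"
    unfolding seq_class_def seq_class_less_def fun_eq_iff using v by blast+
  then show ?thesis
    using dwo_valid[OF assms(1) v(1) assms(2,3)] by simp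
next
  case False
  then show ?thesis
    unfolding dwo_def seq_class_def by blast
qed

lemma dwo_code_class: "p \<in> U \<Longrightarrow> dwo (code_class p) (code_less p)"
  unfolding code_class_def code_less_def
  by (intro dwo_pair dwo_ord[of ord] dwo_ord[of natural, OF natural_ord] dwo_seq_class dfn_lex_seq_class dfns)

text \<open>A code \<open>c\<close> has the form \<open>pr \<alpha> (pr n T)\<close>, and \<open>T(n)\<close> is the truth set that defines \<open>x\<close>.\<close>

definition codes :: "'a \<Rightarrow> 'a \<Rightarrow> bool" where
  "codes x c \<longleftrightarrow> (\<exists>v\<in>U. \<exists>X\<in>U. is_V M (pfst c) v \<and> x \<in> E v \<and> maps_to M (psnd (psnd c)) (pfst (psnd c)) X \<and>
     (\<forall>a\<in>U. is_assignment M v a \<longrightarrow> (a \<in> E X \<longleftrightarrow> maps_to M a emp x)))"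

lemma dfn_codes[dfns]:
  assumes "tmd f" "tmd g"
  shows "dfn (\<lambda>s. codes (f s) (g s))"
  unfolding codes_def by (intro dfns assms[THEN tmd_rename] emp_in)

lemma natural_elem:
  assumes "natural n" "k \<in> E n"
  shows "natural k"
proof -
  have "ord k" "\<forall>m\<in>insert k (E k). m \<in> E n"
    using assms natural_ord ord_elem ord_trans by blast+
  then show ?thesis
    using assms(1) unfolding natural_def is_nat_def ord_def by blast
qed

text \<open>Truth sets contain assignments, so recovering a set from the truth set that defines it
  needs at least one assignment giving variable 0 that value.\<close>

lemma constant_assignment:
  assumes "x \<in> E v"
  shows "\<exists>a\<in>U. is_assignment M v a \<and> (\<forall>y\<in>U. maps_to M a emp y \<longleftrightarrow> y = x)"
proof -
  have x: "x \<in> U" using assms Ext_U by blast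
  let ?w = "st {n \<in> U. is_nat M n}"
  have w: "?w \<in> U" "E ?w = {n \<in> U. is_nat M n}"
    by (simp_all add: isset_omega st_in E_st)
  have "isset {y \<in> U. \<exists>n\<in>E ?w. y = pr n x}"
    using x by (intro isset_repl w(1) dfns) simp_all
  then obtain a where a: "a \<in> U" "E a = {y \<in> U. \<exists>n\<in>E ?w. y = pr n x}"
    unfolding isset_def by blast
  have m: "maps_to M a n y \<longleftrightarrow> n \<in> E ?w \<and> y = x" if "n \<in> U" "y \<in> U" for n y
    using that x by (auto simp: maps_to_iff a Ext_U)
  have "is_fun_on M a ?w"
    unfolding is_fun_on_def
  proof (intro conjI ballI)
    show "\<exists>n\<in>E ?w. \<exists>y\<in>U. is_pair M z n y" if "z \<in> E a" for z
      using that x a by (auto simp: is_pair_iff Ext_U)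
    show "\<exists>!y. y \<in> U \<and> maps_to M a n y" if "n \<in> E ?w" for n
      using that x m Ext_U by blast
  qed
  then have "is_assignment M v a"
    unfolding is_assignment_def using w m assms by blast
  moreover have "emp \<in> E ?w"
    using natural_emp w(2) by (simp add: natural_def)
  ultimately show ?thesis
    using a(1) m emp_in by blast
qed

lemma code_classE:
  assumes "code_class p c"
  obtains \<alpha> n T v where "\<alpha> \<in> U" "n \<in> U" "T \<in> U" "v \<in> U" "c = pr \<alpha> (pr n T)"
    "ord \<alpha>" "natural n" "is_V M \<alpha> v" "valid p \<alpha> v n T"
  using assms unfolding code_class_def seq_class_def by (auto elim!: lex_classE)

text \<open>A code fixes \<alpha>, hence the level, and the truth set \<open>X\<close> at position
  \<open>n\<close>. A constant assignment with value \<open>x\<close> lies in \<open>X\<close>, so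
  it also gives variable 0 the value \<open>y\<close>.\<close>

lemma code_unique:
  assumes "code_class p c" "codes x c" "codes y c"
  shows "x = y"
  using assms(1)
proof (rule code_classE)
  fix \<alpha> n T v assume c: "\<alpha> \<in> U" "n \<in> U" "T \<in> U" "v \<in> U" "c = pr \<alpha> (pr n T)"
    "is_V M \<alpha> v" "valid p \<alpha> v n T"
  have "\<exists>X\<in>U. x \<in> E v \<and> maps_to M T n X \<and>
      (\<forall>a\<in>U. is_assignment M v a \<longrightarrow> (a \<in> E X \<longleftrightarrow> maps_to M a emp x))" if x: "codes x c" for x
  proof -
    have "pfst c = \<alpha>" "pfst (psnd c) = n" "psnd (psnd c) = T"
      using c by simp_all
    with x obtain w X where w: "w \<in> U" "X \<in> U" "is_V M \<alpha> w" "x \<in> E w" "maps_to M T n X"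
      "\<forall>a\<in>U. is_assignment M w a \<longrightarrow> (a \<in> E X \<longleftrightarrow> maps_to M a emp x)"
      unfolding codes_def by blast
    have "w = v"
      using is_V_unique[OF w(3) c(6,1) w(1) c(4)] .
    with w show ?thesis
      by blast
  qed
  from this[OF assms(2)] this[OF assms(3)] obtain X Y where X: "X \<in> U" "x \<in> E v" "maps_to M T n X"
      "\<forall>a\<in>U. is_assignment M v a \<longrightarrow> (a \<in> E X \<longleftrightarrow> maps_to M a emp x)"
    and Y: "Y \<in> U" "y \<in> E v" "maps_to M T n Y"
      "\<forall>a\<in>U. is_assignment M v a \<longrightarrow> (a \<in> E Y \<longleftrightarrow> maps_to M a emp y)"
    by blast
  have "is_fun_on M T (ins n n)" "n \<in> E (ins n n)"
    using c by (simp_all add: valid_def)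
  then have "X = Y"
    using is_fun_on_unique X Y by blast
  then show "x = y"
  proof -
    obtain a where a: "a \<in> U" "is_assignment M v a" "\<And>z. z \<in> U \<Longrightarrow> maps_to M a emp z \<longleftrightarrow> z = x"
      using constant_assignment[OF X(2)] by blast
    have "a \<in> E X"
      using X(2,4) a Ext_U by blast
    then have "maps_to M a emp y"
      using Y(4) a \<open>X = Y\<close> by blast
    then show ?thesis
      using a(3)[of y] Y(2) Ext_U by blast
  qed
qed

text \<open>The truth sets along a formation sequence become the code; the formulas in
  \<open>S\<close> serve only to find an instruction at each position.\<close>

lemma code_exists:
  assumes "p \<in> U" "\<alpha> \<in> U" "v \<in> U" "is_ord M \<alpha>" "is_V M \<alpha> v" "is_definable_in M \<alpha> v p x"
  shows "\<exists>c\<in>U. code_class p c \<and> codes x c"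
proof -
  obtain F X where x: "x \<in> E v" and X: "X \<in> U" "is_truth_set M \<alpha> v p F X"
    "\<forall>a\<in>U. is_assignment M v a \<longrightarrow> (a \<in> E X \<longleftrightarrow> (\<exists>z\<in>U. is_numeral M 0 z \<and> maps_to M a z x))"
    using assms(6) unfolding is_definable_in_def by blast
  obtain n d S T where n: "n \<in> U" "d \<in> U" "S \<in> U" "T \<in> U" "is_nat M n" "E d = insert n (E n)"
    "is_fun_on M S d" "is_fun_on M T d"
    "\<And>k G Y. k \<in> E d \<Longrightarrow> G \<in> U \<Longrightarrow> Y \<in> U \<Longrightarrow> maps_to M S k G \<Longrightarrow> maps_to M T k Y
       \<Longrightarrow> sat_step M \<alpha> v p k S T G Y"
    "maps_to M T n X"
    using X(2) unfolding is_truth_set_def by blast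
  have d: "d = ins n n"
    using n eq_ins_iff by blast
  have \<alpha>: "ord \<alpha>" and n': "natural n"
    using assms n by (simp_all add: ord_def natural_def)
  have "\<exists>b\<in>U. instr_at p \<alpha> v k T b" if k: "k \<in> E d" for k
  proof -
    obtain G Y where "G \<in> U" "maps_to M S k G" "Y \<in> U" "maps_to M T k Y"
      using is_fun_on_ex[OF n(7) k] is_fun_on_ex[OF n(8) k] by blast
    moreover have "natural k"
      using k natural_elem[OF natural_succ[OF n']] d by blast
    ultimately show ?thesis
      using sat_step_instr[OF n(9)[OF k] \<alpha>] unfolding instr_at_def by blast
  qed
  then have "valid p \<alpha> v n T"
    using n(8) unfolding valid_def d by blast
  then have "code_class p (pr \<alpha> (pr n T))"
    using \<alpha> n' n assms unfolding code_class_def seq_class_def by auto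
  moreover have "a \<in> E X \<longleftrightarrow> maps_to M a emp x" if "a \<in> U" "is_assignment M v a" for a
    using X(3) that is_numeral_iff[of _ 0] num_0 emp_in by metis
  then have "codes x (pr \<alpha> (pr n T))"
    unfolding codes_def using x X(1) n assms by auto
  ultimately show ?thesis
    using n assms by auto
qed

theorem definable_wellorder:
  assumes "satisfies_ex_V_eq_HOD M"
  shows "\<exists>L. dfn (\<lambda>s. L (s 0) (s 1)) \<and> dwo (\<lambda>_. True) L \<and> (\<forall>y\<in>U. isset {x \<in> U. L x y})"
proof -
  obtain p where p: "p \<in> U"
    and "\<forall>x\<in>U. \<exists>\<alpha>\<in>U. \<exists>v\<in>U. is_ord M \<alpha> \<and> is_V M \<alpha> v \<and> p \<in> E v \<and> is_definable_in M \<alpha> v p x"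
    using assms unfolding satisfies_ex_V_eq_HOD_def by blast
  then have ex: "\<exists>c\<in>U. code_class p c \<and> codes x c" if "x \<in> U" for x
    using code_exists that by blast
  \<comment> \<open>The least code of \<open>x\<close> precedes the least code of \<open>y\<close>,
    stated without minima; distinct sets share no code by \<open>code_unique\<close>, so ties
    between them cannot occur.\<close>
  define L where "L x y \<longleftrightarrow> (\<exists>c\<in>U. code_class p c \<and> codes x c \<and> (\<forall>d\<in>U. code_class p d \<and> codes y d \<longrightarrow> code_less p c d))" for x y
  have dL: "dfn (\<lambda>s. L (s 0) (s 1))"
    unfolding L_def by (intro dfns dfn_code_class dfn_code_less p)
  moreover have "dwo (\<lambda>_. True) L"
    unfolding dwo_def
  proof (intro conjI ballI impI allI)
    show "\<not> L y x" if "x \<in> U" "y \<in> U" "True \<and> True \<and> L x y" for x y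
      using that dwo_asym[OF dwo_code_class[OF p]] unfolding L_def by blast
    fix P assume P: "dfn (\<lambda>s. P (s 0))" "\<exists>x\<in>U. True \<and> P x"
    have 1: "dfn (\<lambda>s. \<exists>x\<in>U. P x \<and> codes x (s 0))"
      by (intro dfns dfn_sub1[OF P(1)])
    obtain x c where "x \<in> U" "P x" "c \<in> U" "code_class p c" "codes x c"
      using P(2) ex by blast
    then obtain c0 where c0: "c0 \<in> U" "code_class p c0" "\<exists>x\<in>U. P x \<and> codes x c0"
      "\<And>c. c \<in> U \<Longrightarrow> code_class p c \<Longrightarrow> \<exists>x\<in>U. P x \<and> codes x c \<Longrightarrow> c \<noteq> c0 \<Longrightarrow> code_less p c0 c"
      using dwo_least[where P = "\<lambda>c. \<exists>x\<in>U. P x \<and> codes x c", OF dwo_code_class[OF p] 1, of c] by blast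
    then obtain x0 where x0: "x0 \<in> U" "P x0" "codes x0 c0" by blast
    have "L x0 y" if "y \<in> U" "P y" "y \<noteq> x0" for y
      unfolding L_def
    proof (rule bexI[OF _ c0(1)], intro conjI ballI impI)
      fix d assume d: "d \<in> U" "code_class p d \<and> codes y d"
      then have "d \<noteq> c0"
        using code_unique[OF c0(2) x0(3)] that by blast
      then show "code_less p c0 d"
        using c0(4) d that by blast
    qed (use c0 x0 in auto)
    then show "\<exists>x\<in>U. True \<and> P x \<and> (\<forall>y\<in>U. True \<and> P y \<and> y \<noteq> x \<longrightarrow> L x y)"
      using x0 by blast
  qed
  moreover have "isset {x \<in> U. L x y}" if y: "y \<in> U" for y
  proof -
    obtain d where d: "d \<in> U" "code_class p d" "codes y d"
      using ex[OF y] by blast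
    obtain \<delta> where \<delta>: "\<delta> \<in> U" "\<delta> = pfst d"
      by simp
    \<comment> \<open>Codes are ordered first by their ordinal, so every predecessor of
      \<open>y\<close> lies in a level with index at most \<delta>; replacement and union turn these
      levels into one set.\<close>
    let ?S = "ins \<delta> \<delta>"
    have S: "?S \<in> U" using \<delta> by simp
    have "isset {v \<in> U. \<exists>\<alpha>\<in>E ?S. is_V M \<alpha> v}"
      using is_V_unique Ext_U by (intro isset_repl[OF S] dfns) blast
    then obtain I where I: "I \<in> U" "E I = {v \<in> U. \<exists>\<alpha>\<in>E ?S. is_V M \<alpha> v}"
      unfolding isset_def by blast
    have u: "isset (\<Union>v\<in>E I. E v)"
      using I(1) by (rule isset_Union)
    have "{x \<in> U. L x y} \<subseteq> (\<Union>v\<in>E I. E v)"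
    proof
      fix x assume "x \<in> {x \<in> U. L x y}"
      then obtain c where c: "c \<in> U" "code_class p c" "codes x c" "code_less p c d"
        using d unfolding L_def by blast
      then have "pfst c \<in> E ?S"
        using \<delta> unfolding code_less_def lex_less_def by auto
      then show "x \<in> (\<Union>v\<in>E I. E v)"
        using c(3) I(2) unfolding codes_def by blast
    qed
    then show ?thesis
      using dfn_sub2[OF dL tmd_var tmd_const[OF y]] st_in[OF u] E_st[OF u]
      by (intro isset_subset[of "st (\<Union>v\<in>E I. E v)"]) (auto intro!: dfns)
  qed
  ultimately show ?thesis
    by blast
qed

end

section \<open>A definable ultrafilter\<close>

locale zf_wo = zf +
  fixes L :: "'a \<Rightarrow> 'a \<Rightarrow> bool"
  assumes dfn_L_var: "dfn (\<lambda>s. L (s 0) (s 1))"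
    and wo: "dwo (\<lambda>_. True) L"
    and set_like: "y \<in> U \<Longrightarrow> isset {x \<in> U. L x y}"
begin

lemma dfn_L[dfns]: "tmd f \<Longrightarrow> tmd g \<Longrightarrow> dfn (\<lambda>s. L (f s) (g s))"
  by (rule dfn_sub2[OF dfn_L_var])

lemma L_asym: "x \<in> U \<Longrightarrow> y \<in> U \<Longrightarrow> L x y \<Longrightarrow> \<not> L y x"
  using dwo_asym[OF wo] by blast

lemma L_least:
  assumes "dfn (\<lambda>s. P (s 0))" "x \<in> U" "P x"
  obtains m where "m \<in> U" "P m" "\<And>y. y \<in> U \<Longrightarrow> P y \<Longrightarrow> y \<noteq> m \<Longrightarrow> L m y"
  by (rule dwo_least[where P = P, OF wo assms(1,2) TrueI assms(3)]) (rule that, simp_all)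

lemma L_trans:
  assumes "x \<in> U" "y \<in> U" "z \<in> U" "L x y" "L y z"
  shows "L x z"
proof -
  have "dfn (\<lambda>s. s 0 = x \<or> s 0 = y \<or> s 0 = z)"
    using assms by (intro dfns)
  then obtain m where m: "m = x \<or> m = y \<or> m = z"
    "\<And>u. u \<in> U \<Longrightarrow> u = x \<or> u = y \<or> u = z \<Longrightarrow> u \<noteq> m \<Longrightarrow> L m u"
    using L_least[of "\<lambda>u. u = x \<or> u = y \<or> u = z" x] assms(1) by blast
  have "m = x"
    using m assms L_asym by metis
  moreover have "x \<noteq> z"
    using assms L_asym by blast
  ultimately show ?thesis
    using m(2)[of z] assms by blast
qed

lemma L_linear:
  assumes "x \<in> U" "y \<in> U" "x \<noteq> y"
  shows "L x y \<or> L y x"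
proof -
  have "dfn (\<lambda>s. s 0 = x \<or> s 0 = y)"
    using assms by (intro dfns)
  then show ?thesis
    using L_least[of "\<lambda>u. u = x \<or> u = y" x] assms by metis
qed

lemma L_induct:
  assumes "dfn (\<lambda>s. P (s 0))" "\<And>y. y \<in> U \<Longrightarrow> (\<And>x. x \<in> U \<Longrightarrow> L x y \<Longrightarrow> P x) \<Longrightarrow> P y" "y \<in> U"
  shows "P y"
proof (rule ccontr)
  assume "\<not> P y"
  then obtain m where m: "m \<in> U" "\<not> P m" "\<And>y. y \<in> U \<Longrightarrow> \<not> P y \<Longrightarrow> y \<noteq> m \<Longrightarrow> L m y"
    using L_least[of "\<lambda>y. \<not> P y", OF dfn_not[OF assms(1)] assms(3)] by blast
  have "P x" if "x \<in> U" "L x m" for x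
    using m that L_asym by blast
  then show False
    using assms(2) m by blast
qed

section \<open>Definable recursion along the well-order\<close>

definition seg :: "'a \<Rightarrow> 'a" where
  "seg y = st {x \<in> U. L x y}"

lemma seg_in[simp]: "y \<in> U \<Longrightarrow> seg y \<in> U" and E_seg: "y \<in> U \<Longrightarrow> E (seg y) = {x \<in> U. L x y}"
  by (simp_all add: seg_def set_like st_in E_st)

lemma tmd_seg[dfns]:
  assumes "tmd f"
  shows "tmd (\<lambda>s. seg (f s))"
  unfolding seg_def
  by (rule tmd_st) (auto simp: set_like tmd_in assms simp del: mem_Collect_eq
      intro!: dfns assms[THEN tmd_rename])

text \<open>\<open>M\<close> cannot quantify over classes, so the earlier decisions enter as a set
  \<open>g\<close>, and \<open>cong\<close> says that \<open>H\<close> sees \<open>g\<close> only on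
  the initial segment. As in set-theoretic recursion, \<open>D\<close> is assembled from
  approximations, which can be sets because initial segments are.\<close>

lemma predicate_recursion:
  assumes H: "dfn (\<lambda>s. H (s 0) (s 1))"
    and cong: "\<And>y g g'. y \<in> U \<Longrightarrow> g \<in> U \<Longrightarrow> g' \<in> U \<Longrightarrow>
      (\<And>t. t \<in> E (seg y) \<Longrightarrow> t \<in> E g \<longleftrightarrow> t \<in> E g') \<Longrightarrow> H y g \<longleftrightarrow> H y g'"
  shows "\<exists>D. dfn (\<lambda>s. D (s 0)) \<and> (\<forall>y\<in>U. \<forall>g\<in>U. (\<forall>t\<in>E (seg y). t \<in> E g \<longleftrightarrow> D t) \<longrightarrow> (D y \<longleftrightarrow> H y g))"
proof -
  have dH[dfns]: "dfn (\<lambda>s. H (f s) (g s))" if "tmd f" "tmd g" for f g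
    using that by (rule dfn_sub2[OF H])
  \<comment> \<open>An approximation: \<open>g\<close> obeys the recursion on the segment below
    \<open>y\<close> and is arbitrary elsewhere.\<close>
  define good where "good y g \<longleftrightarrow> (\<forall>t\<in>E (seg y). t \<in> E g \<longleftrightarrow> H t g)" for y g
  have dg[dfns]: "dfn (\<lambda>s. good (f s) (g s))" if "tmd f" "tmd g" for f g
    unfolding good_def by (intro dfns dH that[THEN tmd_rename])
  define D where "D y \<longleftrightarrow> (\<exists>g\<in>U. good y g \<and> H y g)" for y
  have dD: "dfn (\<lambda>s. D (f s))" if "tmd f" for f
    unfolding D_def by (intro dfns dg dH that[THEN tmd_rename])
  have agree: "t \<in> E g \<longleftrightarrow> t \<in> E g'"
    if "y \<in> U" "g \<in> U" "y' \<in> U" "g' \<in> U" "good y g" "good y' g'" "t \<in> E (seg y)" "t \<in> E (seg y')"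
    for y g y' g' t
  proof -
    have "t \<in> E (seg y) \<and> t \<in> E (seg y') \<longrightarrow> (t \<in> E g \<longleftrightarrow> t \<in> E g')"
    proof (rule L_induct[where P = "\<lambda>t. t \<in> E (seg y) \<and> t \<in> E (seg y') \<longrightarrow> (t \<in> E g \<longleftrightarrow> t \<in> E g')"])
      show "dfn (\<lambda>s. s 0 \<in> E (seg y) \<and> s 0 \<in> E (seg y') \<longrightarrow> (s 0 \<in> E g \<longleftrightarrow> s 0 \<in> E g'))"
        using that by (intro dfns)
      show "t \<in> U"
        using that Ext_U by blast
    next
      fix t assume t: "t \<in> U"
        and IH: "\<And>x. x \<in> U \<Longrightarrow> L x t \<Longrightarrow> x \<in> E (seg y) \<and> x \<in> E (seg y') \<longrightarrow> (x \<in> E g \<longleftrightarrow> x \<in> E g')"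
      show "t \<in> E (seg y) \<and> t \<in> E (seg y') \<longrightarrow> (t \<in> E g \<longleftrightarrow> t \<in> E g')"
      proof
        assume t': "t \<in> E (seg y) \<and> t \<in> E (seg y')"
        have "x \<in> E g \<longleftrightarrow> x \<in> E g'" if "x \<in> E (seg t)" for x
          using IH[of x] that t' t L_trans[of x t] \<open>y \<in> U\<close> \<open>y' \<in> U\<close> by (auto simp: E_seg)
        then have "H t g \<longleftrightarrow> H t g'"
          using cong t \<open>g \<in> U\<close> \<open>g' \<in> U\<close> by blast
        then show "t \<in> E g \<longleftrightarrow> t \<in> E g'"
          using t' \<open>good y g\<close> \<open>good y' g'\<close> unfolding good_def by blast
      qed
    qed
    then show ?thesis
      using that by blast
  qed
  have D_iff: "D t \<longleftrightarrow> H t g" if "t \<in> U" "g \<in> U" "good t g" for t g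
    using that cong[of t g] agree[of t g t] unfolding D_def by blast
  \<comment> \<open>The approximation \<open>h\<close> at \<open>t\<close> is a premise because
    \<open>ex\<close>, which will provide it, relies on this fact in its own induction.\<close>
  have D_mem: "t \<in> E g \<longleftrightarrow> D t"
    if "y \<in> U" "g \<in> U" "good y g" "t \<in> E (seg y)" "h \<in> U" "good t h" for y g t h
  proof -
    have t: "t \<in> U" "L t y"
      using that by (auto simp: E_seg)
    have "x \<in> E g \<longleftrightarrow> x \<in> E h" if "x \<in> E (seg t)" for x
    proof (rule agree[of y g t h])
      show "x \<in> E (seg y)"
        using that t \<open>y \<in> U\<close> L_trans[of x t y] by (auto simp: E_seg)
    qed (use \<open>y \<in> U\<close> \<open>g \<in> U\<close> \<open>h \<in> U\<close> t \<open>good y g\<close> \<open>good t h\<close> that in auto)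
    then have "H t g \<longleftrightarrow> H t h"
      using cong t that by blast
    then show ?thesis
      using D_iff[of t h] that t unfolding good_def by blast
  qed
  have ex: "\<exists>g\<in>U. good y g" if "y \<in> U" for y
  proof (rule L_induct[where P = "\<lambda>y. \<exists>g\<in>U. good y g", OF _ _ that])
    show "dfn (\<lambda>s. \<exists>g\<in>U. good (s 0) g)"
      by (intro dfns dg)
    fix y assume y: "y \<in> U" and IH: "\<And>x. x \<in> U \<Longrightarrow> L x y \<Longrightarrow> \<exists>g\<in>U. good x g"
    \<comment> \<open>The trace of \<open>D\<close> below \<open>y\<close> is a set by separation;
      it serves as the approximation at \<open>y\<close>.\<close>
    have "isset {t \<in> E (seg y). D t}"
      using y by (intro isset_sep dD dfns seg_in)
    then obtain g where g: "g \<in> U" "E g = {t \<in> E (seg y). D t}"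
      unfolding isset_def by blast
    have "t \<in> E g \<longleftrightarrow> H t g" if "t \<in> E (seg y)" for t
    proof -
      have t: "t \<in> U" "L t y"
        using that y by (auto simp: E_seg)
      then obtain h where h: "h \<in> U" "good t h"
        using IH by blast
      have "x \<in> E g \<longleftrightarrow> x \<in> E h" if "x \<in> E (seg t)" for x
      proof -
        have x: "x \<in> U" "L x t" "L x y"
          using that t y L_trans[of x t y] by (auto simp: E_seg)
        then obtain k where "k \<in> U" "good x k"
          using IH by blast
        then have "x \<in> E h \<longleftrightarrow> D x"
          using D_mem[OF t(1) h that] by blast
        then show ?thesis
          using g x y by (auto simp: E_seg)
      qed
      then have "H t g \<longleftrightarrow> H t h"
        using cong t g h by blast
      then show ?thesis
        using D_iff[OF t(1) h] g that by blast
    qed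
    then show "\<exists>g\<in>U. good y g"
      using g(1) unfolding good_def by blast
  qed
  have "D y \<longleftrightarrow> H y g" if y: "y \<in> U" and g: "g \<in> U" "\<forall>t\<in>E (seg y). t \<in> E g \<longleftrightarrow> D t" for y g
  proof -
    obtain h where h: "h \<in> U" "good y h"
      using ex[OF y] by blast
    have "t \<in> E g \<longleftrightarrow> t \<in> E h" if "t \<in> E (seg y)" for t
      using D_mem[OF y h that] ex[of t] g(2) that Ext_U by blast
    then have "H y g \<longleftrightarrow> H y h"
      using cong y g h by blast
    then show ?thesis
      using D_iff[OF y h] by blast
  qed
  then show ?thesis
    using dD[OF tmd_var] by blast
qed

text \<open>Lets \<open>fbase_decide\<close> treat a finite set of parameters by induction on its
  greatest element.\<close>

lemma fin_max:
  assumes "fin s" "s \<in> U" "E s \<noteq> {}"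
  shows "\<exists>m\<in>E s. E s \<subseteq> insert m (E (seg m))"
proof -
  have "E s = {} \<or> (\<exists>m\<in>E s. \<forall>t\<in>E s. t = m \<or> L t m)"
  proof (rule fin_induct[where P = "\<lambda>s. E s = {} \<or> (\<exists>m\<in>E s. \<forall>t\<in>E s. t = m \<or> L t m)", OF assms(1,2)])
    show "dfn (\<lambda>s. E (s 0) = {} \<or> (\<exists>m\<in>E (s 0). \<forall>t\<in>E (s 0). t = m \<or> L t m))"
      by (intro dfns) simp
    fix t m assume t: "t \<in> U" "m \<in> E s" "E t = {} \<or> (\<exists>m\<in>E t. \<forall>u\<in>E t. u = m \<or> L u m)"
    have m: "m \<in> U" using t Ext_U by blast
    have "\<exists>n\<in>insert m (E t). \<forall>u\<in>insert m (E t). u = n \<or> L u n"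
    proof (cases "E t = {}")
      case False
      then obtain n where n: "n \<in> E t" "\<forall>u\<in>E t. u = n \<or> L u n"
        using t(3) by blast
      show ?thesis
      proof (cases "m = n \<or> L m n")
        case True
        then show ?thesis using n by blast
      next
        case False
        then have "L n m"
          using L_linear[of m n] m n Ext_U by blast
        have "L u m" if "u \<in> E t" for u
          using n that \<open>L n m\<close> L_trans[OF Ext_U[OF that] Ext_U[OF n(1)] m] by (cases "u = n") auto
        then show ?thesis by blast
      qed
    qed simp
    then show "E (ins m t) = {} \<or> (\<exists>n\<in>E (ins m t). \<forall>u\<in>E (ins m t). u = n \<or> L u n)"
      using t m by simp
  qed simp
  then show ?thesis
    using assms(3) E_seg Ext_U by blast
qed

text \<open>A proper filter with base sets \<open>{x. R x z}\<close> indexed by elements of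
  \<open>U\<close>. A single formula in \<open>x\<close> and \<open>z\<close> is what allows
  \<open>M\<close> to quantify over the base, and thus makes the next stage definable.\<close>

definition fbase :: "('a \<Rightarrow> 'a \<Rightarrow> bool) \<Rightarrow> bool" where
  "fbase R \<longleftrightarrow> dfn (\<lambda>s. R (s 0) (s 1)) \<and> (\<forall>z\<in>U. \<exists>x\<in>U. R x z) \<and>
     (\<forall>z\<in>U. \<forall>z'\<in>U. \<exists>w\<in>U. \<forall>x\<in>U. R x w \<longrightarrow> R x z \<and> R x z')"

text \<open>The filter with base \<open>R'\<close> contains the one with base
  \<open>R\<close>.\<close>

definition refines :: "('a \<Rightarrow> 'a \<Rightarrow> bool) \<Rightarrow> ('a \<Rightarrow> 'a \<Rightarrow> bool) \<Rightarrow> bool" where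
  "refines R' R \<longleftrightarrow> (\<forall>z\<in>U. \<exists>w\<in>U. \<forall>x\<in>U. R' x w \<longrightarrow> R x z)"

text \<open>
  \<open>D y\<close> holds iff \<open>A _ y\<close> is compatible with the filter and all decisions made before \<open>y\<close>.
  Finite consistency is then proved by induction on the largest element of \<open>s\<close>.
\<close>

lemma fbase_decide:
  assumes R: "fbase R" and A: "dfn (\<lambda>s. A (s 0) (s 1))"
  shows "\<exists>D. dfn (\<lambda>s. D (s 0)) \<and>
    (\<forall>s\<in>U. fin s \<longrightarrow> (\<forall>z\<in>U. \<exists>x\<in>U. R x z \<and> (\<forall>t\<in>E s. A x t \<longleftrightarrow> D t)))"
proof -
  have dR: "dfn (\<lambda>s. R (f s) (g s))" if "tmd f" "tmd g" for f g
    using that by (intro dfn_sub2[OF R[unfolded fbase_def, THEN conjunct1]])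
  have dA: "dfn (\<lambda>s. A (f s) (g s))" if "tmd f" "tmd g" for f g
    using that by (rule dfn_sub2[OF A])
  have ne: "\<exists>x\<in>U. R x z" if "z \<in> U" for z
    using R that unfolding fbase_def by blast
  have dir: "\<exists>w\<in>U. \<forall>x\<in>U. R x w \<longrightarrow> R x z \<and> R x z'" if "z \<in> U" "z' \<in> U" for z z'
    using R that unfolding fbase_def by blast
  \<comment> \<open>\<open>g\<close> records the earlier decisions. Compatibility quantifies over
    base sets and over finite sets of earlier parameters, both given by elements of
    \<open>U\<close>, so it is expressed by one formula.\<close>
  define H where "H y g \<longleftrightarrow> (\<forall>z\<in>U. \<forall>s\<in>U. fin s \<and> E s \<subseteq> E (seg y) \<longrightarrow>
    (\<exists>x\<in>U. R x z \<and> A x y \<and> (\<forall>t\<in>E s. A x t \<longleftrightarrow> t \<in> E g)))" for y g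
  have "dfn (\<lambda>s. H (s 0) (s 1))"
    unfolding H_def by (intro dfns dR dA)
  moreover have "H y g \<longleftrightarrow> H y g'" if "y \<in> U" "g \<in> U" "g' \<in> U"
      "\<And>t. t \<in> E (seg y) \<Longrightarrow> t \<in> E g \<longleftrightarrow> t \<in> E g'" for y g g'
  proof -
    have "(\<forall>t\<in>E s. A x t \<longleftrightarrow> t \<in> E g) \<longleftrightarrow> (\<forall>t\<in>E s. A x t \<longleftrightarrow> t \<in> E g')" if "E s \<subseteq> E (seg y)" for x s
      using that \<open>\<And>t. t \<in> E (seg y) \<Longrightarrow> t \<in> E g \<longleftrightarrow> t \<in> E g'\<close> by blast
    then show ?thesis
      unfolding H_def by (simp cong: conj_cong imp_cong)
  qed
  ultimately obtain D where dD': "dfn (\<lambda>s. D (s 0))"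
    and D: "\<And>y g. y \<in> U \<Longrightarrow> g \<in> U \<Longrightarrow> \<forall>t\<in>E (seg y). t \<in> E g \<longleftrightarrow> D t \<Longrightarrow> D y \<longleftrightarrow> H y g"
    using predicate_recursion[of H] by blast
  have dD: "dfn (\<lambda>s. D (f s))" if "tmd f" for f
    using that by (rule dfn_sub1[OF dD'])
  \<comment> \<open>The recursion equation with \<open>D\<close> itself in place of
    \<open>g\<close>, available because \<open>D\<close> restricted to a segment is a set.\<close>
  have D_iff: "D y \<longleftrightarrow> (\<forall>z\<in>U. \<forall>s\<in>U. fin s \<and> E s \<subseteq> E (seg y) \<longrightarrow>
    (\<exists>x\<in>U. R x z \<and> A x y \<and> (\<forall>t\<in>E s. A x t \<longleftrightarrow> D t)))" if y: "y \<in> U" for y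
  proof -
    have "isset {t \<in> E (seg y). D t}"
      using y by (intro isset_sep dD dfns seg_in)
    then obtain g where g: "g \<in> U" "E g = {t \<in> E (seg y). D t}"
      unfolding isset_def by blast
    have "(\<forall>t\<in>E s. A x t \<longleftrightarrow> t \<in> E g) \<longleftrightarrow> (\<forall>t\<in>E s. A x t \<longleftrightarrow> D t)" if "E s \<subseteq> E (seg y)" for x s
      using that g by blast
    moreover have "D y \<longleftrightarrow> H y g"
      using D[OF y g(1)] g(2) by blast
    ultimately show ?thesis
      unfolding H_def by (simp cong: conj_cong imp_cong)
  qed
  let ?ok = "\<lambda>s. \<forall>z\<in>U. \<exists>x\<in>U. R x z \<and> (\<forall>t\<in>E s. A x t \<longleftrightarrow> D t)"
  have main: "\<forall>s\<in>U. fin s \<and> E s \<subseteq> insert m (E (seg m)) \<longrightarrow> ?ok s" if "m \<in> U" for m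
  proof (rule L_induct[where P = "\<lambda>m. \<forall>s\<in>U. fin s \<and> E s \<subseteq> insert m (E (seg m)) \<longrightarrow> ?ok s", OF _ _ that])
    have "dfn (\<lambda>r. \<forall>s\<in>U. fin s \<and> E s \<subseteq> E (ins (r 0) (seg (r 0))) \<longrightarrow> ?ok s)"
      by (intro dfns dR dA dD)
    then show "dfn (\<lambda>r. \<forall>s\<in>U. fin s \<and> E s \<subseteq> insert (r 0) (E (seg (r 0))) \<longrightarrow> ?ok s)"
      by (rule dfn_cong[rotated]) (simp add: env_app)
  next
    fix m assume m: "m \<in> U"
      and IH: "\<And>n. n \<in> U \<Longrightarrow> L n m \<Longrightarrow> \<forall>s\<in>U. fin s \<and> E s \<subseteq> insert n (E (seg n)) \<longrightarrow> ?ok s"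
    have below: "?ok s" if s: "s \<in> U" "fin s" "E s \<subseteq> E (seg m)" for s
    proof (cases "E s = {}")
      case False
      then obtain n where "n \<in> E s" "E s \<subseteq> insert n (E (seg n))"
        using fin_max s by blast
      moreover have "n \<in> U" "L n m"
        using \<open>n \<in> E s\<close> s m by (auto simp: E_seg)
      ultimately show ?thesis
        using IH s by blast
    qed (use ne in simp)
    show "\<forall>s\<in>U. fin s \<and> E s \<subseteq> insert m (E (seg m)) \<longrightarrow> ?ok s"
    proof (intro ballI impI; elim conjE)
      fix s z assume s: "s \<in> U" "fin s" "E s \<subseteq> insert m (E (seg m))" and z: "z \<in> U"
      have "isset {t \<in> E s. t \<in> E (seg m)}"
        using s m by (intro isset_sep dfns seg_in)
      then obtain s' where s': "s' \<in> U" "E s' = {t \<in> E s. t \<in> E (seg m)}"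
        unfolding isset_def by blast
      have "fin s'"
        using fin_subset[OF s(2,1) s'(1)] s' by blast
      have "\<exists>x\<in>U. R x z \<and> (A x m \<longleftrightarrow> D m) \<and> (\<forall>t\<in>E s'. A x t \<longleftrightarrow> D t)"
      proof (cases "D m")
        case True
        then show ?thesis
          using D_iff[OF m, THEN iffD1, OF True, rule_format, OF z s'(1)] s'(2) \<open>fin s'\<close> by blast
      next
        \<comment> \<open>A rejection at \<open>m\<close> has witnesses \<open>z0\<close> and
          \<open>s0\<close> that force \<open>A x m\<close> to fail. Adding \<open>s0\<close> to the
          finite set and shrinking the base set into that of \<open>z0\<close> gives an
          \<open>x\<close> that respects the rejection.\<close>
        case False
        then obtain z0 s0 where s0: "z0 \<in> U" "s0 \<in> U" "fin s0" "E s0 \<subseteq> E (seg m)"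
          "\<And>x. x \<in> U \<Longrightarrow> R x z0 \<Longrightarrow> \<forall>t\<in>E s0. A x t \<longleftrightarrow> D t \<Longrightarrow> \<not> A x m"
          using D_iff[OF m] by blast
        obtain w where w: "w \<in> U" "\<And>x. x \<in> U \<Longrightarrow> R x w \<Longrightarrow> R x z \<and> R x z0"
          using dir[OF z s0(1)] by blast
        have "E (un s' s0) \<subseteq> E (seg m)"
          using s0 s' by auto
        then have "?ok (un s' s0)"
          using below[OF un_in[OF s'(1) s0(2)] fin_un[OF \<open>fin s'\<close> s'(1) s0(3,2)]] by blast
        then obtain x where x: "x \<in> U" "R x w" "\<forall>t\<in>E s' \<union> E s0. A x t \<longleftrightarrow> D t"
          using w(1) E_un[OF s'(1) s0(2)] by metis
        then show ?thesis
          using w(2)[OF x(1,2)] s0(5)[OF x(1)] False by blast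
      qed
      then obtain x where x: "x \<in> U" "R x z" "A x m \<longleftrightarrow> D m" "\<forall>t\<in>E s'. A x t \<longleftrightarrow> D t"
        by blast
      then have "\<forall>t\<in>E s. A x t \<longleftrightarrow> D t"
        using s(3) s'(2) by blast
      then show "\<exists>x\<in>U. R x z \<and> (\<forall>t\<in>E s. A x t \<longleftrightarrow> D t)"
        using x by blast
    qed
  qed
  have "?ok s" if s: "s \<in> U" "fin s" for s
  proof (cases "E s = {}")
    case False
    then obtain n where "n \<in> E s" "E s \<subseteq> insert n (E (seg n))"
      using fin_max s by blast
    then show ?thesis
      using main[of n] s Ext_U by blast
  qed (use ne in simp)
  then show ?thesis
    using dD' by blast
qed

lemma fbase_extend:
  assumes R: "fbase R" and A: "dfn (\<lambda>s. A (s 0) (s 1))"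
  shows "\<exists>R'. fbase R' \<and> refines R' R \<and>
    (\<exists>D. dfn (\<lambda>s. D (s 0)) \<and> (\<forall>y\<in>U. \<exists>w\<in>U. \<forall>x\<in>U. R' x w \<longrightarrow> (A x y \<longleftrightarrow> D y)))"
proof -
  obtain D where dD: "dfn (\<lambda>s. D (s 0))"
    and D: "\<And>s z. s \<in> U \<Longrightarrow> fin s \<Longrightarrow> z \<in> U \<Longrightarrow> \<exists>x\<in>U. R x z \<and> (\<forall>t\<in>E s. A x t \<longleftrightarrow> D t)"
    using fbase_decide[OF assms] by blast
  have dR: "dfn (\<lambda>s. R (s 0) (s 1))"
    using R by (simp add: fbase_def)
  \<comment> \<open>Indices are now pairs: an old base set, cut down by the decisions on a finite
    set of parameters. A second component that is not finite imposes nothing, so all of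
    \<open>U\<close> can serve as indices.\<close>
  define R' where "R' x w \<longleftrightarrow> R x (pfst w) \<and> (fin (psnd w) \<longrightarrow> (\<forall>t\<in>E (psnd w). A x t \<longleftrightarrow> D t))" for x w
  have "fbase R'"
    unfolding fbase_def
  proof (intro conjI ballI)
    show "dfn (\<lambda>s. R' (s 0) (s 1))"
      unfolding R'_def by (intro dfns dfn_sub2[OF dR] dfn_sub2[OF A] dfn_sub1[OF dD])
    show "\<exists>x\<in>U. R' x w" for w
      using D[of "psnd w" "pfst w"] D[of emp "pfst w"] fin_emp unfolding R'_def by (cases "fin (psnd w)") auto
    show "\<exists>w''\<in>U. \<forall>x\<in>U. R' x w'' \<longrightarrow> R' x w \<and> R' x w'" if "w \<in> U" "w' \<in> U" for w w'
    proof -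
      define s where "s w = (if fin (psnd w) then psnd w else emp)" for w
      have s: "s w \<in> U" "fin (s w)" for w
        by (simp_all add: s_def fin_emp)
      have R'_iff: "R' x w \<longleftrightarrow> R x (pfst w) \<and> (\<forall>t\<in>E (s w). A x t \<longleftrightarrow> D t)" for x w
        by (simp add: R'_def s_def)
      obtain z where z: "z \<in> U" "\<forall>x\<in>U. R x z \<longrightarrow> R x (pfst w) \<and> R x (pfst w')"
        using R[unfolded fbase_def, THEN conjunct2, THEN conjunct2, rule_format, OF pfst_in pfst_in] by blast
      let ?u = "un (s w) (s w')"
      have "fin ?u" "?u \<in> U" "E ?u = E (s w) \<union> E (s w')"
        using s by (auto intro: fin_un)
      then have "pfst (pr z ?u) = z" "E (s (pr z ?u)) = E (s w) \<union> E (s w')" "pr z ?u \<in> U"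
        using z(1) s_def[of "pr z ?u"] by simp_all
      then show ?thesis
        using z(2) unfolding R'_iff by (intro bexI[of _ "pr z ?u"]) auto
    qed
  qed
  moreover have "refines R' R"
    unfolding refines_def
  proof
    fix z assume "z \<in> U"
    then show "\<exists>w\<in>U. \<forall>x\<in>U. R' x w \<longrightarrow> R x z"
      by (intro bexI[of _ "pr z emp"]) (simp_all add: R'_def)
  qed
  \<comment> \<open>The decision at \<open>y\<close> holds on the base set whose second component is
    the singleton of \<open>y\<close>; the first component may be any element, here
    \<open>emp\<close>.\<close>
  moreover have "\<exists>w\<in>U. \<forall>x\<in>U. R' x w \<longrightarrow> (A x y \<longleftrightarrow> D y)" if "y \<in> U" for y
    using that fin_ins[OF fin_emp emp_in, of y]
    by (intro bexI[of _ "pr emp (ins y emp)"]) (simp_all add: R'_def)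
  ultimately show ?thesis
    using dD by blast
qed

end

section \<open>Packing parameter lists into single elements\<close>

context zf
begin

text \<open>Reads any element as an infinite list in \<open>U\<close>; with
  \<open>sat_finite_support\<close>, one parameter thereby replaces a whole list.\<close>

definition dec :: "'a \<Rightarrow> nat \<Rightarrow> 'a" where
  "dec y i = pfst ((psnd ^^ i) y)"

primrec enc :: "nat \<Rightarrow> (nat \<Rightarrow> 'a) \<Rightarrow> 'a" where
  "enc 0 g = emp"
| "enc (Suc k) g = pr (g 0) (enc k (\<lambda>i. g (Suc i)))"

lemma enc_in: "(\<And>i. g i \<in> U) \<Longrightarrow> enc k g \<in> U"
  by (induction k arbitrary: g) simp_all

lemma dec_enc: "(\<And>i. g i \<in> U) \<Longrightarrow> i < k \<Longrightarrow> dec (enc k g) i = g i"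
proof (induction k arbitrary: g i)
  case (Suc k)
  show ?case
  proof (cases i)
    case 0
    then show ?thesis
      using Suc.prems(1) by (simp add: dec_def enc_in)
  next
    case (Suc j)
    have "(psnd ^^ i) (enc (Suc k) g) = (psnd ^^ j) (enc k (\<lambda>i. g (Suc i)))"
      using Suc Suc.prems by (simp add: funpow_swap1 enc_in del: funpow.simps add: funpow_Suc_right)
    then have "dec (enc (Suc k) g) i = dec (enc k (\<lambda>i. g (Suc i))) j"
      by (simp only: dec_def)
    then show ?thesis
      using Suc.IH[of "\<lambda>i. g (Suc i)" j] Suc.prems Suc by simp
  qed
qed simp

lemma tmd_enc: "(\<And>i. tmd (ts i)) \<Longrightarrow> tmd (\<lambda>s. enc k (\<lambda>i. ts i s))"
  by (induction k arbitrary: ts) (simp_all add: tmd_const tmd_pr)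

lemma tmd_dec:
  assumes "tmd f"
  shows "tmd (\<lambda>s. dec (f s) i)"
proof -
  have "tmd (\<lambda>s. (psnd ^^ i) (f s))"
    using assms by (induction i) (simp_all add: tmd_psnd)
  then show ?thesis
    unfolding dec_def by (rule tmd_pfst)
qed

text \<open>A formula number and one element of \<open>U\<close> determine a definable predicate;
  this bounds the size of the ultrapower.\<close>

lemma dfn_coded:
  assumes "dfn P"
  shows "\<exists>n. \<exists>y\<in>U. \<forall>s. env s \<longrightarrow> (P s \<longleftrightarrow> sat M (merge s (dec y)) (from_nat n))"
proof -
  obtain \<phi> t where \<phi>: "env t" "\<And>s. env s \<Longrightarrow> P s \<longleftrightarrow> sat M (merge s t) \<phi>"
    using assms unfolding dfn_def by blast
  obtain k where k: "\<And>s s'. (\<forall>i<k. s i = s' i) \<Longrightarrow> sat M s \<phi> = sat M s' \<phi>"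
    using sat_finite_support by blast
  have "sat M (merge s t) \<phi> = sat M (merge s (dec (enc k t))) \<phi>" for s
    using \<phi>(1) by (intro k) (auto simp: merge_def dec_enc env_def)
  then show ?thesis
    using \<phi> by (intro exI[of _ "to_nat \<phi>"] bexI[of _ "enc k t"]) (simp_all add: enc_in env_def)
qed

end

section \<open>Assembling the ultrafilter from the stages\<close>

context zf_wo
begin

lemma refines_trans: "refines R S \<Longrightarrow> refines S T \<Longrightarrow> refines R T"
  unfolding refines_def by meson

text \<open>Definability is for each \<open>Q\<close> separately, since the definition depends on
  the stage that decides \<open>Q\<close>. Classes that are not definable may remain
  undecided.\<close>

theorem definable_ultrafilter:
  "\<exists>UF. (\<forall>X Y. UF X \<longrightarrow> (\<forall>x\<in>U. X x \<longrightarrow> Y x) \<longrightarrow> UF Y) \<and>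
    (\<forall>X Y. UF X \<longrightarrow> UF Y \<longrightarrow> UF (\<lambda>x. X x \<and> Y x)) \<and>
    \<not> UF (\<lambda>x. False) \<and>
    (\<forall>Q. dfn Q \<longrightarrow> dfn (\<lambda>s. UF (\<lambda>x. Q (case_nat x s)))) \<and>
    (\<forall>Q s. dfn Q \<longrightarrow> env s \<longrightarrow> UF (\<lambda>x. Q (case_nat x s)) \<or> UF (\<lambda>x. \<not> Q (case_nat x s))) \<and>
    (\<forall>m\<in>U. UF (\<lambda>x. rel M m x))"
proof -
  \<comment> \<open>Formula number \<open>n\<close>, with \<open>x\<close> as variable 0 and all
    other variables unpacked from \<open>y\<close>; fixing \<open>n\<close> keeps this
    definable.\<close>
  define A where "A n x y \<longleftrightarrow> sat M (case_nat x (dec y)) (from_nat n)" for n x y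
  have dA: "dfn (\<lambda>s. A n (s 0) (s 1))" for n
  proof -
    let ?f = "case_nat (\<lambda>s. s 0) (\<lambda>i s. dec (s 1) i)"
    have "tmd (?f i)" for i
      by (cases i) (simp_all add: tmd_var tmd_dec)
    from dfn_sat[of ?f, OF this] have "dfn (\<lambda>s. sat M (\<lambda>i. ?f i s) (from_nat n))" .
    moreover have "(\<lambda>i. ?f i s) = case_nat (s 0) (dec (s 1))" for s :: "nat \<Rightarrow> 'a"
      by (rule ext) (simp split: nat.split)
    ultimately show ?thesis
      by (simp add: A_def)
  qed
  define R0 where "R0 x z \<longleftrightarrow> E z \<subseteq> E x" for x z
  have "fbase R0"
    unfolding fbase_def R0_def
  proof (intro conjI ballI)
    show "dfn (\<lambda>s. E (s 1) \<subseteq> E (s 0))"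
      by (intro dfns)
    show "\<exists>x\<in>U. E z \<subseteq> E x" if "z \<in> U" for z
      using that by blast
    show "\<exists>w\<in>U. \<forall>x\<in>U. E w \<subseteq> E x \<longrightarrow> E z \<subseteq> E x \<and> E z' \<subseteq> E x" if "z \<in> U" "z' \<in> U" for z z'
      using that by (intro bexI[of _ "un z z'"]) simp_all
  qed
  define dd where "dd n R' \<longleftrightarrow> (\<exists>D. dfn (\<lambda>s. D (s 0)) \<and>
    (\<forall>y\<in>U. \<exists>w\<in>U. \<forall>x\<in>U. R' x w \<longrightarrow> (A n x y \<longleftrightarrow> D y)))" for n R'
  \<comment> \<open>Each stage is only known to exist, hence dependent choice outside
    \<open>M\<close>. The invariant that every stage refines \<open>R0\<close> is what later makes
    the extension taller.\<close>
  have "\<exists>R. \<forall>n. (fbase (R n) \<and> refines (R n) R0) \<and> (refines (R (Suc n)) (R n) \<and> dd n (R (Suc n)))"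
  proof (rule dependent_nat_choice)
    show "\<exists>R. fbase R \<and> refines R R0"
      using \<open>fbase R0\<close> unfolding refines_def by blast
    show "\<exists>R'. (fbase R' \<and> refines R' R0) \<and> (refines R' R \<and> dd n R')" if "fbase R \<and> refines R R0" for R n
      using fbase_extend[OF conjunct1[OF that] dA[of n]] that refines_trans unfolding dd_def by blast
  qed
  then obtain R where R: "\<And>n. fbase (R n)" "\<And>n. refines (R n) R0" "\<And>n. refines (R (Suc n)) (R n)"
    "\<And>n. dd n (R (Suc n))"
    by blast
  have R_mono: "refines (R m) (R n)" if "n \<le> m" for n m
    using that
  proof (induction m rule: dec_induct)
    case base
    show ?case unfolding refines_def by blast
  next
    case (step m)
    then show ?case using R(3) refines_trans by blast
  qed
  define UF where "UF X \<longleftrightarrow> (\<exists>n. \<exists>z\<in>U. \<forall>x\<in>U. R n x z \<longrightarrow> X x)" for X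
  have mono: "UF Y" if "UF X" "\<And>x. x \<in> U \<Longrightarrow> X x \<Longrightarrow> Y x" for X Y
    using that unfolding UF_def by meson
  have conj: "UF (\<lambda>x. X x \<and> Y x)" if "UF X" "UF Y" for X Y
  proof -
    obtain n z n' z' where z: "z \<in> U" "\<forall>x\<in>U. R n x z \<longrightarrow> X x" "z' \<in> U" "\<forall>x\<in>U. R n' x z' \<longrightarrow> Y x"
      using \<open>UF X\<close> \<open>UF Y\<close> unfolding UF_def by blast
    let ?m = "max n n'"
    obtain w where w: "w \<in> U" "\<forall>x\<in>U. R ?m x w \<longrightarrow> R n x z"
      using R_mono[of n ?m] z(1) unfolding refines_def by auto
    obtain w' where w': "w' \<in> U" "\<forall>x\<in>U. R ?m x w' \<longrightarrow> R n' x z'"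
      using R_mono[of n' ?m] z(3) unfolding refines_def by auto
    obtain v where "v \<in> U" "\<forall>x\<in>U. R ?m x v \<longrightarrow> R ?m x w \<and> R ?m x w'"
      using R(1)[of ?m] w(1) w'(1) unfolding fbase_def by blast
    then show ?thesis
      unfolding UF_def using w w' z by blast
  qed
  have proper: "\<not> UF (\<lambda>x. False)"
    using R(1) unfolding UF_def fbase_def by blast
  \<comment> \<open>The stage for the number of \<open>Q\<close> decides all its parameters by
    \<open>D\<close>; the term \<open>c\<close> packs the arguments \<open>s\<close> and the hidden
    parameters of \<open>Q\<close> into the single one that \<open>D\<close> expects.\<close>
  have rep: "\<exists>D c. dfn (\<lambda>s. D (s 0)) \<and> tmd c \<and> (\<forall>s. env s \<longrightarrow>
      (if D (c s) then UF (\<lambda>x. Q (case_nat x s)) else UF (\<lambda>x. \<not> Q (case_nat x s))))" if Q: "dfn Q" for Q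
  proof -
    obtain \<phi> t where \<phi>: "env t" "\<And>s. env s \<Longrightarrow> Q s \<longleftrightarrow> sat M (merge s t) \<phi>"
      using Q unfolding dfn_def by blast
    let ?\<psi> = "ren (\<lambda>i. if i = 0 then 0 else if even i then i - 1 else Suc i) \<phi>"
    obtain k where k: "\<And>s s'. (\<forall>i<k. s i = s' i) \<Longrightarrow> sat M s ?\<psi> = sat M s' ?\<psi>"
      using sat_finite_support by blast
    let ?n = "to_nat ?\<psi>"
    let ?c = "\<lambda>s. enc k (merge s t)"
    have "tmd (\<lambda>s. merge s t i)" for i
      using \<phi>(1) by (cases "even i") (simp_all add: merge_def tmd_var tmd_const env_app)
    then have c: "tmd ?c"
      using tmd_enc[of "\<lambda>i s. merge s t i" k] by simp
    have QA: "Q (case_nat x s) \<longleftrightarrow> A ?n x (?c s)" if "x \<in> U" "env s" for x s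
    proof -
      have "Q (case_nat x s) \<longleftrightarrow> sat M (case_nat x (merge s t)) ?\<psi>"
        using \<phi>(2)[OF env_case[OF that]] by (simp only: sat_ren merge_case_nat)
      also have "\<dots> \<longleftrightarrow> sat M (case_nat x (dec (?c s))) ?\<psi>"
        using env_app[OF env_merge[OF that(2) \<phi>(1)]]
        by (intro k) (auto simp: dec_enc split: nat.split)
      finally show ?thesis
        by (simp add: A_def)
    qed
    obtain D where D: "dfn (\<lambda>s. D (s 0))"
      "\<And>y. y \<in> U \<Longrightarrow> \<exists>w\<in>U. \<forall>x\<in>U. R (Suc ?n) x w \<longrightarrow> (A ?n x y \<longleftrightarrow> D y)"
      using R(4)[of ?n] unfolding dd_def by blast
    have "if D (?c s) then UF (\<lambda>x. Q (case_nat x s)) else UF (\<lambda>x. \<not> Q (case_nat x s))" if s: "env s" for s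
    proof -
      obtain w where "w \<in> U" "\<forall>x\<in>U. R (Suc ?n) x w \<longrightarrow> (A ?n x (?c s) \<longleftrightarrow> D (?c s))"
        using D(2)[OF tmd_in[OF c s]] by blast
      then show ?thesis
        unfolding UF_def using QA[OF _ s] by auto
    qed
    then show ?thesis
      using D(1) c by blast
  qed
  have definable: "dfn (\<lambda>s. UF (\<lambda>x. Q (case_nat x s)))" if Q: "dfn Q" for Q
  proof -
    obtain D c where D: "dfn (\<lambda>s. D (s 0))" "tmd c" and *: "\<And>s. env s \<Longrightarrow>
      (if D (c s) then UF (\<lambda>x. Q (case_nat x s)) else UF (\<lambda>x. \<not> Q (case_nat x s)))"
      using rep[OF Q] by blast
    \<comment> \<open>If \<open>D\<close> rejects, the complement is large, and \<open>conj\<close>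
      with \<open>proper\<close> excludes that both are.\<close>
    have "UF (\<lambda>x. Q (case_nat x s)) \<longleftrightarrow> D (c s)" if "env s" for s
    proof (cases "D (c s)")
      case False
      then have "\<not> UF (\<lambda>x. Q (case_nat x s))"
        using *[OF that] conj[of "\<lambda>x. Q (case_nat x s)" "\<lambda>x. \<not> Q (case_nat x s)"] proper by auto
      then show ?thesis using False by simp
    qed (use *[OF that] in simp)
    then show ?thesis
      by (rule dfn_cong[OF _ dfn_sub1[OF D]])
  qed
  have ultra: "UF (\<lambda>x. Q (case_nat x s)) \<or> UF (\<lambda>x. \<not> Q (case_nat x s))" if "dfn Q" "env s" for Q s
    using rep[OF that(1)] that(2) by metis
  have tall: "UF (\<lambda>x. rel M m x)" if m: "m \<in> U" for m
  proof -
    \<comment> \<open>The base set of \<open>R0\<close> at the singleton of \<open>m\<close>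
      consists of the sets that have \<open>m\<close> as a member.\<close>
    obtain w where w: "w \<in> U" "\<forall>x\<in>U. R 0 x w \<longrightarrow> R0 x (ins m emp)"
      using R(2)[of 0, unfolded refines_def, rule_format, OF ins_in[OF m emp_in]] by blast
    have "rel M m x" if "R0 x (ins m emp)" for x
      using that m by (simp add: R0_def Ext_def[of M x])
    then show ?thesis
      unfolding UF_def using w by blast
  qed
  show ?thesis
    using mono conj proper definable ultra tall by (intro exI[of _ UF]) blast
qed

end

section \<open>The definable ultrapower\<close>

locale zf_uf = zf_wo +
  fixes UF :: "('a \<Rightarrow> bool) \<Rightarrow> bool"
  assumes UF_mono: "UF X \<Longrightarrow> (\<And>x. x \<in> U \<Longrightarrow> X x \<Longrightarrow> Y x) \<Longrightarrow> UF Y"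
    and UF_conj: "UF X \<Longrightarrow> UF Y \<Longrightarrow> UF (\<lambda>x. X x \<and> Y x)"
    and UF_proper: "\<not> UF (\<lambda>x. False)"
    and UF_dfn: "dfn Q \<Longrightarrow> dfn (\<lambda>s. UF (\<lambda>x. Q (case_nat x s)))"
    and UF_ultra: "dfn Q \<Longrightarrow> env s \<Longrightarrow> UF (\<lambda>x. Q (case_nat x s)) \<or> UF (\<lambda>x. \<not> Q (case_nat x s))"
    and UF_tall: "m \<in> U \<Longrightarrow> UF (\<lambda>x. rel M m x)"
begin

lemma UF_not:
  assumes "dfn (\<lambda>s. P (s 0))"
  shows "UF (\<lambda>x. \<not> P x) \<longleftrightarrow> \<not> UF P"
proof
  show "\<not> UF P" if "UF (\<lambda>x. \<not> P x)"
    using UF_conj[of P, OF _ that] UF_proper by auto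
  have "env (\<lambda>_. emp)"
    by (simp add: env_def)
  then show "\<not> UF P \<Longrightarrow> UF (\<lambda>x. \<not> P x)"
    using UF_ultra[OF assms] by auto
qed

lemma UF_const: "UF (\<lambda>x. b) \<longleftrightarrow> b"
  using UF_not[of "\<lambda>_. False", OF dfn_const] UF_proper by (cases b) simp_all

lemma UF_conj_iff: "UF (\<lambda>x. X x \<and> Y x) \<longleftrightarrow> UF X \<and> UF Y"
  using UF_conj[of X Y] UF_mono[of "\<lambda>x. X x \<and> Y x"] by blast

text \<open>Only the values on \<open>U\<close> are constrained; off \<open>U\<close> a function of
  the HOL type is arbitrary, and \<open>eqUI\<close> identifies functions that agree on
  \<open>U\<close>.\<close>

definition Fn :: "('a \<Rightarrow> 'a) set" where
  "Fn = {f. tmd (\<lambda>s. f (s 0))}"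

definition eqU :: "('a \<Rightarrow> 'a) \<Rightarrow> ('a \<Rightarrow> 'a) \<Rightarrow> bool" where
  "eqU f g \<longleftrightarrow> UF (\<lambda>x. f x = g x)"

lemma Fn_in: "f \<in> Fn \<Longrightarrow> x \<in> U \<Longrightarrow> f x \<in> U"
  using tmd_in[of "\<lambda>s. f (s 0)" "\<lambda>_. x"] by (simp add: Fn_def env_def)

lemma Fn_tmd: "f \<in> Fn \<Longrightarrow> tmd g \<Longrightarrow> tmd (\<lambda>s. f (g s))"
  unfolding Fn_def by (auto intro: tmd_sub1)

lemma Fn_const: "m \<in> U \<Longrightarrow> (\<lambda>_. m) \<in> Fn"
  by (simp add: Fn_def tmd_const)

lemma Fn_id: "(\<lambda>x. x) \<in> Fn"
  by (simp add: Fn_def tmd_var)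

lemma eqU_refl: "eqU f f"
  by (simp add: eqU_def UF_const)

lemma eqUI: "(\<And>x. x \<in> U \<Longrightarrow> f x = g x) \<Longrightarrow> eqU f g"
  unfolding eqU_def by (rule UF_mono[of "\<lambda>_. True"]) (simp_all add: UF_const)

lemma eqU_sym: "eqU f g \<Longrightarrow> eqU g f"
  unfolding eqU_def by (erule UF_mono) simp

lemma eqU_trans: "eqU f g \<Longrightarrow> eqU g h \<Longrightarrow> eqU f h"
  unfolding eqU_def by (drule (1) UF_conj) (erule UF_mono, simp)

text \<open>The second use of the well-order: the \<open>L\<close>-least witness is a definable
  function of \<open>x\<close>. Where no witness exists, \<open>emp\<close> keeps the function
  total.\<close>

lemma skolem:
  assumes P: "dfn (\<lambda>s. P (s 0) (s 1))"
  shows "\<exists>g\<in>Fn. \<forall>x\<in>U. (\<exists>a\<in>U. P x a) \<longrightarrow> P x (g x)"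
proof -
  define G where "G x u \<longleftrightarrow> P x u \<and> (\<forall>b\<in>U. P x b \<and> b \<noteq> u \<longrightarrow> L u b) \<or>
    \<not> (\<exists>a\<in>U. P x a) \<and> u = emp" for x u
  have dP: "dfn (\<lambda>s. P (f s) (g s))" if "tmd f" "tmd g" for f g
    using that by (rule dfn_sub2[OF P])
  have "\<exists>!u. u \<in> U \<and> G x u" if x: "x \<in> U" for x
  proof (cases "\<exists>a\<in>U. P x a")
    case True
    then obtain a where a: "a \<in> U" "P x a" by blast
    have "dfn (\<lambda>s. P x (s 0))"
      using x by (intro dP dfns)
    then obtain m where m: "m \<in> U" "P x m" "\<And>b. b \<in> U \<Longrightarrow> P x b \<Longrightarrow> b \<noteq> m \<Longrightarrow> L m b"
      using L_least[of "P x" a] a by blast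
    show ?thesis
    proof (rule ex1I[of _ m])
      show "m \<in> U \<and> G x m"
        using m unfolding G_def by blast
      show "u = m" if "u \<in> U \<and> G x u" for u
        using that m True L_asym[of u m] unfolding G_def by metis
    qed
  next
    case False
    then show ?thesis
      unfolding G_def by (intro ex1I[of _ emp]) auto
  qed
  note the = theI'[OF this]
  define g where "g x = (THE u. u \<in> U \<and> G x u)" for x
  have g: "g x \<in> U" "G x (g x)" if "x \<in> U" for x
    using the[OF that] by (simp_all add: g_def)
  have "tmd (\<lambda>s. g (s 0))"
  proof (rule tmdI)
    show "u = g (s 0) \<longleftrightarrow> G (s 0) u" if "u \<in> U" "env s" for u s
      using that g[of "s 0"] \<open>\<And>x. x \<in> U \<Longrightarrow> \<exists>!u. u \<in> U \<and> G x u\<close>[of "s 0"] env_app[of s 0] by blast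
    show "dfn (\<lambda>s. G (s (Suc 0)) (s 0))"
      unfolding G_def by (intro dfns dP emp_in)
  qed (simp add: g env_app)
  moreover have "P x (g x)" if "x \<in> U" "\<exists>a\<in>U. P x a" for x
    using g[of x] that unfolding G_def by blast
  ultimately show ?thesis
    unfolding Fn_def by blast
qed

section \<open>Representing classes of functions in the sum type\<close>

definition fcode :: "('a \<Rightarrow> 'a) \<Rightarrow> 'a" where
  "fcode f = (SOME e. \<exists>n. \<exists>y\<in>U. e = pr (num n) y \<and>
     (\<forall>s. env s \<longrightarrow> (s 0 = f (s (Suc 0)) \<longleftrightarrow> sat M (merge s (dec y)) (from_nat n))))"

lemma fcode_inj:
  assumes "f \<in> Fn" "g \<in> Fn" "fcode f = fcode g" "x \<in> U"
  shows "f x = g x"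
proof -
  have "\<exists>n. \<exists>y\<in>U. fcode f = pr (num n) y \<and>
     (\<forall>s. env s \<longrightarrow> (s 0 = f (s (Suc 0)) \<longleftrightarrow> sat M (merge s (dec y)) (from_nat n)))" if "f \<in> Fn" for f
    unfolding fcode_def
  proof (rule someI_ex)
    have "dfn (\<lambda>s. s 0 = f (s (Suc 0)))"
      by (rule dfn_eq[OF tmd_var Fn_tmd[OF that tmd_var]])
    then show "\<exists>e n. \<exists>y\<in>U. e = pr (num n) y \<and>
        (\<forall>s. env s \<longrightarrow> (s 0 = f (s (Suc 0)) \<longleftrightarrow> sat M (merge s (dec y)) (from_nat n)))"
      using dfn_coded[of "\<lambda>s. s 0 = f (s (Suc 0))"] by blast
  qed
  from this[OF assms(1)] this[OF assms(2)] obtain n y m z where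
    f: "y \<in> U" "fcode f = pr (num n) y"
      "\<And>s. env s \<Longrightarrow> s 0 = f (s (Suc 0)) \<longleftrightarrow> sat M (merge s (dec y)) (from_nat n)"
    and g: "z \<in> U" "fcode g = pr (num m) z"
      "\<And>s. env s \<Longrightarrow> s 0 = g (s (Suc 0)) \<longleftrightarrow> sat M (merge s (dec z)) (from_nat m)"
    by blast
  have "n = m" "y = z"
    using f g assms(3) by simp_all
  moreover have "env (case_nat (f x) (\<lambda>_. x))"
    using assms Fn_in by (intro env_case) (simp_all add: env_def)
  ultimately show ?thesis
    using f(3)[of "case_nat (f x) (\<lambda>_. x)"] g(3)[of "case_nat (f x) (\<lambda>_. x)"] by simp
qed

text \<open>
  The classes of the constant functions are the elements \<open>Inl m\<close>. All others fit into the second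
  copy of \<open>'a\<close>, because a definable function is coded by a formula number and one parameter.
\<close>

definition uclass :: "('a \<Rightarrow> 'a) \<Rightarrow> 'a + 'a" where
  "uclass f = (if \<exists>m\<in>U. eqU f (\<lambda>_. m) then Inl (SOME m. m \<in> U \<and> eqU f (\<lambda>_. m))
     else Inr (fcode (SOME g. g \<in> Fn \<and> eqU f g)))"

lemma uclass_const:
  assumes "m \<in> U" "eqU f (\<lambda>_. m)"
  shows "uclass f = Inl m"
proof -
  have "k = m" if "eqU f (\<lambda>_. k)" for k
    using eqU_trans[OF eqU_sym[OF assms(2)] that] by (simp add: eqU_def UF_const)
  then have "(SOME m. m \<in> U \<and> eqU f (\<lambda>_. m)) = m"
    using assms by (intro some_equality) blast+
  then show ?thesis
    using assms unfolding uclass_def by auto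
qed

lemma uclass_cong:
  assumes "eqU f g"
  shows "uclass f = uclass g"
proof -
  have "eqU f h \<longleftrightarrow> eqU g h" for h
    using assms eqU_sym eqU_trans by blast
  then show ?thesis
    by (simp add: uclass_def)
qed

lemma uclass_eqD:
  assumes "f \<in> Fn" "g \<in> Fn" "uclass f = uclass g"
  shows "eqU f g"
proof (cases "\<exists>m\<in>U. eqU f (\<lambda>_. m)")
  case True
  then obtain m where m: "m \<in> U" "eqU f (\<lambda>_. m)" by blast
  then have "uclass g = Inl m"
    using uclass_const assms(3) by simp
  then obtain k where k: "k \<in> U" "eqU g (\<lambda>_. k)"
    unfolding uclass_def by (auto split: if_splits)
  then have "k = m"
    using uclass_const \<open>uclass g = Inl m\<close> by auto
  then show ?thesis
    using m k eqU_sym eqU_trans by blast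
next
  case False
  have some: "(SOME h. h \<in> Fn \<and> eqU f h) \<in> Fn \<and> eqU f (SOME h. h \<in> Fn \<and> eqU f h)" if "f \<in> Fn" for f
    using someI[of "\<lambda>h. h \<in> Fn \<and> eqU f h" f] that eqU_refl by blast
  \<comment> \<open>The code is taken of a representative that depends on the class alone, so equal
    codes give representatives that agree on \<open>U\<close>.\<close>
  let ?f = "SOME h. h \<in> Fn \<and> eqU f h" and ?g = "SOME h. h \<in> Fn \<and> eqU g h"
  have "uclass f = Inr (fcode ?f)"
    using False by (simp add: uclass_def)
  moreover from this assms(3) have "uclass g = Inr (fcode ?g)"
    unfolding uclass_def[of g] by (auto split: if_splits)
  ultimately have "fcode ?f = fcode ?g"
    using assms(3) by simp
  then have "\<And>x. x \<in> U \<Longrightarrow> ?f x = ?g x"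
    using fcode_inj some assms by blast
  then have "eqU ?f ?g"
    by (rule eqUI)
  then show ?thesis
    using some[OF assms(1)] some[OF assms(2)] eqU_sym eqU_trans by blast
qed

text \<open>A section of \<open>uclass\<close> on \<open>univ N\<close>. Taking the constant
  function itself at \<open>Inl m\<close> reduces truth at elements of \<open>M\<close> to
  \<open>UF_const\<close>.\<close>

definition rep :: "'a + 'a \<Rightarrow> 'a \<Rightarrow> 'a" where
  "rep a = (case a of Inl m \<Rightarrow> (\<lambda>_. m) | Inr e \<Rightarrow> (SOME f. f \<in> Fn \<and> uclass f = Inr e))"

definition N :: "('a + 'a) set_struct" where
  "N = \<lparr>univ = uclass ` Fn, rel = (\<lambda>a b. UF (\<lambda>x. rel M (rep a x) (rep b x)))\<rparr>"

lemma univ_N: "univ N = uclass ` Fn"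
  and rel_N: "rel N a b \<longleftrightarrow> UF (\<lambda>x. rel M (rep a x) (rep b x))"
  by (simp_all add: N_def)

lemma rep_Inl[simp]: "rep (Inl m) = (\<lambda>_. m)"
  by (simp add: rep_def)

lemma Inl_N: "Inl m \<in> univ N \<longleftrightarrow> m \<in> U"
proof
  assume "Inl m \<in> univ N"
  then obtain f where "f \<in> Fn" "uclass f = Inl m"
    by (auto simp: univ_N)
  then obtain k where "k \<in> U" "eqU f (\<lambda>_. k)"
    unfolding uclass_def by (auto split: if_splits)
  then show "m \<in> U"
    using uclass_const \<open>uclass f = Inl m\<close> by auto
next
  assume "m \<in> U"
  then show "Inl m \<in> univ N"
    using uclass_const[OF _ eqU_refl] Fn_const unfolding univ_N by force
qed

lemma rep_props:
  assumes "a \<in> univ N"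
  shows rep_Fn: "rep a \<in> Fn" and uclass_rep: "uclass (rep a) = a"
proof -
  have "rep a \<in> Fn \<and> uclass (rep a) = a"
  proof (cases a)
    case (Inl m)
    then show ?thesis
      using assms Inl_N Fn_const uclass_const[OF _ eqU_refl] by auto
  next
    case (Inr e)
    have "\<exists>f. f \<in> Fn \<and> uclass f = Inr e"
      using assms Inr by (auto simp: univ_N)
    from someI_ex[OF this] show ?thesis
      by (simp add: rep_def Inr)
  qed
  then show "rep a \<in> Fn" "uclass (rep a) = a"
    by simp_all
qed

lemma rep_uclass: "f \<in> Fn \<Longrightarrow> eqU (rep (uclass f)) f"
  by (rule uclass_eqD) (simp_all add: univ_N rep_Fn uclass_rep)

lemma dfn_rep_sat:
  assumes "\<And>i. s i \<in> univ N" "tmd f"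
  shows "dfn (\<lambda>r. sat M (\<lambda>i. rep (s i) (f r)) \<phi>)"
  by (rule dfn_sat) (rule Fn_tmd[OF rep_Fn[OF assms(1)] assms(2)])

lemma dfn_rep_sat_case:
  assumes "\<And>i. s i \<in> univ N" "tmd f" "tmd g"
  shows "dfn (\<lambda>r. sat M (case_nat (g r) (\<lambda>i. rep (s i) (f r))) \<phi>)"
proof -
  let ?f = "case_nat g (\<lambda>i r. rep (s i) (f r))"
  have "tmd (?f i)" for i
    using assms by (cases i) (simp_all add: Fn_tmd rep_Fn)
  from dfn_sat[of ?f, OF this] have "dfn (\<lambda>r. sat M (\<lambda>i. ?f i r) \<phi>)" .
  moreover have "(\<lambda>i. ?f i r) = case_nat (g r) (\<lambda>i. rep (s i) (f r))" for r
    by (rule ext) (simp split: nat.split)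
  ultimately show ?thesis
    by simp
qed

text \<open>Negation uses that definable classes are decided; the existential step needs a definable
  function that picks witnesses, and \<open>skolem\<close> provides it.\<close>

theorem los:
  assumes "\<And>i. s i \<in> univ N"
  shows "sat N s \<phi> \<longleftrightarrow> UF (\<lambda>x. sat M (\<lambda>i. rep (s i) x) \<phi>)"
  using assms
proof (induction \<phi> arbitrary: s)
  case (FEq i j)
  then show ?case
    using uclass_cong[of "rep (s i)" "rep (s j)"] uclass_rep[of "s i"] uclass_rep[of "s j"] UF_const[of True]
    by (auto simp: eqU_def)
next
  case (FMem i j)
  then show ?case
    by (simp add: rel_N)
next
  case (FNeg \<phi>)
  then show ?case
    using UF_not[OF dfn_rep_sat[OF FNeg.prems tmd_var]] by simp
next
  case (FAnd \<phi> \<psi>)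
  then show ?case
    by (simp add: UF_conj_iff)
next
  case (FEx \<phi>)
  let ?P = "\<lambda>x a. sat M (case_nat a (\<lambda>i. rep (s i) x)) \<phi>"
  have IH: "sat N (case_nat a s) \<phi> \<longleftrightarrow> UF (\<lambda>x. ?P x (rep a x))" if "a \<in> univ N" for a
  proof -
    have "(\<lambda>i. rep (case_nat a s i) x) = case_nat (rep a x) (\<lambda>i. rep (s i) x)" for x
      by (rule ext) (simp split: nat.split)
    then show ?thesis
      using FEx.IH[of "case_nat a s"] FEx.prems that by (simp split: nat.split)
  qed
  show ?case
  proof
    assume "sat N s (FEx \<phi>)"
    then obtain a where "a \<in> univ N" "UF (\<lambda>x. ?P x (rep a x))"
      using IH by auto
    then show "UF (\<lambda>x. sat M (\<lambda>i. rep (s i) x) (FEx \<phi>))"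
      using Fn_in[OF rep_Fn] by (elim UF_mono) auto
  next
    assume ex: "UF (\<lambda>x. sat M (\<lambda>i. rep (s i) x) (FEx \<phi>))"
    obtain g where g: "g \<in> Fn" "\<forall>x\<in>U. (\<exists>a\<in>U. ?P x a) \<longrightarrow> ?P x (g x)"
      using skolem[of ?P, OF dfn_rep_sat_case[OF FEx.prems tmd_var tmd_var]] by blast
    have "UF (\<lambda>x. ?P x (g x))"
      using ex g(2) by (elim UF_mono) simp
    \<comment> \<open>\<open>g\<close> is replaced by the representative of its class, which agrees
      with it on a large set.\<close>
    then have "UF (\<lambda>x. ?P x (rep (uclass g) x))"
      using rep_uclass[OF g(1), unfolded eqU_def] by (rule UF_mono[OF UF_conj]) auto
    then show "sat N s (FEx \<phi>)"
      using IH[of "uclass g"] g(1) by (auto simp: univ_N)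
  qed
qed

lemma los_const:
  assumes "env t"
  shows "sat N (Inl \<circ> t) \<phi> \<longleftrightarrow> sat M t \<phi>"
  using los[of "Inl \<circ> t" \<phi>] assms by (simp add: Inl_N env_app UF_const)

lemma N_substructure: "substructure (struct_image Inl M) N"
  unfolding substructure_def struct_image_def by (auto simp: Inl_N rel_N UF_const)

lemma N_elementary: "elementary_extension (struct_image Inl M) N"
  unfolding elementary_extension_def
proof (intro conjI allI impI N_substructure)
  fix \<phi> and s :: "nat \<Rightarrow> 'a + 'a"
  assume "range s \<subseteq> univ (struct_image Inl M)"
  then have "\<forall>i. \<exists>m\<in>U. s i = Inl m"
    by (auto simp: struct_image_def)
  then obtain t where t: "\<And>i. t i \<in> U" "\<And>i. s i = Inl (t i)"
    by metis
  then have s: "s = Inl \<circ> t"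
    by auto
  show "sat (struct_image Inl M) s \<phi> \<longleftrightarrow> sat N s \<phi>"
    unfolding s using los_const[of t] sat_struct_image[of Inl M t \<phi>] t(1)
    by (auto simp: env_def)
qed

text \<open>By \<open>los\<close>, \<open>Inl m\<close> lies in \<open>D\<close> iff the class of
  all \<open>x\<close> satisfying \<phi> at \<open>m\<close> and the values at \<open>x\<close> of
  the representing functions is large; \<open>UF_dfn\<close> makes this condition on
  \<open>m\<close> definable in \<open>M\<close>.\<close>

lemma N_conservative: "conservative_extension (struct_image Inl M) N"
  unfolding conservative_extension_def
proof (intro conjI allI impI N_substructure)
  fix D assume "definable N D"
  then obtain \<phi> s where s: "range s \<subseteq> univ N" and D: "D = {a \<in> univ N. sat N (case_nat a s) \<phi>}"
    unfolding definable_def by blast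
  have s_in: "s i \<in> univ N" for i
    using s by auto
  define P where "P m \<longleftrightarrow> UF (\<lambda>x. sat M (case_nat m (\<lambda>i. rep (s i) x)) \<phi>)" for m
  have "dfn (\<lambda>r. P (r 0))"
    \<comment> \<open>In the predicate passed to \<open>UF_dfn\<close>, the index \<open>x\<close>
      is variable 0 and \<open>m\<close> is variable 1.\<close>
    using UF_dfn[OF dfn_rep_sat_case[of s "\<lambda>r. r 0" "\<lambda>r. r 1" \<phi>, OF s_in tmd_var tmd_var]]
    by (simp add: P_def)
  then obtain \<psi> t where t: "env t" "\<And>m. m \<in> U \<Longrightarrow> P m \<longleftrightarrow> sat M (case_nat m t) \<psi>"
    by (rule dfn_unary) (rule that, assumption, blast)
  have "Inl m \<in> D \<longleftrightarrow> sat (struct_image Inl M) (case_nat (Inl m) (Inl \<circ> t)) \<psi>" if m: "m \<in> U" for m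
  proof -
    have "(\<lambda>i. rep (case_nat (Inl m) s i) x) = case_nat m (\<lambda>i. rep (s i) x)" for x
      by (rule ext) (simp split: nat.split)
    then have "Inl m \<in> D \<longleftrightarrow> P m"
      using los[of "case_nat (Inl m) s" \<phi>] s_in m
      by (simp add: D Inl_N P_def split: nat.split)
    also have "\<dots> \<longleftrightarrow> sat M (case_nat m t) \<psi>"
      using t(2) m by simp
    also have "\<dots> \<longleftrightarrow> sat (struct_image Inl M) (Inl \<circ> case_nat m t) \<psi>"
      using env_case[OF m t(1)] by (intro sat_struct_image[symmetric]) (auto simp: env_def)
    also have "Inl \<circ> case_nat m t = case_nat (Inl m) (Inl \<circ> t)"
      by (rule ext) (simp split: nat.split)
    finally show ?thesis .
  qed
  then have "D \<inter> univ (struct_image Inl M)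
      = {a \<in> univ (struct_image Inl M). sat (struct_image Inl M) (case_nat a (Inl \<circ> t)) \<psi>}"
    by (auto simp: struct_image_def)
  moreover have "range (Inl \<circ> t) \<subseteq> univ (struct_image Inl M)"
    using t(1) by (auto simp: struct_image_def env_def)
  ultimately show "definable (struct_image Inl M) (D \<inter> univ (struct_image Inl M))"
    unfolding definable_def by blast
qed

text \<open>The class of all \<open>x\<close> having \<open>m\<close> as a member is large by
  \<open>UF_tall\<close>, and the representative of the class of the identity agrees with the
  identity on a large set.\<close>

lemma N_taller: "taller (struct_image Inl M) N"
  unfolding taller_def
proof (rule bexI[of _ "uclass (\<lambda>x. x)"])
  show "uclass (\<lambda>x. x) \<in> univ N"
    using Fn_id by (simp add: univ_N)
  have "rel N (Inl m) (uclass (\<lambda>x. x))" if "m \<in> U" for m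
    unfolding rel_N
    by (rule UF_mono[OF UF_conj[OF UF_tall[OF that] rep_uclass[OF Fn_id, unfolded eqU_def]]]) simp
  then show "univ (struct_image Inl M) \<subseteq> Ext N (uclass (\<lambda>x. x))"
    by (auto simp: struct_image_def Ext_def Inl_N)
qed

end

theorem theorem3p1:
  fixes M :: "'a set_struct"
  assumes "ZF_model M" and "satisfies_ex_V_eq_HOD M"
  shows "\<exists>N :: ('a + 'a) set_struct.
    elementary_extension (struct_image Inl M) N \<and>
    conservative_extension (struct_image Inl M) N \<and>
    taller (struct_image Inl M) N"
proof -
  have "univ M \<noteq> {}"
    using assms(1)[unfolded ZF_model_def, THEN conjunct2, THEN conjunct2, THEN conjunct2,
        THEN conjunct2, THEN conjunct2, THEN conjunct1] by blast
  then interpret zf M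
    using assms(1) by unfold_locales
  obtain L where L: "dfn (\<lambda>s. L (s 0) (s 1))" "dwo (\<lambda>_. True) L"
    "\<And>y. y \<in> U \<Longrightarrow> isset {x \<in> U. L x y}"
    using definable_wellorder[OF assms(2)] by blast
  interpret zf_wo M L
    using L by unfold_locales
  obtain UF where UF:
    "\<forall>X Y. UF X \<longrightarrow> (\<forall>x\<in>U. X x \<longrightarrow> Y x) \<longrightarrow> UF Y"
    "\<forall>X Y. UF X \<longrightarrow> UF Y \<longrightarrow> UF (\<lambda>x. X x \<and> Y x)"
    "\<not> UF (\<lambda>x. False)"
    "\<forall>Q. dfn Q \<longrightarrow> dfn (\<lambda>s. UF (\<lambda>x. Q (case_nat x s)))"
    "\<forall>Q s. dfn Q \<longrightarrow> env s \<longrightarrow> UF (\<lambda>x. Q (case_nat x s)) \<or> UF (\<lambda>x. \<not> Q (case_nat x s))"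
    "\<forall>m\<in>U. UF (\<lambda>x. rel M m x)"
    using definable_ultrafilter by (elim exE conjE)
  interpret zf_uf M L UF
  proof
    show "UF Y" if "UF X" "\<And>x. x \<in> U \<Longrightarrow> X x \<Longrightarrow> Y x" for X Y
      using UF(1)[rule_format, OF that] .
    show "UF (\<lambda>x. X x \<and> Y x)" if "UF X" "UF Y" for X Y
      using UF(2)[rule_format, OF that] .
    show "\<not> UF (\<lambda>x. False)"
      by (fact UF(3))
    show "dfn (\<lambda>s. UF (\<lambda>x. Q (case_nat x s)))" if "dfn Q" for Q
      using UF(4)[rule_format, OF that] .
    show "UF (\<lambda>x. Q (case_nat x s)) \<or> UF (\<lambda>x. \<not> Q (case_nat x s))" if "dfn Q" "env s" for Q s
      using UF(5)[rule_format, OF that] .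
    show "UF (\<lambda>x. rel M m x)" if "m \<in> U" for m
      using UF(6)[rule_format, OF that] .
  qed
  show ?thesis
    using N_elementary N_conservative N_taller by blast
qed

end
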